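(* Let $n$ and $\tau$ be positive integers. For a partition $\lambda\vdash n$ put $$c_\lambda=\prod_{(i,j)\in\lambda}(\tau+2j-1-i),$$ where the product runs over the boxes $(i,j)$ ($i$ = row, $j$ = column) of the Young diagram of $\lambda$, and define $$W=\sum_{\substack{\lambda\vdash n\\ c_\lambda\neq 0}} c_\lambda^{-1}\,P_{2\lambda}\in\mathbb{C}[\mathcal{S}_{2n}].$$ Then the Weingarten matrix $\mathbf{W}$ of the orthogonal group $O(\tau)$, i.e. the pseudo-inverse of the Gram matrix $\mathbf{G}=(\mathbf{G}_{\pi,\pi'})_{\pi,\pi'\in\mathcal{B}_n}$, is the matrix, in the standard basis of $\mathbb{C}[\mathcal{B}_n]$, of $W$ acting by multiplication on the left or on the right on $\mathbb{C}[\mathcal{B}_n]$ (the two actions coincide, since the $P_{2\lambda}$ are central).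
   Context: $\mathcal{S}_{2n}$ is the symmetric group on $\{1,\ldots,2n\}$, with product $(\sigma\rho)(i)=\sigma(\rho(i))$, and $\mathbb{C}[\mathcal{S}_{2n}]$ is its group algebra; $s_{i,j}$ denotes the transposition of $i$ and $j$. $\mathcal{B}_n$ is the set of fixed-point-free involutions of $\{1,\ldots,2n\}$ (equivalently, perfect pairings). $\mathcal{S}_{2n}$ acts on $\mathcal{B}_n$ transitively by conjugation. Let $\beta_n=s_{1,2}s_{3,4}\cdots s_{2n-1,2n}\in\mathcal{B}_n$, and let $\mathcal{H}_n\subset\mathcal{S}_{2n}$ be the stabilizer of $\beta_n$ (the hyperoctahedral group). Put $P_{\mathcal{H}_n}=\frac{1}{|\mathcal{H}_n|}\sum_{h\in\mathcal{H}_n}h$. $\mathbb{C}[\mathcal{B}_n]$ denotes the subspace of $x\in\mathbb{C}[\mathcal{S}_{2n}]$ with $xh=x$ for all $h\in\mathcal{H}_n$, i.e. $\mathbb{C}[\mathcal{S}_{2n}]P_{\mathcal{H}_n}$. Its standard basis is $(b_\pi)_{\pi\in\mathcal{B}_n}$, $b_\pi=\sigma P_{\mathcal{H}_n}$ where $\sigma\in\mathcal{S}_{2n}$ is any permutation with $\sigma\beta_n\sigma^{-1}=\pi$. The matrix $M$ of an operator $L$ on $\mathbb{C}[\mathcal{B}_n]$ is given by $L b_\pi=\sum_{\pi'}M_{\pi',\pi}b_{\pi'}$. The Gram matrix is $\mathbf{G}_{\pi,\pi'}=\tau^{\frac12(\text{number of cycles of }\pi\pi')}$ for $\pi,\pi'\in\mathcal{B}_n$,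 where fixed points count as cycles. (It is the Gram matrix of the generators, indexed by the pairings $\pi\in\mathcal{B}_n$, of the $O(\tau)$-invariant subspace of $(\mathbb{C}^\tau)^{\otimes 2n}$.) The pseudo-inverse of $\mathbf{G}$ is the symmetric matrix $\mathbf{W}$ such that $\mathbf{G}\mathbf{W}\mathbf{G}=\mathbf{G}$ and $\mathbf{W}\mathbf{G}\mathbf{W}=\mathbf{W}$; if $\mathbf{G}$ is invertible, $\mathbf{W}=\mathbf{G}^{-1}$. For $\lambda=(\lambda_1,\lambda_2,\ldots)\vdash n$, $2\lambda=(2\lambda_1,2\lambda_2,\ldots)\vdash 2n$. For $\mu\vdash 2n$, $P_\mu$ is the central idempotent of $\mathbb{C}[\mathcal{S}_{2n}]$ associated to the irreducible representation indexed by $\mu$: $P_\mu=\frac{\chi_\mu(1)}{|\mathcal{S}_{2n}|}\sum_{\sigma\in\mathcal{S}_{2n}}\chi_\mu(\sigma^{-1})\sigma$, where $\chi_\mu$ is the irreducible character (convention: the one-row partition $(2n)$ corresponds to the trivial representation).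
   Formalization: The pseudo-inverse is taken to be the Moore–Penrose one: GW and WG are also required to be symmetric, since for singular G the conditions that W is symmetric, GWG=G and WGW=W do not determine W (e.g. n=2, τ=1). *)

theory Defs
  imports
    Complex_Main
    "HOL-Library.Function_Algebras"
    "HOL-Combinatorics.Combinatorics"
begin

section \<open>Complex-valued functions as a vector space\<close>

definition fscale :: "complex \<Rightarrow> ('a \<Rightarrow> complex) \<Rightarrow> 'a \<Rightarrow> complex"  (infixr "*\<^sub>C" 75)
  where "c *\<^sub>C x = (\<lambda>s. c * x s)"

interpretation fun_vs: vector_space "fscale :: complex \<Rightarrow> ('a \<Rightarrow> complex) \<Rightarrow> 'a \<Rightarrow> complex"
  by unfold_locales (auto simp: fscale_def fun_eq_iff algebra_simps)

text \<open>Trace of an operator \<open>f\<close> on a subspace \<open>U\<close> that it maps into itself: the sum of the diagonal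
  entries of its matrix in a basis of \<open>U\<close>; for \<open>U\<close> of finite dimension the choice of basis does not
  matter.\<close>

definition trace_on ::
    "('a \<Rightarrow> complex) set \<Rightarrow> (('a \<Rightarrow> complex) \<Rightarrow> ('a \<Rightarrow> complex)) \<Rightarrow> complex"
  where "trace_on U f =
    (let B = (SOME B. fun_vs.independent B \<and> fun_vs.span B = U)
     in \<Sum>b\<in>B. fun_vs.representation B (f b) b)"


section \<open>The group algebra of the symmetric group on \<open>{1..m}\<close>\<close>

text \<open>An element \<open>\<Sum>\<^sub>\<sigma> x(\<sigma>) \<sigma>\<close> is the function \<open>x\<close>, which vanishes off the group.\<close>

type_synonym galg = "(nat \<Rightarrow> nat) \<Rightarrow> complex"

definition symgrp :: "nat \<Rightarrow> (nat \<Rightarrow> nat) set"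
  where "symgrp m = {\<sigma>. \<sigma> permutes {1..m}}"

definition group_algebra :: "nat \<Rightarrow> galg set"
  where "group_algebra m = {x. \<forall>\<sigma>. \<sigma> \<notin> symgrp m \<longrightarrow> x \<sigma> = 0}"

definition gelem :: "(nat \<Rightarrow> nat) \<Rightarrow> galg"
  where "gelem \<sigma> = (\<lambda>\<rho>. if \<rho> = \<sigma> then 1 else 0)"

definition gmult :: "nat \<Rightarrow> galg \<Rightarrow> galg \<Rightarrow> galg"
  where "gmult m x y =
    (\<Sum>\<sigma>\<in>symgrp m. \<Sum>\<rho>\<in>symgrp m. (x \<sigma> * y \<rho>) *\<^sub>C gelem (\<sigma> \<circ> \<rho>))"


section \<open>Partitions and irreducible characters\<close>

definition partitions :: "nat \<Rightarrow> nat list set"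
  where "partitions m = {\<mu>. sorted_wrt (\<ge>) \<mu> \<and> 0 \<notin> set \<mu> \<and> sum_list \<mu> = m}"

definition boxes :: "nat list \<Rightarrow> (nat \<times> nat) set"
  where "boxes \<mu> = {(i, j). 1 \<le> i \<and> i \<le> length \<mu> \<and> 1 \<le> j \<and> j \<le> \<mu> ! (i - 1)}"

text \<open>The tableau of shape \<open>\<mu>\<close> filled with \<open>1, 2, \<dots>\<close> row by row.\<close>

definition tableau :: "nat list \<Rightarrow> nat \<times> nat \<Rightarrow> nat"
  where "tableau \<mu> = (\<lambda>(i, j). sum_list (take (i - 1) \<mu>) + j)"

definition row_group :: "nat \<Rightarrow> nat list \<Rightarrow> (nat \<Rightarrow> nat) set"
  where "row_group m \<mu> = {\<sigma> \<in> symgrp m. \<forall>(i, j) \<in> boxes \<mu>.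
    \<exists>j'. (i, j') \<in> boxes \<mu> \<and> \<sigma> (tableau \<mu> (i, j)) = tableau \<mu> (i, j')}"

definition col_group :: "nat \<Rightarrow> nat list \<Rightarrow> (nat \<Rightarrow> nat) set"
  where "col_group m \<mu> = {\<sigma> \<in> symgrp m. \<forall>(i, j) \<in> boxes \<mu>.
    \<exists>i'. (i', j) \<in> boxes \<mu> \<and> \<sigma> (tableau \<mu> (i, j)) = tableau \<mu> (i', j)}"

definition young_symmetrizer :: "nat \<Rightarrow> nat list \<Rightarrow> galg"
  where "young_symmetrizer m \<mu> =
    gmult m (\<Sum>p\<in>row_group m \<mu>. gelem p)
            (\<Sum>q\<in>col_group m \<mu>. of_int (sign q) *\<^sub>C gelem q)"

text \<open>The irreducible representation indexed by \<open>\<mu>\<close> is the left ideal generated by the Young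
  symmetrizer (rows symmetrized, columns antisymmetrized), so that \<open>[m]\<close> gives the trivial
  representation and \<open>[1, \<dots>, 1]\<close> the sign representation.\<close>

definition specht_module :: "nat \<Rightarrow> nat list \<Rightarrow> galg set"
  where "specht_module m \<mu> = (\<lambda>x. gmult m x (young_symmetrizer m \<mu>)) ` group_algebra m"

definition irr_char :: "nat \<Rightarrow> nat list \<Rightarrow> (nat \<Rightarrow> nat) \<Rightarrow> complex"
  where "irr_char m \<mu> \<sigma> = trace_on (specht_module m \<mu>) (gmult m (gelem \<sigma>))"

definition central_idempotent :: "nat \<Rightarrow> nat list \<Rightarrow> galg"
  where "central_idempotent m \<mu> =
    (irr_char m \<mu> id / of_nat (card (symgrp m))) *\<^sub>C
      (\<Sum>\<sigma>\<in>symgrp m. irr_char m \<mu> (inv \<sigma>) *\<^sub>C gelem \<sigma>)"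


section \<open>Pairings\<close>

definition pairings :: "nat \<Rightarrow> (nat \<Rightarrow> nat) set"
  where "pairings n =
    {\<pi> \<in> symgrp (2 * n). \<pi> \<circ> \<pi> = id \<and> (\<forall>i\<in>{1..2 * n}. \<pi> i \<noteq> i)}"

primrec base_pairing :: "nat \<Rightarrow> nat \<Rightarrow> nat"
  where
    "base_pairing 0 = id"
  | "base_pairing (Suc n) = base_pairing n \<circ> transpose (2 * n + 1) (2 * n + 2)"

definition hyperoctahedral :: "nat \<Rightarrow> (nat \<Rightarrow> nat) set"
  where "hyperoctahedral n =
    {h \<in> symgrp (2 * n). h \<circ> base_pairing n \<circ> inv h = base_pairing n}"

definition hyper_proj :: "nat \<Rightarrow> galg"
  where "hyper_proj n =
    (1 / of_nat (card (hyperoctahedral n))) *\<^sub>C (\<Sum>h\<in>hyperoctahedral n. gelem h)"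

definition pairing_space :: "nat \<Rightarrow> galg set"
  where "pairing_space n =
    {x \<in> group_algebra (2 * n). \<forall>h\<in>hyperoctahedral n. gmult (2 * n) x (gelem h) = x}"

text \<open>The choice of \<open>\<sigma>\<close> is immaterial: see \<open>std_basis_eq\<close> below.\<close>

definition std_basis :: "nat \<Rightarrow> (nat \<Rightarrow> nat) \<Rightarrow> galg"
  where "std_basis n \<pi> =
    gmult (2 * n)
      (gelem (SOME \<sigma>. \<sigma> \<in> symgrp (2 * n) \<and> \<sigma> \<circ> base_pairing n \<circ> inv \<sigma> = \<pi>))
      (hyper_proj n)"

text \<open>Matrices indexed by pairings are functions of two arguments; only the entries indexed by
  elements of \<open>pairings n\<close> are relevant.\<close>

type_synonym pmat = "(nat \<Rightarrow> nat) \<Rightarrow> (nat \<Rightarrow> nat) \<Rightarrow> complex"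

definition is_matrix_of :: "nat \<Rightarrow> (galg \<Rightarrow> galg) \<Rightarrow> pmat \<Rightarrow> bool"
  where "is_matrix_of n L M \<longleftrightarrow>
    (\<forall>\<pi>\<in>pairings n. L (std_basis n \<pi>) = (\<Sum>\<pi>'\<in>pairings n. M \<pi>' \<pi> *\<^sub>C std_basis n \<pi>'))"


section \<open>Gram matrix and pseudo-inverse\<close>

definition num_cycles :: "nat \<Rightarrow> (nat \<Rightarrow> nat) \<Rightarrow> nat"
  where "num_cycles m \<sigma> = card (orbit \<sigma> ` {1..m})"

definition gram :: "nat \<Rightarrow> nat \<Rightarrow> pmat"
  where "gram n \<tau> \<pi> \<pi>' =
    complex_of_real (real \<tau> powr (1 / 2 * real (num_cycles (2 * n) (\<pi> \<circ> \<pi>'))))"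

definition mmult_on :: "'i set \<Rightarrow> ('i \<Rightarrow> 'i \<Rightarrow> complex) \<Rightarrow> ('i \<Rightarrow> 'i \<Rightarrow> complex) \<Rightarrow> 'i \<Rightarrow> 'i \<Rightarrow> complex"
  where "mmult_on I A B i j = (\<Sum>k\<in>I. A i k * B k j)"

definition mat_eq_on :: "'i set \<Rightarrow> ('i \<Rightarrow> 'i \<Rightarrow> complex) \<Rightarrow> ('i \<Rightarrow> 'i \<Rightarrow> complex) \<Rightarrow> bool"
  where "mat_eq_on I A B \<longleftrightarrow> (\<forall>i\<in>I. \<forall>j\<in>I. A i j = B i j)"

definition symmetric_on :: "'i set \<Rightarrow> ('i \<Rightarrow> 'i \<Rightarrow> complex) \<Rightarrow> bool"
  where "symmetric_on I A \<longleftrightarrow> (\<forall>i\<in>I. \<forall>j\<in>I. A i j = A j i)"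

text \<open>For symmetric \<open>G\<close>, the equations \<open>G W G = G\<close> and \<open>W G W = W\<close> together with symmetry of \<open>W\<close>
  do not determine \<open>W\<close> when \<open>G\<close> is singular (take \<open>G = diag(1, 0)\<close> and \<open>W\<close> with rows \<open>(1, a)\<close> and
  \<open>(a, a\<^sup>2)\<close>). The remaining Moore-Penrose conditions, symmetry of \<open>G W\<close> and \<open>W G\<close>, are what makes
  the pseudo-inverse unique: see \<open>is_pseudo_inverse_on_unique\<close> below.\<close>

definition is_pseudo_inverse_on ::
    "'i set \<Rightarrow> ('i \<Rightarrow> 'i \<Rightarrow> complex) \<Rightarrow> ('i \<Rightarrow> 'i \<Rightarrow> complex) \<Rightarrow> bool"
  where "is_pseudo_inverse_on I G W \<longleftrightarrow>
    symmetric_on I W \<and>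
    mat_eq_on I (mmult_on I (mmult_on I G W) G) G \<and>
    mat_eq_on I (mmult_on I (mmult_on I W G) W) W \<and>
    symmetric_on I (mmult_on I G W) \<and>
    symmetric_on I (mmult_on I W G)"

text \<open>The last conjunct only normalizes the irrelevant entries.\<close>

definition weingarten_matrix :: "nat \<Rightarrow> nat \<Rightarrow> pmat"
  where "weingarten_matrix n \<tau> =
    (THE W. is_pseudo_inverse_on (pairings n) (gram n \<tau>) W \<and>
            (\<forall>\<pi> \<pi>'. \<pi> \<notin> pairings n \<or> \<pi>' \<notin> pairings n \<longrightarrow> W \<pi> \<pi>' = 0))"


section \<open>The Weingarten element\<close>

definition content_prod :: "nat \<Rightarrow> nat list \<Rightarrow> complex"
  where "content_prod \<tau> \<nu> =
    (\<Prod>(i, j)\<in>boxes \<nu>. of_nat \<tau> + 2 * of_nat j - 1 - of_nat i)"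

definition weingarten_element :: "nat \<Rightarrow> nat \<Rightarrow> galg"
  where "weingarten_element n \<tau> =
    (\<Sum>\<nu> | \<nu> \<in> partitions n \<and> content_prod \<tau> \<nu> \<noteq> 0.
       inverse (content_prod \<tau> \<nu>) *\<^sub>C central_idempotent (2 * n) (map ((*) 2) \<nu>))"


section \<open>Well-definedness\<close>

lemma finite_symgrp: "finite (symgrp m)"
  unfolding symgrp_def by (rule finite_permutations) simp

lemma finite_pairings: "finite (pairings n)"
  by (rule finite_subset[OF _ finite_symgrp[of "2 * n"]]) (auto simp: pairings_def)

lemma finite_partitions: "finite (partitions m)"
proof (rule finite_subset)
  show "partitions m \<subseteq> {xs. set xs \<subseteq> {..m} \<and> length xs \<le> m}"
  proof
    fix xs assume xs: "xs \<in> partitions m"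
    have "length ys \<le> sum_list ys" if "0 \<notin> set ys" for ys :: "nat list"
      using that by (induction ys) auto
    then show "xs \<in> {xs. set xs \<subseteq> {..m} \<and> length xs \<le> m}"
      using xs by (auto simp: partitions_def intro: member_le_sum_list)
  qed
  show "finite {xs. set xs \<subseteq> {..m} \<and> length xs \<le> m}"
    by (rule finite_lists_length_le) simp
qed

lemma fun_sum_apply: "(\<Sum>i\<in>I. f i) s = (\<Sum>i\<in>I. f i s)"
  for f :: "'i \<Rightarrow> 'a \<Rightarrow> complex"
  by (induction I rule: infinite_finite_induct) auto

lemma gmult_apply:
  assumes "\<sigma> \<in> symgrp m"
  shows "gmult m x y \<sigma> = (\<Sum>\<rho>\<in>symgrp m. x \<rho> * y (inv \<rho> \<circ> \<sigma>))"
proof -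
  have "(\<Sum>\<rho>'\<in>symgrp m. if \<sigma> = \<rho> \<circ> \<rho>' then x \<rho> * y \<rho>' else 0) = x \<rho> * y (inv \<rho> \<circ> \<sigma>)"
    if \<rho>: "\<rho> \<in> symgrp m" for \<rho>
  proof -
    have bij: "bij \<rho>" using \<rho> by (auto simp: symgrp_def intro: permutes_bij)
    have "\<sigma> = \<rho> \<circ> \<rho>' \<longleftrightarrow> \<rho>' = inv \<rho> \<circ> \<sigma>" for \<rho>'
      using bij by (auto simp: fun_eq_iff bij_is_inj bij_is_surj surj_f_inv_f)
    moreover have "inv \<rho> \<circ> \<sigma> \<in> symgrp m"
      using \<rho> assms by (auto simp: symgrp_def intro: permutes_compose permutes_inv)
    ultimately show ?thesis by (simp add: finite_symgrp)
  qed
  then show ?thesis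
    by (simp add: gmult_def fun_sum_apply fscale_def gelem_def if_distrib cong: if_cong)
qed

lemma gmult_gelem_left:
  assumes "\<sigma> \<in> symgrp m"
  shows "gmult m (gelem \<sigma>) y = (\<lambda>\<rho>. if \<rho> \<in> symgrp m then y (inv \<sigma> \<circ> \<rho>) else 0)"
proof
  fix \<rho>
  show "gmult m (gelem \<sigma>) y \<rho> = (if \<rho> \<in> symgrp m then y (inv \<sigma> \<circ> \<rho>) else 0)"
  proof (cases "\<rho> \<in> symgrp m")
    case True
    then have "gmult m (gelem \<sigma>) y \<rho>
        = (\<Sum>s\<in>symgrp m. if s = \<sigma> then y (inv \<sigma> \<circ> \<rho>) else 0)"
      by (auto simp: gmult_apply gelem_def intro!: sum.cong)
    with True assms show ?thesis by (simp add: finite_symgrp)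
  next
    case False
    then have "\<rho> \<noteq> s \<circ> t" if "s \<in> symgrp m" "t \<in> symgrp m" for s t
      using that by (auto simp: symgrp_def intro: permutes_compose)
    with False show ?thesis
      by (auto simp: gmult_def fun_sum_apply fscale_def gelem_def intro!: sum.neutral)
  qed
qed

lemma std_basis_eq:
  assumes \<sigma>: "\<sigma> \<in> symgrp (2 * n)" and conj: "\<sigma> \<circ> base_pairing n \<circ> inv \<sigma> = \<pi>"
  shows "std_basis n \<pi> = gmult (2 * n) (gelem \<sigma>) (hyper_proj n)"
proof -
  have fin: "finite (hyperoctahedral n)"
    by (rule finite_subset[OF _ finite_symgrp[of "2 * n"]]) (auto simp: hyperoctahedral_def)
  have hp: "hyper_proj n s =
      (if s \<in> hyperoctahedral n then 1 / of_nat (card (hyperoctahedral n)) else 0)" for s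
    using fin by (simp add: hyper_proj_def fscale_def fun_sum_apply gelem_def)
  have mem: "inv s \<circ> r \<in> hyperoctahedral n \<longleftrightarrow> r \<circ> base_pairing n \<circ> inv r = \<pi>"
    if s: "s \<in> symgrp (2 * n)" "s \<circ> base_pairing n \<circ> inv s = \<pi>" and r: "r \<in> symgrp (2 * n)"
    for s r
  proof -
    have b: "bij s" "bij r" using s r by (auto simp: symgrp_def intro: permutes_bij)
    have inv: "inv (inv s \<circ> r) = inv r \<circ> s"
      using b by (simp add: o_inv_distrib bij_imp_bij_inv inv_inv_eq)
    have "inv s \<circ> r \<in> symgrp (2 * n)"
      using s r by (auto simp: symgrp_def intro: permutes_compose permutes_inv)
    then have "inv s \<circ> r \<in> hyperoctahedral n \<longleftrightarrow>
        inv s \<circ> (r \<circ> base_pairing n \<circ> inv r) \<circ> s = base_pairing n"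
      by (simp add: hyperoctahedral_def inv comp_assoc)
    also have "\<dots> \<longleftrightarrow> r \<circ> base_pairing n \<circ> inv r = s \<circ> base_pairing n \<circ> inv s"
    proof
      assume "inv s \<circ> (r \<circ> base_pairing n \<circ> inv r) \<circ> s = base_pairing n"
      then have "s \<circ> (inv s \<circ> (r \<circ> base_pairing n \<circ> inv r) \<circ> s) \<circ> inv s
          = s \<circ> base_pairing n \<circ> inv s" by simp
      then show "r \<circ> base_pairing n \<circ> inv r = s \<circ> base_pairing n \<circ> inv s"
        using b by (simp add: fun_eq_iff bij_is_surj surj_f_inv_f)
    next
      assume "r \<circ> base_pairing n \<circ> inv r = s \<circ> base_pairing n \<circ> inv s"
      then show "inv s \<circ> (r \<circ> base_pairing n \<circ> inv r) \<circ> s = base_pairing n"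
        using b by (simp add: fun_eq_iff bij_is_inj)
    qed
    finally show ?thesis using s by simp
  qed
  let ?s = "SOME \<sigma>. \<sigma> \<in> symgrp (2 * n) \<and> \<sigma> \<circ> base_pairing n \<circ> inv \<sigma> = \<pi>"
  have s: "?s \<in> symgrp (2 * n) \<and> ?s \<circ> base_pairing n \<circ> inv ?s = \<pi>"
    by (rule someI[of _ \<sigma>]) (use assms in auto)
  show ?thesis
    unfolding std_basis_def
    using s assms by (auto simp: gmult_gelem_left hp mem fun_eq_iff[where ?'a = "nat \<Rightarrow> nat" and ?'b = complex])
qed

lemma mmult_on_assoc: "mmult_on I (mmult_on I A B) C = mmult_on I A (mmult_on I B C)"
proof (intro ext)
  fix i j
  have "mmult_on I (mmult_on I A B) C i j = (\<Sum>k\<in>I. \<Sum>l\<in>I. A i l * B l k * C k j)"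
    by (simp add: mmult_on_def sum_distrib_right)
  also have "\<dots> = (\<Sum>l\<in>I. \<Sum>k\<in>I. A i l * B l k * C k j)"
    by (rule sum.swap)
  also have "\<dots> = mmult_on I A (mmult_on I B C) i j"
    by (simp add: mmult_on_def sum_distrib_left mult.assoc)
  finally show "mmult_on I (mmult_on I A B) C i j = mmult_on I A (mmult_on I B C) i j" .
qed

lemma is_pseudo_inverse_on_unique:
  assumes G: "symmetric_on I G"
    and V: "is_pseudo_inverse_on I G V" and W: "is_pseudo_inverse_on I G W"
  shows "mat_eq_on I V W"
proof -
  define R :: "('a \<Rightarrow> 'a \<Rightarrow> complex) \<Rightarrow> 'a \<Rightarrow> 'a \<Rightarrow> complex"
    where "R A = (\<lambda>i j. if i \<in> I \<and> j \<in> I then A i j else 0)" for A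
  define m where "m = mmult_on I"
  have assoc: "m (m A B) C = m A (m B C)" for A B C
    by (simp add: m_def mmult_on_assoc)
  have R_m: "R (m A B) = m (R A) (R B)" for A B
    by (auto simp: R_def m_def mmult_on_def fun_eq_iff)
  have R_eq: "mat_eq_on I A B \<longleftrightarrow> R A = R B" for A B
    by (auto simp: mat_eq_on_def R_def fun_eq_iff)
  have comm: "m (R G) (R X) = m (R X) (R G)"
    if X: "is_pseudo_inverse_on I G X" for X
  proof -
    have "mat_eq_on I (m G X) (m X G)"
      using X G by (auto simp: is_pseudo_inverse_on_def symmetric_on_def mat_eq_on_def m_def
          mmult_on_def mult.commute intro!: sum.cong)
    then show ?thesis by (simp add: R_eq R_m)
  qed
  have eqs: "m (m (R G) (R X)) (R G) = R G" "m (m (R X) (R G)) (R X) = R X"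
    if "is_pseudo_inverse_on I G X" for X
    using that unfolding is_pseudo_inverse_on_def m_def[symmetric] R_eq R_m by simp_all
  have "m (R G) (R V) = m (m (m (R G) (R W)) (R G)) (R V)"
    using eqs(1)[OF W] by simp
  also have "\<dots> = m (m (R W) (R G)) (m (R V) (R G))"
    using comm[OF V] comm[OF W] by (simp add: assoc)
  also have "\<dots> = m (R W) (R G)"
    using eqs(1)[OF V] by (simp add: assoc)
  finally have E: "m (R G) (R V) = m (R G) (R W)"
    using comm[OF W] by simp
  have "R V = m (R V) (m (R G) (R V))"
    using eqs(2)[OF V] by (simp add: assoc)
  also have "\<dots> = m (m (R V) (R G)) (R W)"
    using E by (simp add: assoc)
  also have "\<dots> = m (m (R W) (R G)) (R W)"
    using E comm[OF V] comm[OF W] by simp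
  also have "\<dots> = R W" by (rule eqs(2)[OF W])
  finally show ?thesis by (simp add: R_eq)
qed

end

theory Submission
  imports Defs
begin

text \<open>
  Left multiplication by \<open>x\<close> on the span of the pairings has matrix entries
  \<open>\<Sum> {x(\<rho>) | \<rho> \<pi> \<rho>\<^sup>-\<^sup>1 = \<pi>'}\<close>. The matrices commuting with this action are constant on the orbits of the
  symmetric group on pairs of pairings, and these orbits are classified by the component sizes of
  \<open>\<pi> \<union> \<pi>'\<close>, i.e. by partitions of \<open>n\<close>. The idempotents \<open>P\<^sub>2\<^sub>\<nu>\<close> give equally many nonzero orthogonal
  elements of this commutant, so they span it, and the Gram matrix is \<open>\<Sum>\<^sub>\<nu> f\<^sub>\<nu> P\<^sub>2\<^sub>\<nu>\<close> for some scalars \<open>f\<^sub>\<nu>\<close>.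

  To find \<open>f\<^sub>\<nu>\<close>, pair the Gram matrix with the sum of all row-preserving pairings of the boxes of \<open>2\<nu>\<close> on
  one side and the column-antisymmetrized pairing into horizontal dominoes on the other. Since the
  Gram entries count colourings that are constant on the pairs of both pairings, removing the last domino \<open>(i, j)\<close> of
  \<open>\<nu>\<close> multiplies the result by \<open>\<tau> + 2(j - 1) - (i - 1)\<close>: the loop closed by the domino gives \<open>\<tau>\<close>, the
  \<open>2(j - 1)\<close> row exchanges and the \<open>i - 1\<close> column exchanges give \<open>\<plusminus>1\<close> each, and the mixed terms cancel by
  antisymmetry. So \<open>f\<^sub>\<nu> = c\<^sub>\<nu>\<close>, and inverting the nonzero eigenvalues gives the pseudo-inverse.
\<close>

section \<open>The group algebra\<close>

text \<open>The pairing of row-preserving pairings with antisymmetrized ones does two jobs. For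
  every invariant kernel \<open>K\<close>, multiplying \<open>K\<close> by the Young symmetrizer of
  the shape 2\<nu> multiplies the pairing by the orders of the row and column groups. With
  \<open>K\<close> the identity kernel, where the pairing is 1, this shows that the idempotent of
  2\<nu> acts on pairings as a nonzero matrix, as the dimension count requires. With
  \<open>K\<close> the Gram matrix it reads off the scalar, because on that Young symmetrizer only
  one idempotent survives. Characters are given as traces, so each central idempotent is first
  rewritten as a multiple of the sum of the conjugates of a Young symmetrizer; the constant comes
  from its square being \<kappa> times itself. Signs are summed only over permutations of left
  halves of dominoes: a permutation of right halves moves the base pairing in the same way as some
  permutation of left halves, so this sum is already antisymmetric under the full column group. Zero
  eigenvalues are absorbed by the convention \<open>inverse 0 = 0\<close>.\<close>

lemma id_symgrp [simp]: "id \<in> symgrp m"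
  by (simp add: symgrp_def permutes_id)

lemma comp_symgrp [simp]: "\<sigma> \<in> symgrp m \<Longrightarrow> \<rho> \<in> symgrp m \<Longrightarrow> \<sigma> \<circ> \<rho> \<in> symgrp m"
  by (simp add: symgrp_def permutes_compose)

lemma inv_symgrp [simp]: "\<sigma> \<in> symgrp m \<Longrightarrow> inv \<sigma> \<in> symgrp m"
  by (simp add: symgrp_def permutes_inv)

lemma transpose_symgrp: "i \<in> {1..m} \<Longrightarrow> j \<in> {1..m} \<Longrightarrow> transpose i j \<in> symgrp m"
  unfolding symgrp_def by (auto intro: permutes_swap_id)

lemma bij_symgrp: "\<sigma> \<in> symgrp m \<Longrightarrow> bij \<sigma>"
  by (auto simp: symgrp_def intro: permutes_bij)

lemma permutation_symgrp: "\<sigma> \<in> symgrp m \<Longrightarrow> permutation \<sigma>"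
  by (auto simp: symgrp_def permutation_permutes)

lemma symgrp_simps [simp]:
  assumes "\<sigma> \<in> symgrp m"
  shows "\<sigma> \<circ> inv \<sigma> = id" "inv \<sigma> \<circ> \<sigma> = id" "inv (inv \<sigma>) = \<sigma>"
    "\<sigma> (inv \<sigma> x) = x" "inv \<sigma> (\<sigma> x) = x"
    "\<sigma> \<circ> (inv \<sigma> \<circ> f) = f" "inv \<sigma> \<circ> (\<sigma> \<circ> f) = f"
  using bij_symgrp[OF assms]
  by (auto simp: fun_eq_iff bij_is_inj bij_is_surj surj_f_inv_f inv_inv_eq)

lemma inv_comp_symgrp:
  "\<sigma> \<in> symgrp m \<Longrightarrow> \<rho> \<in> symgrp m \<Longrightarrow> inv (\<sigma> \<circ> \<rho>) = inv \<rho> \<circ> inv \<sigma>"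
  by (simp add: bij_symgrp o_inv_distrib)

lemma symgrp_mem_iff: "\<sigma> \<in> symgrp m \<Longrightarrow> \<sigma> x \<in> {1..m} \<longleftrightarrow> x \<in> {1..m}"
  unfolding symgrp_def mem_Collect_eq by (rule permutes_in_image)

lemma bij_betw_mult_left: "\<sigma> \<in> symgrp m \<Longrightarrow> bij_betw ((\<circ>) \<sigma>) (symgrp m) (symgrp m)"
  by (rule bij_betwI[where g = "(\<circ>) (inv \<sigma>)"]) auto

lemma bij_betw_mult_right: "\<sigma> \<in> symgrp m \<Longrightarrow> bij_betw (\<lambda>\<rho>. \<rho> \<circ> \<sigma>) (symgrp m) (symgrp m)"
  by (rule bij_betwI[where g = "\<lambda>\<rho>. \<rho> \<circ> inv \<sigma>"]) (auto simp: comp_assoc)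

lemma bij_betw_inv_symgrp: "bij_betw inv (symgrp m) (symgrp m)"
  by (rule bij_betwI[where g = inv]) auto

lemma sum_mult_left:
  "\<sigma> \<in> symgrp m \<Longrightarrow> (\<Sum>\<rho>\<in>symgrp m. f (\<sigma> \<circ> \<rho>)) = (\<Sum>\<rho>\<in>symgrp m. f \<rho>)"
  by (rule sum.reindex_bij_betw[OF bij_betw_mult_left])

lemma sum_mult_right:
  "\<sigma> \<in> symgrp m \<Longrightarrow> (\<Sum>\<rho>\<in>symgrp m. f (\<rho> \<circ> \<sigma>)) = (\<Sum>\<rho>\<in>symgrp m. f \<rho>)"
  by (rule sum.reindex_bij_betw[OF bij_betw_mult_right])

lemma sum_inv_symgrp: "(\<Sum>\<rho>\<in>symgrp m. f (inv \<rho>)) = (\<Sum>\<rho>\<in>symgrp m. f \<rho>)"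
  by (rule sum.reindex_bij_betw[OF bij_betw_inv_symgrp])

lemma group_algebra_outside: "x \<in> group_algebra m \<Longrightarrow> \<sigma> \<notin> symgrp m \<Longrightarrow> x \<sigma> = 0"
  by (simp add: group_algebra_def)

lemma group_algebra_eqI:
  assumes "x \<in> group_algebra m" "y \<in> group_algebra m"
    and "\<And>\<sigma>. \<sigma> \<in> symgrp m \<Longrightarrow> x \<sigma> = y \<sigma>"
  shows "x = y"
  using assms by (intro ext) (metis group_algebra_outside)

lemma gmult_outside: "\<sigma> \<notin> symgrp m \<Longrightarrow> gmult m x y \<sigma> = 0"
  unfolding gmult_def fun_sum_apply fscale_def gelem_def
  by (intro sum.neutral ballI) auto

lemma gmult_in_group_algebra [simp]: "gmult m x y \<in> group_algebra m"
  by (simp add: group_algebra_def gmult_outside)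

lemma gelem_in_group_algebra [simp]: "\<sigma> \<in> symgrp m \<Longrightarrow> gelem \<sigma> \<in> group_algebra m"
  by (auto simp: group_algebra_def gelem_def)

lemma fscale_apply: "(c *\<^sub>C x) s = c * x s"
  by (simp add: fscale_def)

lemma gelem_apply: "gelem \<sigma> \<rho> = (if \<rho> = \<sigma> then 1 else 0)"
  by (simp add: gelem_def)

lemma zero_in_group_algebra [simp]: "0 \<in> group_algebra m"
  by (simp add: group_algebra_def)

lemma add_in_group_algebra [simp]:
  "x \<in> group_algebra m \<Longrightarrow> y \<in> group_algebra m \<Longrightarrow> x + y \<in> group_algebra m"
  by (simp add: group_algebra_def)

lemma scale_in_group_algebra [simp]: "x \<in> group_algebra m \<Longrightarrow> c *\<^sub>C x \<in> group_algebra m"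
  by (simp add: group_algebra_def fscale_def)

lemma sum_in_group_algebra:
  "(\<And>i. i \<in> I \<Longrightarrow> f i \<in> group_algebra m) \<Longrightarrow> (\<Sum>i\<in>I. f i) \<in> group_algebra m"
  by (induction I rule: infinite_finite_induct) auto

lemma gmult_eqI:
  assumes "\<And>\<sigma>. \<sigma> \<in> symgrp m \<Longrightarrow> gmult m x y \<sigma> = gmult m x' y' \<sigma>"
  shows "gmult m x y = gmult m x' y'"
  by (rule group_algebra_eqI[where m = m]) (auto simp: assms)

lemma gmult_add_left: "gmult m (x + y) z = gmult m x z + gmult m y z"
  by (rule group_algebra_eqI[where m = m]) (auto simp: gmult_apply sum.distrib algebra_simps)

lemma gmult_add_right: "gmult m x (y + z) = gmult m x y + gmult m x z"
  by (rule group_algebra_eqI[where m = m]) (auto simp: gmult_apply sum.distrib algebra_simps)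

lemma gmult_scale_left: "gmult m (c *\<^sub>C x) y = c *\<^sub>C gmult m x y"
  by (rule group_algebra_eqI[where m = m])
    (auto simp: gmult_apply fscale_apply sum_distrib_left algebra_simps)

lemma gmult_scale_right: "gmult m x (c *\<^sub>C y) = c *\<^sub>C gmult m x y"
  by (rule group_algebra_eqI[where m = m])
    (auto simp: gmult_apply fscale_apply sum_distrib_left algebra_simps)

lemma gmult_zero_left [simp]: "gmult m 0 y = 0"
  by (rule group_algebra_eqI[where m = m]) (auto simp: gmult_apply)

lemma gmult_zero_right [simp]: "gmult m x 0 = 0"
  by (rule group_algebra_eqI[where m = m]) (auto simp: gmult_apply)

lemma gmult_sum_left: "gmult m (\<Sum>i\<in>I. f i) y = (\<Sum>i\<in>I. gmult m (f i) y)"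
  by (induction I rule: infinite_finite_induct)
    (simp_all only: sum.infinite sum.empty sum.insert gmult_zero_left gmult_add_left not_False_eq_True)

lemma gmult_sum_right: "gmult m x (\<Sum>i\<in>I. f i) = (\<Sum>i\<in>I. gmult m x (f i))"
  by (induction I rule: infinite_finite_induct)
    (simp_all only: sum.infinite sum.empty sum.insert gmult_zero_right gmult_add_right not_False_eq_True)

lemma gmult_assoc: "gmult m (gmult m x y) z = gmult m x (gmult m y z)"
proof (rule gmult_eqI)
  fix \<sigma> assume \<sigma>: "\<sigma> \<in> symgrp m"
  have "gmult m (gmult m x y) z \<sigma> =
      (\<Sum>\<rho>\<in>symgrp m. \<Sum>\<eta>\<in>symgrp m. x \<eta> * (y (inv \<eta> \<circ> \<rho>) * z (inv \<rho> \<circ> \<sigma>)))"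
    using \<sigma> by (simp add: gmult_apply sum_distrib_right mult.assoc)
  also have "\<dots> = (\<Sum>\<eta>\<in>symgrp m. \<Sum>\<rho>\<in>symgrp m. x \<eta> * (y (inv \<eta> \<circ> \<rho>) * z (inv \<rho> \<circ> \<sigma>)))"
    by (rule sum.swap)
  also have "\<dots> = (\<Sum>\<eta>\<in>symgrp m. \<Sum>\<rho>\<in>symgrp m. x \<eta> * (y \<rho> * z (inv \<rho> \<circ> (inv \<eta> \<circ> \<sigma>))))"
  proof (rule sum.cong[OF refl])
    fix \<eta> assume \<eta>: "\<eta> \<in> symgrp m"
    have "(\<Sum>\<rho>\<in>symgrp m. x \<eta> * (y (inv \<eta> \<circ> \<rho>) * z (inv \<rho> \<circ> \<sigma>)))
      = (\<Sum>\<rho>\<in>symgrp m. x \<eta> * (y (inv \<eta> \<circ> (\<eta> \<circ> \<rho>)) * z (inv (\<eta> \<circ> \<rho>) \<circ> \<sigma>)))"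
      by (rule sum_mult_left[OF \<eta>, symmetric])
    also have "\<dots> = (\<Sum>\<rho>\<in>symgrp m. x \<eta> * (y \<rho> * z (inv \<rho> \<circ> (inv \<eta> \<circ> \<sigma>))))"
      using \<eta> by (intro sum.cong) (auto simp: inv_comp_symgrp comp_assoc)
    finally show "(\<Sum>\<rho>\<in>symgrp m. x \<eta> * (y (inv \<eta> \<circ> \<rho>) * z (inv \<rho> \<circ> \<sigma>))) = \<dots>" .
  qed
  also have "\<dots> = gmult m x (gmult m y z) \<sigma>"
    using \<sigma> by (simp add: gmult_apply sum_distrib_left comp_assoc)
  finally show "gmult m (gmult m x y) z \<sigma> = gmult m x (gmult m y z) \<sigma>" .
qed

lemma gmult_gelem_right:
  assumes "\<sigma> \<in> symgrp m" "\<rho> \<in> symgrp m"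
  shows "gmult m y (gelem \<sigma>) \<rho> = y (\<rho> \<circ> inv \<sigma>)"
proof -
  have "inv s \<circ> \<rho> = \<sigma> \<longleftrightarrow> s = \<rho> \<circ> inv \<sigma>" if "s \<in> symgrp m" for s
    using that assms by (metis comp_assoc comp_id symgrp_simps(1,2,6))
  then have "gmult m y (gelem \<sigma>) \<rho>
      = (\<Sum>s\<in>symgrp m. if s = \<rho> \<circ> inv \<sigma> then y (\<rho> \<circ> inv \<sigma>) else 0)"
    using assms by (auto simp: gmult_apply gelem_def intro!: sum.cong)
  with assms show ?thesis by (simp add: finite_symgrp)
qed

lemma gmult_gelem_gelem:
  assumes "\<sigma> \<in> symgrp m" "\<rho> \<in> symgrp m"
  shows "gmult m (gelem \<sigma>) (gelem \<rho>) = gelem (\<sigma> \<circ> \<rho>)"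
proof (rule group_algebra_eqI[where m = m])
  fix s assume s: "s \<in> symgrp m"
  have "inv \<sigma> \<circ> s = \<rho> \<longleftrightarrow> s = \<sigma> \<circ> \<rho>"
    using assms s by (metis symgrp_simps(6,7))
  then show "gmult m (gelem \<sigma>) (gelem \<rho>) s = gelem (\<sigma> \<circ> \<rho>) s"
    using assms s by (simp add: gmult_gelem_left gelem_apply)
qed (use assms in auto)

lemma group_algebra_expand:
  assumes "x \<in> group_algebra m"
  shows "x = (\<Sum>\<sigma>\<in>symgrp m. x \<sigma> *\<^sub>C gelem \<sigma>)"
proof (rule group_algebra_eqI[OF assms])
  fix s assume "s \<in> symgrp m"
  have "(\<Sum>\<sigma>\<in>symgrp m. x \<sigma> *\<^sub>C gelem \<sigma>) s = (\<Sum>\<sigma>\<in>symgrp m. if \<sigma> = s then x s else 0)"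
    by (auto simp: fun_sum_apply fscale_apply gelem_apply intro!: sum.cong)
  with \<open>s \<in> symgrp m\<close> show "x s = (\<Sum>\<sigma>\<in>symgrp m. x \<sigma> *\<^sub>C gelem \<sigma>) s"
    by (simp add: finite_symgrp)
qed (auto intro!: sum_in_group_algebra)

lemma gmult_id_left [simp]: "x \<in> group_algebra m \<Longrightarrow> gmult m (gelem id) x = x"
  by (rule group_algebra_eqI[where m = m]) (simp_all, simp add: gmult_gelem_left)

section \<open>The inversion involution and positivity\<close>

text \<open>The linear extension of inversion, an anti-automorphism. Coefficients are not
  conjugated, so positivity arguments with it are restricted to real-valued elements.\<close>

definition gstar :: "nat \<Rightarrow> galg \<Rightarrow> galg"
  where "gstar m x = (\<lambda>\<sigma>. if \<sigma> \<in> symgrp m then x (inv \<sigma>) else 0)"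

lemma gstar_in_group_algebra [simp]: "gstar m x \<in> group_algebra m"
  by (simp add: gstar_def group_algebra_def)

lemma gstar_apply: "\<sigma> \<in> symgrp m \<Longrightarrow> gstar m x \<sigma> = x (inv \<sigma>)"
  by (simp add: gstar_def)

lemma gstar_gstar: "x \<in> group_algebra m \<Longrightarrow> gstar m (gstar m x) = x"
  by (rule group_algebra_eqI[where m = m]) (auto simp: gstar_apply)

lemma gstar_gelem: "\<sigma> \<in> symgrp m \<Longrightarrow> gstar m (gelem \<sigma>) = gelem (inv \<sigma>)"
  by (rule group_algebra_eqI[where m = m]) (auto simp: gstar_apply gelem_apply)

lemma gstar_scale: "gstar m (c *\<^sub>C x) = c *\<^sub>C gstar m x"
  by (auto simp: gstar_def fscale_def)

lemma gstar_sum: "gstar m (\<Sum>i\<in>I. f i) = (\<Sum>i\<in>I. gstar m (f i))"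
  by (rule ext) (auto simp: gstar_def fun_sum_apply intro!: sum.neutral)

lemma gstar_gmult: "gstar m (gmult m x y) = gmult m (gstar m y) (gstar m x)"
proof (rule group_algebra_eqI[where m = m])
  fix \<sigma> assume \<sigma>: "\<sigma> \<in> symgrp m"
  have "gstar m (gmult m x y) \<sigma> = (\<Sum>\<rho>\<in>symgrp m. x \<rho> * y (inv \<rho> \<circ> inv \<sigma>))"
    using \<sigma> by (simp add: gstar_def gmult_apply)
  also have "\<dots> = (\<Sum>\<rho>\<in>symgrp m. x (inv \<sigma> \<circ> \<rho>) * y (inv (inv \<sigma> \<circ> \<rho>) \<circ> inv \<sigma>))"
    by (rule sum_mult_left[symmetric]) (use \<sigma> in simp)
  also have "\<dots> = (\<Sum>\<rho>\<in>symgrp m. x (inv \<sigma> \<circ> \<rho>) * y (inv \<rho>))"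
    using \<sigma> by (intro sum.cong) (auto simp: inv_comp_symgrp[of _ m] comp_assoc)
  also have "\<dots> = gmult m (gstar m y) (gstar m x) \<sigma>"
    using \<sigma> by (auto simp: gmult_apply gstar_def inv_comp_symgrp[of _ m] mult.commute intro!: sum.cong)
  finally show "gstar m (gmult m x y) \<sigma> = gmult m (gstar m y) (gstar m x) \<sigma>" .
qed auto

lemma gmult_gstar_id:
  "gmult m x (gstar m x) id = (\<Sum>\<sigma>\<in>symgrp m. x \<sigma> ^ 2)"
  by (auto simp: gmult_apply gstar_def power2_eq_square intro!: sum.cong)

text \<open>The coefficient at \<open>id\<close> of \<open>x\<close> times its star is the sum of
  the squares of the coefficients of \<open>x\<close>; for real coefficients it vanishes only if all
  of them do.\<close>

lemma gmult_gstar_eq_0: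
  assumes x: "x \<in> group_algebra m" and real: "\<And>\<sigma>. x \<sigma> \<in> \<real>" and 0: "gmult m x (gstar m x) = 0"
  shows "x = 0"
proof -
  have "of_real (Re (x \<sigma>)) = x \<sigma>" for \<sigma>
    using real[of \<sigma>] by (simp add: complex_is_Real_iff complex_eq_iff)
  then have "complex_of_real (\<Sum>\<sigma>\<in>symgrp m. Re (x \<sigma>) ^ 2) = (\<Sum>\<sigma>\<in>symgrp m. x \<sigma> ^ 2)"
    by simp
  also have "\<dots> = 0"
    using gmult_gstar_id[of m x] 0 by simp
  finally have "(\<Sum>\<sigma>\<in>symgrp m. Re (x \<sigma>) ^ 2) = 0"
    by (simp only: of_real_eq_0_iff)
  then have "\<forall>\<sigma>\<in>symgrp m. Re (x \<sigma>) = 0"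
    by (simp add: sum_nonneg_eq_0_iff finite_symgrp)
  then show ?thesis
    using real by (intro group_algebra_eqI[OF x]) (auto simp: complex_is_Real_iff complex_eq_iff)
qed

lemma gmult_real:
  assumes "\<And>\<sigma>. x \<sigma> \<in> \<real>" "\<And>\<sigma>. y \<sigma> \<in> \<real>"
  shows "gmult m x y \<sigma> \<in> \<real>"
  by (cases "\<sigma> \<in> symgrp m") (auto simp: gmult_apply gmult_outside assms intro!: sum_in_Reals Reals_mult)

section \<open>Young symmetrizers\<close>

lemma boxes_Sigma: "boxes \<mu> = (SIGMA i:{1..length \<mu>}. {1..\<mu> ! (i - 1)})"
  by (auto simp: boxes_def)

lemma finite_boxes [simp]: "finite (boxes \<mu>)"
  by (simp add: boxes_Sigma)

lemma card_boxes_rows: "k \<le> length \<mu> \<Longrightarrow> card {(i, j) \<in> boxes \<mu>. i \<le> k} = sum_list (take k \<mu>)"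
proof -
  assume k: "k \<le> length \<mu>"
  have "{(i, j) \<in> boxes \<mu>. i \<le> k} = (SIGMA i:{1..k}. {1..\<mu> ! (i - 1)})"
    using k by (auto simp: boxes_def)
  then have "card {(i, j) \<in> boxes \<mu>. i \<le> k} = (\<Sum>i=1..k. \<mu> ! (i - 1))"
    by simp
  also have "\<dots> = (\<Sum>i<k. \<mu> ! i)"
    by (rule sum.reindex_bij_witness[of _ Suc "\<lambda>i. i - 1"]) auto
  also have "\<dots> = sum_list (take k \<mu>)"
    using k by (simp add: sum_list_sum_nth atLeast0LessThan)
  finally show ?thesis .
qed

lemma sum_list_take_mono: "k \<le> l \<Longrightarrow> sum_list (take k \<mu>) \<le> sum_list (take l (\<mu> :: nat list))"
proof -
  assume "k \<le> l"
  then obtain d where "l = k + d" using le_Suc_ex by blast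
  then show ?thesis by (simp add: take_add)
qed

lemma tableau_le:
  assumes "(i, j) \<in> boxes \<mu>"
  shows "tableau \<mu> (i, j) \<le> sum_list (take i \<mu>)"
proof -
  from assms have "take i \<mu> = take (i - 1) \<mu> @ [\<mu> ! (i - 1)]"
    by (cases i) (auto simp: boxes_def take_Suc_conv_app_nth)
  with assms show ?thesis by (auto simp: tableau_def boxes_def)
qed

lemma tableau_less:
  assumes "(i, j) \<in> boxes \<mu>" "(i', j') \<in> boxes \<mu>" "i < i'"
  shows "tableau \<mu> (i, j) < tableau \<mu> (i', j')"
proof -
  have "tableau \<mu> (i, j) \<le> sum_list (take (i' - 1) \<mu>)"
    using tableau_le[OF assms(1)] sum_list_take_mono[of i "i' - 1" \<mu>] assms by linarith
  with assms show ?thesis by (auto simp: tableau_def boxes_def)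
qed

lemma inj_on_tableau: "inj_on (tableau \<mu>) (boxes \<mu>)"
proof (rule inj_onI, clarify)
  fix i j i' j' assume b: "(i, j) \<in> boxes \<mu>" "(i', j') \<in> boxes \<mu>"
    and eq: "tableau \<mu> (i, j) = tableau \<mu> (i', j')"
  have "i = i'"
    using tableau_less[OF b] tableau_less[OF b(2,1)] eq by (cases i i' rule: linorder_cases) auto
  with eq show "i = i' \<and> j = j'" by (auto simp: tableau_def)
qed

text \<open>Row \<open>i\<close> is numbered inside the interval that ends at the
  \<open>i\<close>-th partial sum, which gives injectivity and values in \<open>{1..m}\<close>;
  counting the boxes makes the numbering onto.\<close>

lemma bij_betw_tableau:
  assumes "sum_list \<mu> = m"
  shows "bij_betw (tableau \<mu>) (boxes \<mu>) {1..m}"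
proof -
  have "card (boxes \<mu>) = m"
  proof -
    have "{(i, j) \<in> boxes \<mu>. i \<le> length \<mu>} = boxes \<mu>" by (auto simp: boxes_def)
    with card_boxes_rows[of "length \<mu>" \<mu>] assms show ?thesis by simp
  qed
  moreover have "tableau \<mu> ` boxes \<mu> \<subseteq> {1..m}"
  proof clarify
    fix i j assume b: "(i, j) \<in> boxes \<mu>"
    have "tableau \<mu> (i, j) \<le> m"
      using tableau_le[OF b] sum_list_take_mono[of i "max i (length \<mu>)" \<mu>] assms by simp
    moreover have "1 \<le> tableau \<mu> (i, j)" using b by (auto simp: tableau_def boxes_def)
    ultimately show "tableau \<mu> (i, j) \<in> {1..m}" by simp
  qed
  ultimately have "tableau \<mu> ` boxes \<mu> = {1..m}"
    by (intro card_subset_eq) (simp_all add: card_image inj_on_tableau)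
  with inj_on_tableau show ?thesis by (simp add: bij_betw_def)
qed

text \<open>Inverse of the row-by-row numbering. Row and column of an entry thereby become labels on
  \<open>{1..m}\<close>, which turns the row and column groups into stabilizers of a
  labelling.\<close>

definition cell :: "nat list \<Rightarrow> nat \<Rightarrow> nat \<times> nat"
  where "cell \<mu> = the_inv_into (boxes \<mu>) (tableau \<mu>)"

definition rowof :: "nat list \<Rightarrow> nat \<Rightarrow> nat" where "rowof \<mu> x = fst (cell \<mu> x)"
definition colof :: "nat list \<Rightarrow> nat \<Rightarrow> nat" where "colof \<mu> x = snd (cell \<mu> x)"

lemma cell_eq: "cell \<mu> x = (rowof \<mu> x, colof \<mu> x)"
  by (simp add: rowof_def colof_def)

lemma cell_tableau [simp]: "b \<in> boxes \<mu> \<Longrightarrow> cell \<mu> (tableau \<mu> b) = b"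
  unfolding cell_def by (rule the_inv_into_f_f[OF inj_on_tableau])

lemma rowof_tableau [simp]: "(i, j) \<in> boxes \<mu> \<Longrightarrow> rowof \<mu> (tableau \<mu> (i, j)) = i"
  by (simp add: rowof_def)

lemma colof_tableau [simp]: "(i, j) \<in> boxes \<mu> \<Longrightarrow> colof \<mu> (tableau \<mu> (i, j)) = j"
  by (simp add: colof_def)

context
  fixes m :: nat and \<mu> :: "nat list"
  assumes \<mu>: "sum_list \<mu> = m"
begin

lemma tableau_cell [simp]: "x \<in> {1..m} \<Longrightarrow> tableau \<mu> (rowof \<mu> x, colof \<mu> x) = x"
  unfolding cell_eq[symmetric] cell_def
  using bij_betw_tableau[OF \<mu>] by (intro f_the_inv_into_f) (auto simp: bij_betw_def)

lemma cell_in_boxes: "x \<in> {1..m} \<Longrightarrow> (rowof \<mu> x, colof \<mu> x) \<in> boxes \<mu>"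
  unfolding cell_eq[symmetric] cell_def
  using bij_betw_tableau[OF \<mu>] by (intro the_inv_into_into) (auto simp: bij_betw_def)

lemma tableau_in: "b \<in> boxes \<mu> \<Longrightarrow> tableau \<mu> b \<in> {1..m}"
  using bij_betw_tableau[OF \<mu>] by (auto simp: bij_betw_def)

lemma cell_inject:
  "x \<in> {1..m} \<Longrightarrow> y \<in> {1..m} \<Longrightarrow> rowof \<mu> x = rowof \<mu> y \<Longrightarrow> colof \<mu> x = colof \<mu> y \<Longrightarrow> x = y"
  using tableau_cell by metis

lemma row_group_eq: "row_group m \<mu> = {\<sigma> \<in> symgrp m. \<forall>x\<in>{1..m}. rowof \<mu> (\<sigma> x) = rowof \<mu> x}"
proof (intro set_eqI iffI)
  fix \<sigma> assume \<sigma>: "\<sigma> \<in> row_group m \<mu>"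
  then have "rowof \<mu> (\<sigma> x) = rowof \<mu> x" if x: "x \<in> {1..m}" for x
    using cell_in_boxes[OF x] tableau_cell[OF x] unfolding row_group_def
    by (fastforce simp: rowof_tableau)
  with \<sigma> show "\<sigma> \<in> {\<sigma> \<in> symgrp m. \<forall>x\<in>{1..m}. rowof \<mu> (\<sigma> x) = rowof \<mu> x}"
    by (auto simp: row_group_def)
next
  fix \<sigma> assume \<sigma>: "\<sigma> \<in> {\<sigma> \<in> symgrp m. \<forall>x\<in>{1..m}. rowof \<mu> (\<sigma> x) = rowof \<mu> x}"
  have "\<exists>j'. (i, j') \<in> boxes \<mu> \<and> \<sigma> (tableau \<mu> (i, j)) = tableau \<mu> (i, j')"
    if b: "(i, j) \<in> boxes \<mu>" for i j
  proof -
    have x: "tableau \<mu> (i, j) \<in> {1..m}" using b by (rule tableau_in)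
    then have y: "\<sigma> (tableau \<mu> (i, j)) \<in> {1..m}" using \<sigma> symgrp_mem_iff by blast
    have "rowof \<mu> (\<sigma> (tableau \<mu> (i, j))) = i" using \<sigma> x b by auto
    with cell_in_boxes[OF y] tableau_cell[OF y] show ?thesis by metis
  qed
  with \<sigma> show "\<sigma> \<in> row_group m \<mu>" by (auto simp: row_group_def)
qed

lemma col_group_eq: "col_group m \<mu> = {\<sigma> \<in> symgrp m. \<forall>x\<in>{1..m}. colof \<mu> (\<sigma> x) = colof \<mu> x}"
proof (intro set_eqI iffI)
  fix \<sigma> assume \<sigma>: "\<sigma> \<in> col_group m \<mu>"
  then have "colof \<mu> (\<sigma> x) = colof \<mu> x" if x: "x \<in> {1..m}" for x
    using cell_in_boxes[OF x] tableau_cell[OF x] unfolding col_group_def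
    by (fastforce simp: colof_tableau)
  with \<sigma> show "\<sigma> \<in> {\<sigma> \<in> symgrp m. \<forall>x\<in>{1..m}. colof \<mu> (\<sigma> x) = colof \<mu> x}"
    by (auto simp: col_group_def)
next
  fix \<sigma> assume \<sigma>: "\<sigma> \<in> {\<sigma> \<in> symgrp m. \<forall>x\<in>{1..m}. colof \<mu> (\<sigma> x) = colof \<mu> x}"
  have "\<exists>i'. (i', j) \<in> boxes \<mu> \<and> \<sigma> (tableau \<mu> (i, j)) = tableau \<mu> (i', j)"
    if b: "(i, j) \<in> boxes \<mu>" for i j
  proof -
    have x: "tableau \<mu> (i, j) \<in> {1..m}" using b by (rule tableau_in)
    then have y: "\<sigma> (tableau \<mu> (i, j)) \<in> {1..m}" using \<sigma> symgrp_mem_iff by blast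
    have "colof \<mu> (\<sigma> (tableau \<mu> (i, j))) = j" using \<sigma> x b by auto
    with cell_in_boxes[OF y] tableau_cell[OF y] show ?thesis by metis
  qed
  with \<sigma> show "\<sigma> \<in> col_group m \<mu>" by (auto simp: col_group_def)
qed

lemma card_cells: "card {x \<in> {1..m}. P (rowof \<mu> x) (colof \<mu> x)} = card {(i, j) \<in> boxes \<mu>. P i j}"
  by (rule bij_betw_same_card[of "\<lambda>x. (rowof \<mu> x, colof \<mu> x)"],
      rule bij_betwI[where g = "tableau \<mu>"])
    (use cell_in_boxes tableau_in in auto)

end

lemma finite_row_group [simp]: "finite (row_group m \<mu>)"
  by (rule finite_subset[OF _ finite_symgrp[of m]]) (auto simp: row_group_def)

lemma finite_col_group [simp]: "finite (col_group m \<mu>)"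
  by (rule finite_subset[OF _ finite_symgrp[of m]]) (auto simp: col_group_def)

lemma row_group_symgrp: "p \<in> row_group m \<mu> \<Longrightarrow> p \<in> symgrp m"
  by (simp add: row_group_def)

lemma col_group_symgrp: "p \<in> col_group m \<mu> \<Longrightarrow> p \<in> symgrp m"
  by (simp add: col_group_def)

section \<open>Row sums, column sums and Young subgroups\<close>

definition row_sum :: "nat \<Rightarrow> nat list \<Rightarrow> galg"
  where "row_sum m \<mu> = (\<Sum>p\<in>row_group m \<mu>. gelem p)"

definition col_sum :: "nat \<Rightarrow> nat list \<Rightarrow> galg"
  where "col_sum m \<mu> = (\<Sum>q\<in>col_group m \<mu>. of_int (sign q) *\<^sub>C gelem q)"

lemma young_symmetrizer_eq: "young_symmetrizer m \<mu> = gmult m (row_sum m \<mu>) (col_sum m \<mu>)"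
  by (simp add: young_symmetrizer_def row_sum_def col_sum_def)

text \<open>A Young subgroup, given by a labelling instead of a set partition. Row groups, column
  groups and the groups permuting only left or only right halves of dominoes are all of this kind,
  so closure and reindexing are proved once.\<close>

definition label_group :: "nat \<Rightarrow> (nat \<Rightarrow> 'l) \<Rightarrow> (nat \<Rightarrow> nat) set"
  where "label_group m r = {\<sigma> \<in> symgrp m. \<forall>x\<in>{1..m}. r (\<sigma> x) = r x}"

lemma label_group_symgrp: "\<sigma> \<in> label_group m r \<Longrightarrow> \<sigma> \<in> symgrp m"
  by (simp add: label_group_def)

lemma label_group_comp: "\<sigma> \<in> label_group m r \<Longrightarrow> \<rho> \<in> label_group m r \<Longrightarrow> \<sigma> \<circ> \<rho> \<in> label_group m r"
  unfolding label_group_def using symgrp_mem_iff[of \<rho> m] by auto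

lemma label_group_inv:
  assumes "\<sigma> \<in> label_group m r"
  shows "inv \<sigma> \<in> label_group m r"
proof -
  have \<sigma>: "\<sigma> \<in> symgrp m" using assms by (rule label_group_symgrp)
  have "r (inv \<sigma> x) = r x" if "x \<in> {1..m}" for x
  proof -
    have "inv \<sigma> x \<in> {1..m}" using that symgrp_mem_iff[OF inv_symgrp[OF \<sigma>]] by blast
    then have "r (\<sigma> (inv \<sigma> x)) = r (inv \<sigma> x)" using assms by (simp add: label_group_def)
    then show ?thesis using \<sigma> by simp
  qed
  with \<sigma> show ?thesis by (simp add: label_group_def)
qed

lemma label_group_id: "id \<in> label_group m r"
  by (simp add: label_group_def)

lemma bij_betw_label_group_left:
  "\<sigma> \<in> label_group m r \<Longrightarrow> bij_betw ((\<circ>) \<sigma>) (label_group m r) (label_group m r)"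
  by (rule bij_betwI[where g = "(\<circ>) (inv \<sigma>)"])
    (auto simp: label_group_comp label_group_inv dest: label_group_symgrp)

lemma bij_betw_label_group_right:
  "\<sigma> \<in> label_group m r \<Longrightarrow> bij_betw (\<lambda>\<rho>. \<rho> \<circ> \<sigma>) (label_group m r) (label_group m r)"
  by (rule bij_betwI[where g = "\<lambda>\<rho>. \<rho> \<circ> inv \<sigma>"])
    (auto simp: label_group_comp label_group_inv comp_assoc dest: label_group_symgrp)

lemma bij_betw_label_group_inv: "bij_betw inv (label_group m r) (label_group m r)"
  by (rule bij_betwI[where g = inv])
    (auto simp: label_group_inv dest: label_group_symgrp)

lemma transpose_label_group:
  "i \<in> {1..m} \<Longrightarrow> j \<in> {1..m} \<Longrightarrow> r i = r j \<Longrightarrow> transpose i j \<in> label_group m r"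
  by (auto simp: label_group_def transpose_symgrp transpose_def)

lemma finite_label_group [simp]: "finite (label_group m r)"
  by (rule finite_subset[OF _ finite_symgrp[of m]]) (auto simp: label_group_def)

lemma row_group_label: "sum_list \<mu> = m \<Longrightarrow> row_group m \<mu> = label_group m (rowof \<mu>)"
  by (simp add: row_group_eq label_group_def)

lemma col_group_label: "sum_list \<mu> = m \<Longrightarrow> col_group m \<mu> = label_group m (colof \<mu>)"
  by (simp add: col_group_eq label_group_def)

lemma sign_symgrp_comp: "p \<in> symgrp m \<Longrightarrow> q \<in> symgrp m \<Longrightarrow> sign (p \<circ> q) = sign p * sign q"
  by (simp add: sign_compose permutation_symgrp)

lemma sign_symgrp_inv: "p \<in> symgrp m \<Longrightarrow> sign (inv p) = sign p"
  by (simp add: sign_inverse permutation_symgrp)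

lemma sign_mult_self: "of_int (sign p) * (of_int (sign p) * x) = (x :: complex)"
  by (simp add: sign_def)

lemma sign_sq: "of_int (sign p) * of_int (sign p) = (1 :: complex)"
  by (simp add: sign_def)

context
  fixes m :: nat and \<mu> :: "nat list"
  assumes \<mu>: "sum_list \<mu> = m"
begin

lemma gelem_row_sum: "p \<in> row_group m \<mu> \<Longrightarrow> gmult m (gelem p) (row_sum m \<mu>) = row_sum m \<mu>"
  unfolding row_sum_def gmult_sum_right row_group_label[OF \<mu>]
  by (subst (2) sum.reindex_bij_betw[OF bij_betw_label_group_left[of p], symmetric])
    (auto intro!: sum.cong gmult_gelem_gelem label_group_symgrp)

lemma row_sum_gelem: "p \<in> row_group m \<mu> \<Longrightarrow> gmult m (row_sum m \<mu>) (gelem p) = row_sum m \<mu>"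
  unfolding row_sum_def gmult_sum_left row_group_label[OF \<mu>]
  by (subst (2) sum.reindex_bij_betw[OF bij_betw_label_group_right[of p], symmetric])
    (auto intro!: sum.cong gmult_gelem_gelem label_group_symgrp)

lemma gelem_col_sum:
  assumes "q \<in> col_group m \<mu>"
  shows "gmult m (gelem q) (col_sum m \<mu>) = of_int (sign q) *\<^sub>C col_sum m \<mu>"
proof -
  have q: "q \<in> label_group m (colof \<mu>)" using assms col_group_label[OF \<mu>] by simp
  have "of_int (sign q) *\<^sub>C col_sum m \<mu> =
      (\<Sum>s\<in>label_group m (colof \<mu>). (of_int (sign q) * of_int (sign s)) *\<^sub>C gelem s)"
    by (simp add: col_sum_def fun_vs.scale_sum_right col_group_label[OF \<mu>])
  also have "\<dots> = (\<Sum>s\<in>label_group m (colof \<mu>). (of_int (sign q) * of_int (sign (q \<circ> s))) *\<^sub>C gelem (q \<circ> s))"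
    by (rule sum.reindex_bij_betw[OF bij_betw_label_group_left[OF q], symmetric])
  also have "\<dots> = gmult m (gelem q) (col_sum m \<mu>)"
    unfolding col_sum_def gmult_sum_right col_group_label[OF \<mu>]
    using q by (intro sum.cong)
      (auto simp: gmult_scale_right gmult_gelem_gelem sign_symgrp_comp[of _ m] sign_mult_self
        label_group_symgrp dest!: label_group_symgrp)
  finally show ?thesis by simp
qed

lemma gstar_row_sum: "gstar m (row_sum m \<mu>) = row_sum m \<mu>"
  unfolding row_sum_def gstar_sum row_group_label[OF \<mu>]
  by (subst (2) sum.reindex_bij_betw[OF bij_betw_label_group_inv, symmetric])
    (auto intro!: sum.cong gstar_gelem label_group_symgrp)

lemma gstar_col_sum: "gstar m (col_sum m \<mu>) = col_sum m \<mu>"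
  unfolding col_sum_def gstar_sum col_group_label[OF \<mu>]
  by (subst (2) sum.reindex_bij_betw[OF bij_betw_label_group_inv, symmetric])
    (auto intro!: sum.cong simp: gstar_scale gstar_gelem[of _ m] sign_symgrp_inv[of _ m] dest!: label_group_symgrp)

lemma row_sum_sq: "gmult m (row_sum m \<mu>) (row_sum m \<mu>) = of_nat (card (row_group m \<mu>)) *\<^sub>C row_sum m \<mu>"
  by (subst (1) row_sum_def) (simp add: gmult_sum_left gelem_row_sum, simp add: fscale_def fun_eq_iff fun_sum_apply)

lemma col_sum_sq: "gmult m (col_sum m \<mu>) (col_sum m \<mu>) = of_nat (card (col_group m \<mu>)) *\<^sub>C col_sum m \<mu>"
  by (subst (1) col_sum_def)
    (simp add: gmult_sum_left gmult_scale_left gelem_col_sum,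
     simp add: fscale_def fun_eq_iff fun_sum_apply sign_sq)

lemma row_sum_in [simp]: "row_sum m \<mu> \<in> group_algebra m"
  unfolding row_sum_def by (auto intro!: sum_in_group_algebra gelem_in_group_algebra row_group_symgrp)

end

lemma row_sum_real: "row_sum m \<mu> \<sigma> \<in> \<real>"
  by (auto simp: row_sum_def fun_sum_apply gelem_def intro!: sum_in_Reals)

lemma col_sum_real: "col_sum m \<mu> \<sigma> \<in> \<real>"
  by (auto simp: col_sum_def fun_sum_apply fscale_def gelem_def intro!: sum_in_Reals)

section \<open>Dominance order and transversal tableaux\<close>

text \<open>Intended reading: \<open>X\<close> is the set of entries, \<open>r\<close> their row in
  one tableau, \<open>c\<close> their column in another, and \<open>D\<close> the diagram of the
  second. Injectivity allows at most \<open>min k (h j)\<close> entries of column \<open>j\<close>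
  in the first \<open>k\<close> rows, and summing over \<open>j\<close> gives the number of boxes in
  the first \<open>k\<close> rows of \<open>D\<close>. If equality holds for every \<open>k\<close>,
  it holds in every column, which confines the entries to boxes of \<open>D\<close>.\<close>

lemma dominance_count:
  fixes r c :: "'a \<Rightarrow> nat" and X :: "'a set" and D :: "(nat \<times> nat) set"
  assumes X: "finite X" and D: "finite D"
    and inj: "inj_on (\<lambda>x. (r x, c x)) X"
    and r1: "\<And>x. x \<in> X \<Longrightarrow> 1 \<le> r x"
    and D1: "\<And>i j. (i, j) \<in> D \<Longrightarrow> 1 \<le> i"
    and down: "\<And>i i' j. (i, j) \<in> D \<Longrightarrow> 1 \<le> i' \<Longrightarrow> i' \<le> i \<Longrightarrow> (i', j) \<in> D"
    and cols: "\<And>j. card {x \<in> X. c x = j} = card {i. (i, j) \<in> D}"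
  shows "card {x \<in> X. r x \<le> k} \<le> card {(i, j) \<in> D. i \<le> k}"
    and "(\<And>k. card {x \<in> X. r x \<le> k} = card {(i, j) \<in> D. i \<le> k}) \<Longrightarrow> x \<in> X \<Longrightarrow> (r x, c x) \<in> D"
proof -
  define J where "J = c ` X \<union> snd ` D"
  define h where "h j = card {i. (i, j) \<in> D}" for j
  have J: "finite J" using X D by (simp add: J_def)
  have fin: "finite {i. (i, j) \<in> D}" for j
    by (rule finite_subset[OF _ finite_imageI[OF D, of fst]]) force
  \<comment> \<open>Being closed under moving up, a nonempty column of \<open>D\<close> is an
    initial segment ending at its maximum.\<close>
  have column: "{i. (i, j) \<in> D} = {1..h j}" for j
  proof (cases "{i. (i, j) \<in> D} = {}")
    case False
    define M where "M = Max {i. (i, j) \<in> D}"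
    have "M \<in> {i. (i, j) \<in> D}" unfolding M_def using fin False by (rule Max_in)
    then have M: "(M, j) \<in> D" by simp
    have "{i. (i, j) \<in> D} = {1..M}"
    proof (intro set_eqI iffI)
      fix i assume i: "i \<in> {i. (i, j) \<in> D}"
      then have "i \<le> M" unfolding M_def by (rule Max_ge[OF fin])
      with i D1 show "i \<in> {1..M}" by simp
    next
      fix i assume "i \<in> {1..M}"
      with down[OF M] show "i \<in> {i. (i, j) \<in> D}" by simp
    qed
    then show ?thesis by (simp add: h_def)
  qed (simp add: h_def)
  have sumX: "card {x \<in> X. r x \<le> k} = (\<Sum>j\<in>J. card {x \<in> X. r x \<le> k \<and> c x = j})" for k
  proof -
    have "{x \<in> X. r x \<le> k} = (\<Union>j\<in>J. {x \<in> X. r x \<le> k \<and> c x = j})"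
      by (auto simp: J_def)
    then show ?thesis using X J by (simp add: card_UN_disjoint disjoint_iff)
  qed
  have sumD: "card {(i, j) \<in> D. i \<le> k} = (\<Sum>j\<in>J. min k (h j))" for k
  proof -
    have "{(i, j) \<in> D. i \<le> k} = (\<Union>j\<in>J. (\<lambda>i. (i, j)) ` {i. (i, j) \<in> D \<and> i \<le> k})"
      by (auto simp: J_def image_iff)
    then have "card {(i, j) \<in> D. i \<le> k} = (\<Sum>j\<in>J. card ((\<lambda>i. (i, j)) ` {i. (i, j) \<in> D \<and> i \<le> k}))"
      using J finite_subset[OF _ fin] by (simp only:, subst card_UN_disjoint) auto
    also have "\<dots> = (\<Sum>j\<in>J. min k (h j))"
    proof (rule sum.cong[OF refl])
      fix j
      have "{i. (i, j) \<in> D \<and> i \<le> k} = {1..min k (h j)}" using column[of j] by auto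
      then show "card ((\<lambda>i. (i, j)) ` {i. (i, j) \<in> D \<and> i \<le> k}) = min k (h j)"
        by (simp add: card_image inj_on_def)
    qed
    finally show ?thesis .
  qed
  have le: "card {x \<in> X. r x \<le> k \<and> c x = j} \<le> min k (h j)" for k j
  proof -
    have "card {x \<in> X. r x \<le> k \<and> c x = j} \<le> card {x \<in> X. c x = j}"
      by (rule card_mono) (use X in auto)
    moreover have "card {x \<in> X. r x \<le> k \<and> c x = j} \<le> card {1..k}"
      by (rule card_inj_on_le[of r]) (use inj r1 in \<open>auto simp: inj_on_def\<close>)
    ultimately show ?thesis by (simp add: cols h_def)
  qed
  show "card {x \<in> X. r x \<le> k} \<le> card {(i, j) \<in> D. i \<le> k}"
    unfolding sumX sumD by (rule sum_mono) (rule le)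
  assume eq: "\<And>k. card {x \<in> X. r x \<le> k} = card {(i, j) \<in> D. i \<le> k}" and x: "x \<in> X"
  have eq': "card {x \<in> X. r x \<le> k \<and> c x = j} = min k (h j)" if "j \<in> J" for j k
  proof (rule ccontr)
    assume "card {x \<in> X. r x \<le> k \<and> c x = j} \<noteq> min k (h j)"
    with le have "card {x \<in> X. r x \<le> k \<and> c x = j} < min k (h j)" by (rule le_neq_implies_less)
    then have "(\<Sum>j\<in>J. card {x \<in> X. r x \<le> k \<and> c x = j}) < (\<Sum>j\<in>J. min k (h j))"
      using J le that by (intro sum_strict_mono_ex1) auto
    with eq[of k] show False unfolding sumX sumD by simp
  qed
  have cJ: "c x \<in> J" using x by (simp add: J_def)
  \<comment> \<open>From \<open>r x - 1\<close> to \<open>r x\<close> the count in the column of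
    \<open>x\<close> strictly grows, hence so does the minimum with the height of that column, which
    is possible only up to this height.\<close>
  have "card {y \<in> X. r y \<le> r x - 1 \<and> c y = c x} < card {y \<in> X. r y \<le> r x \<and> c y = c x}"
  proof (rule psubset_card_mono)
    have "x \<in> {y \<in> X. r y \<le> r x \<and> c y = c x}" "x \<notin> {y \<in> X. r y \<le> r x - 1 \<and> c y = c x}"
      using x r1[OF x] by auto
    then show "{y \<in> X. r y \<le> r x - 1 \<and> c y = c x} \<subset> {y \<in> X. r y \<le> r x \<and> c y = c x}"
      by auto
  qed (use X in simp)
  then have "r x \<le> h (c x)" using eq'[OF cJ, of "r x"] eq'[OF cJ, of "r x - 1"] by linarith
  with column[of "c x"] r1[OF x] show "(r x, c x) \<in> D" by auto
qed

lemma boxes_ge_1: "(i, j) \<in> boxes \<mu> \<Longrightarrow> 1 \<le> i"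
  by (simp add: boxes_def)

lemma boxes_down:
  assumes "\<mu> \<in> partitions m" "(i, j) \<in> boxes \<mu>" "1 \<le> i'" "i' \<le> i"
  shows "(i', j) \<in> boxes \<mu>"
proof -
  have "\<mu> ! (i - 1) \<le> \<mu> ! (i' - 1)"
  proof (cases "i' = i")
    case False
    with assms have "i' - 1 < i - 1" "i - 1 < length \<mu>" by (auto simp: boxes_def)
    with assms(1) show ?thesis by (auto simp: partitions_def dest: sorted_wrt_nth_less)
  qed simp
  with assms show ?thesis by (auto simp: boxes_def)
qed

text \<open>The parts are the differences of the partial sums, continued by 0 beyond the end of the
  list; since parts are positive, the lengths agree as well.\<close>

lemma partitions_eqI:
  assumes \<mu>: "\<mu> \<in> partitions m" and \<nu>: "\<nu> \<in> partitions m"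
    and eq: "\<And>k. card {(i, j) \<in> boxes \<mu>. i \<le> k} = card {(i, j) \<in> boxes \<nu>. i \<le> k}"
  shows "\<mu> = \<nu>"
proof -
  have *: "card {(i, j) \<in> boxes \<rho>. i \<le> k} = sum_list (take k \<rho>)" for \<rho> k
  proof (cases "k \<le> length \<rho>")
    case False
    then have "{(i, j) \<in> boxes \<rho>. i \<le> k} = {(i, j) \<in> boxes \<rho>. i \<le> length \<rho>}" by (auto simp: boxes_def)
    with False show ?thesis by (simp add: card_boxes_rows)
  qed (rule card_boxes_rows)
  have **: "(if k < length \<rho> then \<rho> ! k else 0) = sum_list (take (Suc k) \<rho>) - sum_list (take k \<rho>)" for \<rho> :: "nat list" and k
    by (auto simp: take_Suc_conv_app_nth)
  have nth: "(if k < length \<mu> then \<mu> ! k else 0) = (if k < length \<nu> then \<nu> ! k else 0)" for k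
    unfolding ** using eq[unfolded *] by simp
  have pos: "\<rho> ! k > 0" if "\<rho> \<in> partitions m" "k < length \<rho>" for \<rho> k
    using that nth_mem[OF that(2)] by (intro gr0I) (auto simp: partitions_def)
  have len: "k < length \<mu> \<longleftrightarrow> k < length \<nu>" for k
    using nth[of k] pos[OF \<mu>, of k] pos[OF \<nu>, of k] by (auto split: if_splits)
  then have "length \<mu> = length \<nu>" by (metis nat_neq_iff)
  with nth show ?thesis by (intro nth_equalityI) (auto split: if_splits, metis)
qed

text \<open>The classical condition that a row of the first tableau and a column of the
  \<open>g\<close>-translate of the second share at most one entry. It separates the
  \<open>g\<close> that survive between a row sum and a column sum from those that are
  annihilated.\<close>

definition transversal :: "nat \<Rightarrow> nat list \<Rightarrow> nat list \<Rightarrow> (nat \<Rightarrow> nat) \<Rightarrow> bool"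
  where "transversal m \<mu> \<nu> g \<longleftrightarrow> inj_on (\<lambda>x. (rowof \<mu> x, colof \<nu> (inv g x))) {1..m}"

text \<open>Two entries sharing a row and a column give a transposition in the row group. Carried
  through \<open>g\<close>, it becomes a transposition in the column group, which contributes a
  sign, so the product equals its own negative.\<close>

lemma row_gelem_col_eq_0:
  assumes \<mu>: "sum_list \<mu> = m" and \<nu>: "sum_list \<nu> = m" and g: "g \<in> symgrp m"
    and "\<not> transversal m \<mu> \<nu> g"
  shows "gmult m (row_sum m \<mu>) (gmult m (gelem g) (col_sum m \<nu>)) = 0"
proof -
  obtain x y where xy: "x \<in> {1..m}" "y \<in> {1..m}" "x \<noteq> y" "rowof \<mu> x = rowof \<mu> y"
    "colof \<nu> (inv g x) = colof \<nu> (inv g y)"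
    using assms(4) by (auto simp: transversal_def inj_on_def)
  define q where "q = transpose (inv g x) (inv g y)"
  have in': "inv g x \<in> {1..m}" "inv g y \<in> {1..m}"
    using xy symgrp_mem_iff[OF inv_symgrp[OF g]] by blast+
  have p: "transpose x y \<in> row_group m \<mu>"
    using xy by (simp add: row_group_label[OF \<mu>] transpose_label_group)
  have q: "q \<in> col_group m \<nu>"
    using xy in' by (simp add: col_group_label[OF \<nu>] transpose_label_group q_def)
  have "inj g" using g bij_symgrp bij_is_inj by blast
  then have "transpose (g a) (g b) \<circ> g = g \<circ> transpose a b" for a b
    by (auto simp: fun_eq_iff transpose_def inj_def)
  from this[of "inv g x" "inv g y"] have comm: "transpose x y \<circ> g = g \<circ> q"
    using g by (simp add: q_def)
  have "inv g x \<noteq> inv g y" using xy(3) symgrp_simps(4)[OF g] by metis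
  then have sg: "sign q = -1" by (simp add: q_def sign_swap_id)
  let ?Z = "gmult m (row_sum m \<mu>) (gmult m (gelem g) (col_sum m \<nu>))"
  have "?Z = gmult m (gmult m (row_sum m \<mu>) (gelem (transpose x y))) (gmult m (gelem g) (col_sum m \<nu>))"
    using row_sum_gelem[OF \<mu> p] by simp
  also have "\<dots> = gmult m (row_sum m \<mu>) (gmult m (gmult m (gelem (transpose x y)) (gelem g)) (col_sum m \<nu>))"
    by (simp only: gmult_assoc)
  also have "gmult m (gelem (transpose x y)) (gelem g) = gmult m (gelem g) (gelem q)"
    using g p q comm by (simp add: gmult_gelem_gelem row_group_symgrp col_group_symgrp)
  also have "gmult m (row_sum m \<mu>) (gmult m (gmult m (gelem g) (gelem q)) (col_sum m \<nu>)) = (-1) *\<^sub>C ?Z"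
    by (simp only: gmult_assoc gelem_col_sum[OF \<nu> q] sg gmult_scale_right of_int_minus of_int_1)
  finally have eq: "?Z = (-1) *\<^sub>C ?Z" .
  show ?thesis
  proof
    fix s show "?Z s = 0 s" using arg_cong[OF eq, of "\<lambda>f. f s"] by (simp add: fscale_def)
  qed
qed

text \<open>Translating by \<open>g\<close> does not change column lengths, so the count applies to
  the rows of \<open>\<mu>\<close> and the translated columns of \<open>\<nu>\<close>: a transversal
  exists only if \<open>\<nu>\<close> dominates \<open>\<mu>\<close>.\<close>

lemma transversal_dominance:
  assumes \<mu>: "\<mu> \<in> partitions m" and \<nu>: "\<nu> \<in> partitions m" and g: "g \<in> symgrp m"
    and sep: "transversal m \<mu> \<nu> g"
  shows "card {(i, j) \<in> boxes \<mu>. i \<le> k} \<le> card {(i, j) \<in> boxes \<nu>. i \<le> k}"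
    and "(\<And>k. card {(i, j) \<in> boxes \<mu>. i \<le> k} = card {(i, j) \<in> boxes \<nu>. i \<le> k}) \<Longrightarrow>
      x \<in> {1..m} \<Longrightarrow> (rowof \<mu> x, colof \<nu> (inv g x)) \<in> boxes \<nu>"
proof -
  have s\<mu>: "sum_list \<mu> = m" and s\<nu>: "sum_list \<nu> = m" using \<mu> \<nu> by (auto simp: partitions_def)
  have c: "card {x \<in> {1..m}. rowof \<mu> x \<le> k} = card {(i, j) \<in> boxes \<mu>. i \<le> k}" for k
    by (rule card_cells[OF s\<mu>])
  have r1: "1 \<le> rowof \<mu> x" if "x \<in> {1..m}" for x
    using cell_in_boxes[OF s\<mu> that] by (auto simp: boxes_def)
  have cols: "card {x \<in> {1..m}. colof \<nu> (inv g x) = j} = card {i. (i, j) \<in> boxes \<nu>}" for j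
  proof -
    have "card {x \<in> {1..m}. colof \<nu> (inv g x) = j} = card {x \<in> {1..m}. colof \<nu> x = j}"
      by (rule bij_betw_same_card[of "inv g"], rule bij_betwI[where g = g])
        (use g symgrp_mem_iff[OF g] symgrp_mem_iff[OF inv_symgrp[OF g]] in auto)
    also have "\<dots> = card {(i, j') \<in> boxes \<nu>. j' = j}" by (rule card_cells[OF s\<nu>])
    also have "{(i, j') \<in> boxes \<nu>. j' = j} = (\<lambda>i. (i, j)) ` {i. (i, j) \<in> boxes \<nu>}" by auto
    also have "card \<dots> = card {i. (i, j) \<in> boxes \<nu>}" by (rule card_image) (simp add: inj_on_def)
    finally show ?thesis .
  qed
  note d = dominance_count[of "{1..m}" "boxes \<nu>" "rowof \<mu>" "\<lambda>x. colof \<nu> (inv g x)",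
      OF finite_atLeastAtMost finite_boxes sep[unfolded transversal_def] r1 boxes_ge_1 boxes_down[OF \<nu>] cols, unfolded c]
  show "card {(i, j) \<in> boxes \<mu>. i \<le> k} \<le> card {(i, j) \<in> boxes \<nu>. i \<le> k}"
    by (rule d(1))
  show "(rowof \<mu> x, colof \<nu> (inv g x)) \<in> boxes \<nu>"
    if "\<And>k. card {(i, j) \<in> boxes \<mu>. i \<le> k} = card {(i, j) \<in> boxes \<nu>. i \<le> k}" "x \<in> {1..m}"
    by (rule d(2)) (use that in auto)
qed

text \<open>Von Neumann's lemma. Each entry is moved inside its row to the column in which the
  translated tableau has it; by the equality case of the dominance count the target is a box of the
  diagram.\<close>

lemma transversal_decompose:
  assumes \<mu>: "\<mu> \<in> partitions m" and g: "g \<in> symgrp m" and sep: "transversal m \<mu> \<mu> g"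
  obtains p q where "p \<in> row_group m \<mu>" "q \<in> col_group m \<mu>" "g = p \<circ> q"
proof -
  have s: "sum_list \<mu> = m" using \<mu> by (auto simp: partitions_def)
  define f where "f x = (rowof \<mu> x, colof \<mu> (inv g x))" for x
  have fbox: "f x \<in> boxes \<mu>" if "x \<in> {1..m}" for x
    unfolding f_def by (rule transversal_dominance(2)[OF \<mu> \<mu> g sep refl that])
  \<comment> \<open>The inverse of the wanted row permutation: it keeps the row of \<open>x\<close>
    and takes the column from \<open>inv g x\<close>, so that \<open>p' \<circ> g\<close> preserves
    columns.\<close>
  define p' where "p' x = (if x \<in> {1..m} then tableau \<mu> (f x) else x)" for x
  have p'_in: "p' x \<in> {1..m}" if "x \<in> {1..m}" for x
    using tableau_in[OF s fbox[OF that]] that by (simp add: p'_def)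
  have "inj_on p' {1..m}"
  proof (rule inj_onI)
    fix x y assume xy: "x \<in> {1..m}" "y \<in> {1..m}" "p' x = p' y"
    then have "f x = f y" using inj_on_tableau fbox by (auto simp: p'_def dest: inj_onD)
    with sep xy show "x = y" unfolding transversal_def f_def by (auto dest: inj_onD)
  qed
  then have "bij_betw p' {1..m} {1..m}"
    by (rule bij_betw_imageI) (rule endo_inj_surj, use p'_in \<open>inj_on p' {1..m}\<close> in auto)
  then have p': "p' \<in> symgrp m"
    unfolding symgrp_def by (auto intro!: bij_imp_permutes simp: p'_def)
  have row: "rowof \<mu> (p' x) = rowof \<mu> x" and col: "colof \<mu> (p' x) = colof \<mu> (inv g x)"
    if "x \<in> {1..m}" for x
    using that fbox[OF that] unfolding p'_def f_def by auto
  have p: "p' \<in> row_group m \<mu>"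
    using p' row by (simp add: row_group_eq[OF s])
  have q: "p' \<circ> g \<in> col_group m \<mu>"
    unfolding col_group_eq[OF s]
  proof (intro CollectI conjI ballI)
    fix x assume "x \<in> {1..m}"
    then have "g x \<in> {1..m}" using g symgrp_mem_iff by blast
    with col[of "g x"] g show "colof \<mu> ((p' \<circ> g) x) = colof \<mu> x" by simp
  qed (use p' g in simp)
  show thesis
  proof (rule that)
    show "inv p' \<in> row_group m \<mu>" using p label_group_inv by (simp add: row_group_label[OF s])
    show "p' \<circ> g \<in> col_group m \<mu>" by (rule q)
    show "g = inv p' \<circ> (p' \<circ> g)" using p' by simp
  qed
qed

section \<open>The Young symmetrizer and products around it\<close>

context
  fixes m :: nat and \<mu> :: "nat list"
  assumes s: "sum_list \<mu> = m"
begin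

lemma row_sum_apply: "row_sum m \<mu> \<sigma> = (if \<sigma> \<in> row_group m \<mu> then 1 else 0)"
  by (simp add: row_sum_def fun_sum_apply gelem_apply)

lemma col_sum_apply: "col_sum m \<mu> \<sigma> = (if \<sigma> \<in> col_group m \<mu> then of_int (sign \<sigma>) else 0)"
  by (simp add: col_sum_def fun_sum_apply fscale_apply gelem_apply if_distrib cong: if_cong)

lemma row_col_group_Int: "p \<in> row_group m \<mu> \<Longrightarrow> p \<in> col_group m \<mu> \<Longrightarrow> p = id"
proof
  fix x assume p: "p \<in> row_group m \<mu>" "p \<in> col_group m \<mu>"
  show "p x = id x"
  proof (cases "x \<in> {1..m}")
    case True
    then have "p x \<in> {1..m}" using p row_group_symgrp symgrp_mem_iff by blast
    with True p cell_inject[OF s this True] show ?thesis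
      by (auto simp: row_group_eq[OF s] col_group_eq[OF s])
  next
    case False
    with p show ?thesis by (auto simp: row_group_def symgrp_def permutes_def)
  qed
qed

lemma young_symmetrizer_in [simp]: "young_symmetrizer m \<mu> \<in> group_algebra m"
  by (simp add: young_symmetrizer_eq)

lemma young_symmetrizer_real: "young_symmetrizer m \<mu> \<sigma> \<in> \<real>"
  unfolding young_symmetrizer_eq by (intro gmult_real row_sum_real col_sum_real)

text \<open>A row permutation times a column permutation is \<open>id\<close> only if both are,
  since the two groups meet trivially. With this normalization a multiple of the Young symmetrizer
  reveals its scalar as the coefficient at \<open>id\<close>.\<close>

lemma young_symmetrizer_id: "young_symmetrizer m \<mu> id = 1"
proof -
  have "young_symmetrizer m \<mu> id = (\<Sum>\<rho>\<in>symgrp m. row_sum m \<mu> \<rho> * col_sum m \<mu> (inv \<rho>))"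
    by (simp add: young_symmetrizer_eq gmult_apply)
  also have "\<dots> = (\<Sum>\<rho>\<in>symgrp m. if \<rho> = id then 1 else 0)"
  proof (rule sum.cong[OF refl])
    fix \<rho> assume \<rho>: "\<rho> \<in> symgrp m"
    show "row_sum m \<mu> \<rho> * col_sum m \<mu> (inv \<rho>) = (if \<rho> = id then 1 else 0)"
    proof (cases "\<rho> = id")
      case True
      then show ?thesis
        by (simp add: row_sum_apply col_sum_apply row_group_label[OF s] col_group_label[OF s] label_group_id)
    next
      case False
      have "\<not> (\<rho> \<in> row_group m \<mu> \<and> inv \<rho> \<in> col_group m \<mu>)"
      proof
        assume *: "\<rho> \<in> row_group m \<mu> \<and> inv \<rho> \<in> col_group m \<mu>"
        then have "inv (inv \<rho>) \<in> col_group m \<mu>"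
          unfolding col_group_label[OF s] by (blast intro: label_group_inv)
        with * \<rho> row_col_group_Int[of \<rho>] False show False by simp
      qed
      with False show ?thesis by (auto simp: row_sum_apply col_sum_apply)
    qed
  qed
  also have "\<dots> = 1" by (simp add: finite_symgrp)
  finally show ?thesis .
qed

text \<open>With \<open>c = a b\<close> and \<open>c\<^sup>* = b a\<close>, the product \<open>c c\<^sup>* c\<close> is a multiple of \<open>c c\<close>, while positivity
  forces it to be nonzero.\<close>

lemma young_symmetrizer_sq_neq_0:
  "gmult m (young_symmetrizer m \<mu>) (young_symmetrizer m \<mu>) \<noteq> 0"
proof
  let ?a = "row_sum m \<mu>" and ?b = "col_sum m \<mu>" and ?c = "young_symmetrizer m \<mu>"
  assume 0: "gmult m ?c ?c = 0"
  have star: "gstar m ?c = gmult m ?b ?a"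
    by (simp add: young_symmetrizer_eq gstar_gmult gstar_row_sum[OF s] gstar_col_sum[OF s])
  define y where "y = gmult m ?c (gstar m ?c)"
  have "gmult m (gstar m ?c) ?c = gmult m ?b (gmult m (gmult m ?a ?a) ?b)"
    unfolding star by (simp add: young_symmetrizer_eq gmult_assoc)
  also have "\<dots> = of_nat (card (row_group m \<mu>)) *\<^sub>C gmult m ?b ?c"
    by (simp add: row_sum_sq[OF s] gmult_scale_left gmult_scale_right young_symmetrizer_eq)
  finally have "gmult m y ?c = of_nat (card (row_group m \<mu>)) *\<^sub>C gmult m ?c (gmult m ?b ?c)"
    by (simp add: y_def gmult_assoc gmult_scale_right)
  also have "gmult m ?c (gmult m ?b ?c) = gmult m ?a (gmult m (gmult m ?b ?b) ?c)"
    by (simp add: young_symmetrizer_eq gmult_assoc)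
  also have "\<dots> = of_nat (card (col_group m \<mu>)) *\<^sub>C gmult m ?c ?c"
    by (simp add: col_sum_sq[OF s] gmult_scale_left gmult_scale_right)
       (simp add: young_symmetrizer_eq gmult_assoc)
  finally have yc: "gmult m y ?c = 0" unfolding 0 by (simp add: fscale_def fun_eq_iff)
  have "gstar m y = y" by (simp add: y_def gstar_gmult gstar_gstar)
  then have "gmult m y (gstar m y) = gmult m (gmult m y ?c) (gstar m ?c)"
    by (simp add: y_def gmult_assoc)
  then have yy: "gmult m y (gstar m y) = 0" by (simp add: yc)
  have "gstar m ?c \<sigma> \<in> \<real>" for \<sigma>
    unfolding gstar_def using young_symmetrizer_real by simp
  then have yr: "y \<sigma> \<in> \<real>" for \<sigma>
    unfolding y_def by (intro gmult_real young_symmetrizer_real)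
  have "y \<in> group_algebra m" by (simp add: y_def)
  then have "y = 0" using yr yy by (rule gmult_gstar_eq_0)
  then have "?c = 0"
    unfolding y_def by (rule gmult_gstar_eq_0[OF young_symmetrizer_in young_symmetrizer_real])
  with young_symmetrizer_id show False by simp
qed

end

text \<open>By linearity it is enough to treat a group element \<open>g\<close>. A transversal one
  factors as \<open>p \<circ> q\<close>, and the factors are absorbed up to the sign of
  \<open>q\<close>; any other one gives 0.\<close>

lemma row_x_col:
  assumes \<mu>: "\<mu> \<in> partitions m" and x: "x \<in> group_algebra m"
  shows "\<exists>k. gmult m (row_sum m \<mu>) (gmult m x (col_sum m \<mu>)) = k *\<^sub>C young_symmetrizer m \<mu>"
proof -
  have s: "sum_list \<mu> = m" using \<mu> by (simp add: partitions_def)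
  let ?a = "row_sum m \<mu>" and ?b = "col_sum m \<mu>" and ?c = "young_symmetrizer m \<mu>"
  have "\<exists>k. gmult m ?a (gmult m (gelem g) ?b) = k *\<^sub>C ?c" if g: "g \<in> symgrp m" for g
  proof (cases "transversal m \<mu> \<mu> g")
    case True
    then obtain p q where pq: "p \<in> row_group m \<mu>" "q \<in> col_group m \<mu>" "g = p \<circ> q"
      using transversal_decompose[OF \<mu> g] by blast
    then have "gelem g = gmult m (gelem p) (gelem q)"
      by (simp add: gmult_gelem_gelem row_group_symgrp col_group_symgrp)
    then have "gmult m ?a (gmult m (gelem g) ?b) = gmult m (gmult m ?a (gelem p)) (gmult m (gelem q) ?b)"
      by (simp add: gmult_assoc)
    also have "\<dots> = of_int (sign q) *\<^sub>C ?c"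
      using pq by (simp add: row_sum_gelem[OF s] gelem_col_sum[OF s] gmult_scale_right young_symmetrizer_eq)
    finally show ?thesis ..
  next
    case False
    then show ?thesis using row_gelem_col_eq_0[OF s s g] by (intro exI[of _ 0]) (simp add: fscale_def fun_eq_iff)
  qed
  then obtain k where k: "\<And>g. g \<in> symgrp m \<Longrightarrow> gmult m ?a (gmult m (gelem g) ?b) = k g *\<^sub>C ?c"
    by metis
  have "gmult m ?a (gmult m x ?b) = (\<Sum>g\<in>symgrp m. x g *\<^sub>C gmult m ?a (gmult m (gelem g) ?b))"
    by (subst group_algebra_expand[OF x])
      (simp add: gmult_sum_left gmult_sum_right gmult_scale_left gmult_scale_right)
  also have "\<dots> = (\<Sum>g\<in>symgrp m. (x g * k g) *\<^sub>C ?c)"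
    by (intro sum.cong) (simp_all add: k)
  also have "\<dots> = (\<Sum>g\<in>symgrp m. x g * k g) *\<^sub>C ?c"
    by (simp add: fun_vs.scale_sum_left)
  finally show ?thesis ..
qed

text \<open>The left column sum, \<open>x\<close> and the right row sum merge into one element
  standing between a row sum and a column sum.\<close>

lemma young_x_young:
  assumes \<mu>: "\<mu> \<in> partitions m" and x: "x \<in> group_algebra m"
  shows "\<exists>k. gmult m (young_symmetrizer m \<mu>) (gmult m x (young_symmetrizer m \<mu>)) = k *\<^sub>C young_symmetrizer m \<mu>"
  using row_x_col[OF \<mu>, of "gmult m (col_sum m \<mu>) (gmult m x (row_sum m \<mu>))"]
  by (simp add: young_symmetrizer_eq gmult_assoc)

lemma row_x_col_eq_0:
  assumes "sum_list \<mu> = m" "sum_list \<nu> = m"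
    and "\<And>g. g \<in> symgrp m \<Longrightarrow> \<not> transversal m \<mu> \<nu> g" and x: "x \<in> group_algebra m"
  shows "gmult m (row_sum m \<mu>) (gmult m x (col_sum m \<nu>)) = 0"
  by (subst group_algebra_expand[OF x])
    (simp add: gmult_sum_left gmult_sum_right gmult_scale_left gmult_scale_right row_gelem_col_eq_0 assms)

text \<open>Transversals in both directions would make each partition dominate the other and hence
  make them equal. So one direction has none, and every group element is annihilated there.\<close>

lemma young_x_young_neq:
  assumes \<mu>: "\<mu> \<in> partitions m" and \<nu>: "\<nu> \<in> partitions m" and neq: "\<mu> \<noteq> \<nu>"
    and x: "x \<in> group_algebra m"
  shows "gmult m (young_symmetrizer m \<mu>) (gmult m x (young_symmetrizer m \<nu>)) = 0"
proof -
  have s: "sum_list \<mu> = m" "sum_list \<nu> = m" using \<mu> \<nu> by (simp_all add: partitions_def)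
  let ?a = "row_sum m" and ?b = "col_sum m"
  have "\<not> (transversal m \<mu> \<nu> g \<and> transversal m \<nu> \<mu> h)" if "g \<in> symgrp m" "h \<in> symgrp m" for g h
    using transversal_dominance(1)[OF \<mu> \<nu> that(1)] transversal_dominance(1)[OF \<nu> \<mu> that(2)]
      partitions_eqI[OF \<mu> \<nu>] neq by (meson le_antisym)
  then consider "\<And>g. g \<in> symgrp m \<Longrightarrow> \<not> transversal m \<mu> \<nu> g" | "\<And>g. g \<in> symgrp m \<Longrightarrow> \<not> transversal m \<nu> \<mu> g"
    by blast
  then show ?thesis
  proof cases
    case 1
    have "gmult m (?a \<mu>) (gmult m (gmult m (?b \<mu>) (gmult m x (?a \<nu>))) (?b \<nu>)) = 0"
      by (rule row_x_col_eq_0[OF s 1]) simp_all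
    then show ?thesis by (simp add: young_symmetrizer_eq gmult_assoc)
  next
    case 2
    have "gmult m (?a \<nu>) (gmult m (gstar m x) (?b \<mu>)) = 0"
      by (rule row_x_col_eq_0[OF s(2,1) 2]) simp_all
    \<comment> \<open>The star reverses the product and fixes row and column sums, so the vanishing
      reappears for column sum, \<open>x\<close>, row sum: the middle of the product of the two
      Young symmetrizers.\<close>
    then have "gstar m (gmult m (?a \<nu>) (gmult m (gstar m x) (?b \<mu>))) = 0"
      by (simp add: gstar_def fun_eq_iff)
    then have "gmult m (?b \<mu>) (gmult m x (?a \<nu>)) = 0"
      by (simp add: gstar_gmult gstar_row_sum gstar_col_sum s gstar_gstar[OF x] gmult_assoc)
    then have "gmult m (?a \<mu>) (gmult m (gmult m (?b \<mu>) (gmult m x (?a \<nu>))) (?b \<nu>)) = 0"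
      by simp
    then show ?thesis by (simp add: young_symmetrizer_eq gmult_assoc)
  qed
qed

section \<open>Characters and central idempotents\<close>

lemma linear_gmult_left: "Vector_Spaces.linear fscale fscale (gmult m x)"
  by unfold_locales (simp_all add: gmult_add_right gmult_scale_right)

lemma linear_gmult_right: "Vector_Spaces.linear fscale fscale (\<lambda>y. gmult m y x)"
  by unfold_locales (simp_all add: gmult_add_left gmult_scale_left)

text \<open>The trace is defined through some chosen basis of \<open>U\<close>. Composing with the
  projection \<open>p\<close> trades it for a trace over the whole algebra in the basis of group
  elements, which can be computed: both are the same double sum over basis vectors of
  \<open>U\<close> and group elements.\<close>

lemma trace_on_projection:
  fixes p f :: "galg \<Rightarrow> galg"
  assumes f: "Vector_Spaces.linear fscale fscale f" and p: "Vector_Spaces.linear fscale fscale p"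
    and U: "p ` group_algebra m = U" and sub: "U \<subseteq> group_algebra m"
    and fix_p: "\<And>u. u \<in> U \<Longrightarrow> p u = u" and fU: "\<And>u. u \<in> U \<Longrightarrow> f u \<in> U"
  shows "trace_on U f = (\<Sum>g\<in>symgrp m. f (p (gelem g)) g)"
proof -
  interpret f: Vector_Spaces.linear fscale fscale f by (rule f)
  interpret p: Vector_Spaces.linear fscale fscale p by (rule p)
  have GA: "fun_vs.subspace (group_algebra m)"
    by (rule fun_vs.subspaceI) simp_all
  have subU: "fun_vs.subspace U"
    unfolding U[symmetric] by (rule p.subspace_image[OF GA])
  define B where "B = (SOME B. fun_vs.independent B \<and> fun_vs.span B = U)"
  have "\<exists>B. fun_vs.independent B \<and> fun_vs.span B = U"
  proof -
    obtain B where "B \<subseteq> U" "fun_vs.independent B" "U \<subseteq> fun_vs.span B"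
      using fun_vs.maximal_independent_subset by blast
    moreover from this have "fun_vs.span B \<subseteq> U" by (intro fun_vs.span_minimal subU)
    ultimately show ?thesis by blast
  qed
  from someI_ex[OF this] have B: "fun_vs.independent B" "fun_vs.span B = U"
    unfolding B_def[symmetric] by blast+
  have "B \<subseteq> fun_vs.span (gelem ` symgrp m)"
  proof
    fix x assume "x \<in> B"
    then have "x \<in> group_algebra m" using B sub fun_vs.span_base by blast
    then show "x \<in> fun_vs.span (gelem ` symgrp m)"
      by (subst group_algebra_expand[of x m])
        (auto intro!: fun_vs.span_sum fun_vs.span_scale intro: fun_vs.span_base)
  qed
  then have finB: "finite B"
    using fun_vs.independent_span_bound[OF _ B(1)] finite_symgrp by blast
  have BU: "b \<in> U" if "b \<in> B" for b using B(2) fun_vs.span_base[OF that] by simp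
  let ?r = "fun_vs.representation B"
  have expand: "u = (\<Sum>b\<in>B. ?r u b *\<^sub>C b)" if "u \<in> U" for u
    by (rule fun_vs.sum_representation_eq[symmetric]) (use that B finB in auto)
  have pU: "p x \<in> U" if "x \<in> group_algebra m" for x using that U by blast
  \<comment> \<open>The coordinates of \<open>u\<close> as a linear function of its values, obtained
    by applying \<open>p\<close> to the expansion of \<open>u\<close> in group elements.\<close>
  have rb: "?r u b = (\<Sum>g\<in>symgrp m. u g * ?r (p (gelem g)) b)" if u: "u \<in> U" for u b
  proof -
    have "u = p (\<Sum>g\<in>symgrp m. u g *\<^sub>C gelem g)"
      using fix_p[OF u] group_algebra_expand[of u m] sub u by auto
    also have "\<dots> = (\<Sum>g\<in>symgrp m. u g *\<^sub>C p (gelem g))"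
      by (simp add: p.sum p.scale)
    finally have "?r u b = ?r (\<Sum>g\<in>symgrp m. u g *\<^sub>C p (gelem g)) b" by simp
    also have "\<dots> = (\<Sum>g\<in>symgrp m. ?r (u g *\<^sub>C p (gelem g)) b)"
      using B(1) by (subst fun_vs.representation_sum) (auto simp: B(2) fun_sum_apply intro!: fun_vs.subspace_scale[OF subU] pU)
    also have "\<dots> = (\<Sum>g\<in>symgrp m. u g * ?r (p (gelem g)) b)"
      using B(1) by (intro sum.cong refl) (simp add: fun_vs.representation_scale B(2) pU)
    finally show ?thesis .
  qed
  have "trace_on U f = (\<Sum>b\<in>B. ?r (f b) b)"
    by (simp add: trace_on_def B_def[symmetric])
  also have "\<dots> = (\<Sum>b\<in>B. \<Sum>g\<in>symgrp m. f b g * ?r (p (gelem g)) b)"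
    by (intro sum.cong refl rb fU BU)
  also have "\<dots> = (\<Sum>g\<in>symgrp m. \<Sum>b\<in>B. f b g * ?r (p (gelem g)) b)"
    by (rule sum.swap)
  \<comment> \<open>Summed over \<open>b\<close>, the coordinates reassemble
    \<open>p (gelem g)\<close>.\<close>
  also have "\<dots> = (\<Sum>g\<in>symgrp m. f (p (gelem g)) g)"
  proof (rule sum.cong[OF refl])
    fix g assume "g \<in> symgrp m"
    then have "f (p (gelem g)) = f (\<Sum>b\<in>B. ?r (p (gelem g)) b *\<^sub>C b)"
      using expand[OF pU] by simp
    then have "f (p (gelem g)) g = (\<Sum>b\<in>B. ?r (p (gelem g)) b * f b g)"
      by (simp add: f.sum f.scale fun_sum_apply fscale_apply)
    then show "(\<Sum>b\<in>B. f b g * ?r (p (gelem g)) b) = f (p (gelem g)) g"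
      by (simp add: mult.commute)
  qed
  finally show ?thesis .
qed

section \<open>Sums of conjugates and central idempotents\<close>

text \<open>Averaging over conjugation up to the factor \<open>card (symgrp m)\<close>. The results
  are central, and the central idempotents turn out to be multiples of such elements.\<close>

definition conj_sum :: "nat \<Rightarrow> galg \<Rightarrow> galg"
  where "conj_sum m x = (\<Sum>g\<in>symgrp m. gmult m (gelem g) (gmult m x (gelem (inv g))))"

lemma conj_sum_in [simp]: "conj_sum m x \<in> group_algebra m"
  by (simp add: conj_sum_def sum_in_group_algebra)

lemma conj_sum_apply:
  assumes "\<sigma> \<in> symgrp m"
  shows "conj_sum m x \<sigma> = (\<Sum>g\<in>symgrp m. x (inv g \<circ> \<sigma> \<circ> g))"
  unfolding conj_sum_def fun_sum_apply
  using assms by (intro sum.cong refl) (simp add: gmult_gelem_left gmult_gelem_right)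

lemma conj_sum_central_gelem:
  assumes h: "h \<in> symgrp m"
  shows "gmult m (gelem h) (conj_sum m x) = gmult m (conj_sum m x) (gelem h)"
proof -
  have "gmult m (conj_sum m x) (gelem h) =
      (\<Sum>g\<in>symgrp m. gmult m (gelem (h \<circ> g)) (gmult m x (gmult m (gelem (inv (h \<circ> g))) (gelem h))))"
    unfolding conj_sum_def gmult_sum_left gmult_assoc by (rule sum_mult_left[OF h, symmetric])
  also have "\<dots> = gmult m (gelem h) (conj_sum m x)"
    unfolding conj_sum_def gmult_sum_right using h
    by (intro sum.cong refl)
      (simp add: gmult_gelem_gelem[symmetric] gmult_assoc[symmetric] del: o_apply,
       simp add: gmult_gelem_gelem gmult_assoc inv_comp_symgrp[of _ m] comp_assoc)
  finally show ?thesis by simp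
qed

lemma conj_sum_central:
  assumes y: "y \<in> group_algebra m"
  shows "gmult m y (conj_sum m x) = gmult m (conj_sum m x) y"
proof -
  have "gmult m y (conj_sum m x) = (\<Sum>h\<in>symgrp m. y h *\<^sub>C gmult m (gelem h) (conj_sum m x))"
    by (subst group_algebra_expand[OF y]) (simp add: gmult_sum_left gmult_scale_left)
  also have "\<dots> = (\<Sum>h\<in>symgrp m. y h *\<^sub>C gmult m (conj_sum m x) (gelem h))"
    by (simp add: conj_sum_central_gelem)
  also have "\<dots> = gmult m (conj_sum m x) y"
    by (subst (2) group_algebra_expand[OF y]) (simp add: gmult_sum_right gmult_scale_right)
  finally show ?thesis .
qed

lemma conj_sum_sum: "conj_sum m (\<Sum>i\<in>I. f i) = (\<Sum>i\<in>I. conj_sum m (f i))"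
  unfolding conj_sum_def gmult_sum_left gmult_sum_right by (rule sum.swap)

lemma conj_sum_scale: "conj_sum m (k *\<^sub>C x) = k *\<^sub>C conj_sum m x"
  by (simp add: conj_sum_def gmult_scale_left gmult_scale_right fun_vs.scale_sum_right)

text \<open>Sums of conjugates behave like a trace: replacing \<open>g\<close> by
  \<open>g \<circ> p\<close> moves the factor \<open>p\<close> to the other side.\<close>

lemma conj_sum_commute_gelem:
  assumes p: "p \<in> symgrp m"
  shows "conj_sum m (gmult m x (gelem p)) = conj_sum m (gmult m (gelem p) x)"
proof -
  have "conj_sum m (gmult m x (gelem p)) =
    (\<Sum>g\<in>symgrp m. gmult m (gelem (g \<circ> p)) (gmult m (gmult m x (gelem p)) (gelem (inv (g \<circ> p)))))"
    unfolding conj_sum_def by (rule sum_mult_right[OF p, symmetric])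
  also have "\<dots> = conj_sum m (gmult m (gelem p) x)"
    unfolding conj_sum_def using p
    by (intro sum.cong refl)
      (simp add: gmult_assoc inv_comp_symgrp[of _ m] gmult_gelem_gelem,
       simp add: gmult_assoc gmult_gelem_gelem[symmetric])
  finally show ?thesis .
qed

lemma conj_sum_commute:
  assumes y: "y \<in> group_algebra m"
  shows "conj_sum m (gmult m x y) = conj_sum m (gmult m y x)"
proof -
  have "conj_sum m (gmult m x y) = (\<Sum>h\<in>symgrp m. y h *\<^sub>C conj_sum m (gmult m x (gelem h)))"
    by (subst group_algebra_expand[OF y])
      (simp add: gmult_sum_right gmult_scale_right conj_sum_sum conj_sum_scale)
  also have "\<dots> = (\<Sum>h\<in>symgrp m. y h *\<^sub>C conj_sum m (gmult m (gelem h) x))"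
    by (simp add: conj_sum_commute_gelem)
  also have "\<dots> = conj_sum m (gmult m y x)"
    by (subst (2) group_algebra_expand[OF y])
      (simp add: gmult_sum_left gmult_scale_left conj_sum_sum conj_sum_scale)
  finally show ?thesis .
qed

lemma gstar_conj_sum: "gstar m (conj_sum m x) = conj_sum m (gstar m x)"
  unfolding conj_sum_def gstar_sum
  by (intro sum.cong refl) (simp add: gstar_gmult gstar_gelem gmult_assoc)

context
  fixes m :: nat and \<mu> :: "nat list"
  assumes \<mu>: "\<mu> \<in> partitions m"
begin

abbreviation (input) "YS \<equiv> young_symmetrizer m \<mu>"

lemma sum_list_partition: "sum_list \<mu> = m" using \<mu> by (simp add: partitions_def)

lemma young_symmetrizer_in_algebra: "YS \<in> group_algebra m" by (rule young_symmetrizer_in[OF sum_list_partition])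

lemma young_symmetrizer_sandwich:
  assumes "x \<in> group_algebra m"
  shows "gmult m YS (gmult m x YS) = (gmult m YS (gmult m x YS)) id *\<^sub>C YS"
proof -
  obtain k where k: "gmult m YS (gmult m x YS) = k *\<^sub>C YS" using young_x_young[OF \<mu> assms] by blast
  show ?thesis unfolding k by (simp add: fscale_apply young_symmetrizer_id[OF sum_list_partition])
qed

lemma young_symmetrizer_quasi_idempotent:
  obtains \<kappa> where "\<kappa> \<noteq> 0" "gmult m YS YS = \<kappa> *\<^sub>C YS"
proof -
  obtain k where k: "gmult m YS YS = k *\<^sub>C YS"
    using young_x_young[OF \<mu>, of "gelem id"] by (auto simp: young_symmetrizer_in_algebra)
  moreover have "k \<noteq> 0"
    using young_symmetrizer_sq_neq_0[OF sum_list_partition] k by (auto simp: fscale_def fun_eq_iff)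
  ultimately show thesis by (rule that[rotated])
qed

context
  fixes \<kappa> :: complex
  assumes \<kappa>: "\<kappa> \<noteq> 0" and CC: "gmult m YS YS = \<kappa> *\<^sub>C YS"
begin

text \<open>Right multiplication by the idempotent \<open>?e\<close> projects the algebra onto the
  Specht module. The trace over the whole algebra then collects, for each \<open>g\<close>, the
  coefficient of \<open>\<sigma> g ?e\<close> at \<open>g\<close>, which is the value of
  \<open>?e\<close> at a conjugate of \<open>inv \<sigma>\<close>.\<close>

lemma irr_char_eq:
  assumes \<sigma>: "\<sigma> \<in> symgrp m"
  shows "irr_char m \<mu> \<sigma> = (1 / \<kappa>) * (\<Sum>g\<in>symgrp m. YS (inv g \<circ> inv \<sigma> \<circ> g))"
proof -
  let ?e = "(1 / \<kappa>) *\<^sub>C YS"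
  have ee: "gmult m YS ?e = YS" using \<kappa> by (simp add: gmult_scale_right CC)
  have "irr_char m \<mu> \<sigma> = (\<Sum>g\<in>symgrp m. gmult m (gelem \<sigma>) (gmult m (gelem g) ?e) g)"
    unfolding irr_char_def
  proof (rule trace_on_projection[where p = "\<lambda>x. gmult m x ?e", OF linear_gmult_left linear_gmult_right])
    show "(\<lambda>x. gmult m x ?e) ` group_algebra m = specht_module m \<mu>"
    proof (intro set_eqI iffI)
      fix y assume "y \<in> (\<lambda>x. gmult m x ?e) ` group_algebra m"
      then obtain x where x: "x \<in> group_algebra m" "y = gmult m x ?e" by blast
      then have eq: "y = gmult m ((1 / \<kappa>) *\<^sub>C x) YS" by (simp add: gmult_scale_left gmult_scale_right)
      show "y \<in> specht_module m \<mu>"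
        unfolding specht_module_def by (rule image_eqI[where x = "(1 / \<kappa>) *\<^sub>C x"]) (use x eq in simp_all)
    next
      fix y assume "y \<in> specht_module m \<mu>"
      then obtain x where x: "x \<in> group_algebra m" "y = gmult m x YS" by (auto simp: specht_module_def)
      then have eq: "y = gmult m (\<kappa> *\<^sub>C x) ?e" using \<kappa> by (simp add: gmult_scale_left gmult_scale_right)
      show "y \<in> (\<lambda>x. gmult m x ?e) ` group_algebra m"
        by (rule image_eqI[where x = "\<kappa> *\<^sub>C x"]) (use x eq in simp_all)
    qed
    show "specht_module m \<mu> \<subseteq> group_algebra m" by (auto simp: specht_module_def)
    fix u assume "u \<in> specht_module m \<mu>"
    then obtain x where x: "x \<in> group_algebra m" "u = gmult m x YS" by (auto simp: specht_module_def)
    then show "gmult m u ?e = u" by (simp add: gmult_assoc ee)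
    show "gmult m (gelem \<sigma>) u \<in> specht_module m \<mu>"
      using x by (auto simp: specht_module_def gmult_assoc[symmetric])
  qed
  also have "\<dots> = (\<Sum>g\<in>symgrp m. (1 / \<kappa>) * YS (inv g \<circ> inv \<sigma> \<circ> g))"
    using \<sigma> by (intro sum.cong refl) (simp add: gmult_gelem_left fscale_apply comp_assoc)
  finally show ?thesis by (simp add: sum_distrib_left)
qed

lemma irr_char_inv:
  assumes \<sigma>: "\<sigma> \<in> symgrp m"
  shows "irr_char m \<mu> (inv \<sigma>) = (1 / \<kappa>) * conj_sum m YS \<sigma>"
  using \<sigma> by (simp add: irr_char_eq conj_sum_apply)

text \<open>One factor \<open>1 / \<kappa>\<close> comes from the character. The other is the degree
  divided by the group order: the coefficient 1 of the Young symmetrizer at \<open>id\<close> makes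
  the degree \<open>card (symgrp m) / \<kappa>\<close>.\<close>

lemma central_idempotent_eq: "central_idempotent m \<mu> = (1 / \<kappa>^2) *\<^sub>C conj_sum m YS"
proof (rule group_algebra_eqI[where m = m])
  have "irr_char m \<mu> id = of_nat (card (symgrp m)) / \<kappa>"
    by (simp add: irr_char_eq young_symmetrizer_id[OF sum_list_partition])
  moreover have "card (symgrp m) \<noteq> 0" using finite_symgrp[of m] id_symgrp[of m] by (metis card_eq_0_iff empty_iff)
  ultimately have *: "irr_char m \<mu> id / of_nat (card (symgrp m)) = 1 / \<kappa>" by simp
  show "central_idempotent m \<mu> \<in> group_algebra m"
    unfolding central_idempotent_def by (auto intro!: scale_in_group_algebra sum_in_group_algebra)
  show "central_idempotent m \<mu> \<sigma> = ((1 / \<kappa>^2) *\<^sub>C conj_sum m YS) \<sigma>" if "\<sigma> \<in> symgrp m" for \<sigma>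
    unfolding central_idempotent_def * using that \<kappa>
    by (simp add: fscale_apply fun_sum_apply gelem_apply irr_char_inv if_distrib finite_symgrp power2_eq_square
      cong: if_cong)
qed auto

text \<open>By centrality the sum of conjugates times \<open>YS\<close> can be sandwiched between
  two copies of \<open>YS\<close>, hence is a multiple of \<open>YS\<close>. The multiple, read off
  at \<open>id\<close>, is \<open>\<kappa>^2\<close> and cancels the constant of
  \<open>central_idempotent_eq\<close>.\<close>

lemma central_idempotent_young: "gmult m (central_idempotent m \<mu>) YS = YS"
proof -
  let ?P = "central_idempotent m \<mu>"
  have P: "?P = (1 / \<kappa>^2) *\<^sub>C conj_sum m YS" by (rule central_idempotent_eq)
  have PC: "gmult m ?P YS = (1 / \<kappa>^2) *\<^sub>C gmult m (conj_sum m YS) YS"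
    by (simp add: P gmult_scale_left)
  have comm: "gmult m (conj_sum m YS) YS = gmult m YS (conj_sum m YS)"
    using conj_sum_central[OF young_symmetrizer_in_algebra] by simp
  have "\<kappa> *\<^sub>C gmult m (conj_sum m YS) YS = gmult m (conj_sum m YS) (gmult m YS YS)"
    by (simp add: CC gmult_scale_right)
  also have "\<dots> = gmult m YS (gmult m (conj_sum m YS) YS)"
    by (metis comm gmult_assoc)
  finally obtain k where k: "\<kappa> *\<^sub>C gmult m (conj_sum m YS) YS = k *\<^sub>C YS"
    using young_symmetrizer_sandwich[of "conj_sum m YS"] by auto
  have "gmult m (conj_sum m YS) YS = (1 / \<kappa>) *\<^sub>C (\<kappa> *\<^sub>C gmult m (conj_sum m YS) YS)" using \<kappa> by simp
  then have "gmult m (conj_sum m YS) YS = (k / \<kappa>) *\<^sub>C YS" unfolding k by simp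
  then have scal: "gmult m (conj_sum m YS) YS = (gmult m (conj_sum m YS) YS) id *\<^sub>C YS"
    by (simp add: fscale_apply young_symmetrizer_id[OF sum_list_partition])
  \<comment> \<open>In each summand the factors \<open>YS\<close>, \<open>inv g\<close>,
    \<open>YS\<close> form a sandwich and can be replaced by a scalar times
    \<open>YS\<close>.\<close>
  have "gmult m (conj_sum m YS) YS = (\<Sum>g\<in>symgrp m. gmult m (gelem g) (gmult m YS (gmult m (gelem (inv g)) YS)))"
    by (simp add: conj_sum_def gmult_sum_left gmult_assoc)
  also have "\<dots> = (\<Sum>g\<in>symgrp m. (gmult m YS (gmult m (gelem (inv g)) YS)) id *\<^sub>C gmult m (gelem g) YS)"
    by (intro sum.cong refl, subst young_symmetrizer_sandwich) (simp_all add: gmult_scale_right)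
  finally have "gmult m (conj_sum m YS) YS id = (\<Sum>g\<in>symgrp m. (gmult m YS (gmult m (gelem (inv g)) YS)) id * YS (inv g))"
    by (simp add: fun_sum_apply fscale_apply gmult_gelem_left)
  also have "\<dots> = (\<Sum>g\<in>symgrp m. (gmult m YS (gmult m (gelem g) YS)) id * YS g)"
    by (rule sum_inv_symgrp)
  \<comment> \<open>The scalars are linear in the middle element, and the weights
    \<open>YS g\<close> reassemble a third copy of \<open>YS\<close> there.\<close>
  also have "\<dots> = (gmult m YS (gmult m (\<Sum>g\<in>symgrp m. YS g *\<^sub>C gelem g) YS)) id"
    by (simp add: gmult_sum_left gmult_sum_right gmult_scale_left gmult_scale_right fun_sum_apply fscale_apply mult.commute)
  also have "\<dots> = (gmult m YS (gmult m YS YS)) id"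
    using group_algebra_expand[OF young_symmetrizer_in_algebra] by simp
  also have "\<dots> = \<kappa>^2"
    by (simp add: CC gmult_scale_right fscale_apply young_symmetrizer_id[OF sum_list_partition] power2_eq_square)
  finally show ?thesis using scal \<kappa> unfolding PC by (metis fun_vs.scale_scale fun_vs.scale_one nonzero_eq_divide_eq power_not_zero)
qed

end

lemma central_idempotent_times_young: "gmult m (central_idempotent m \<mu>) (young_symmetrizer m \<mu>) = young_symmetrizer m \<mu>"
  by (rule young_symmetrizer_quasi_idempotent) (rule central_idempotent_young)

lemma central_idempotent_conj_sum:
  "\<exists>k. central_idempotent m \<mu> = k *\<^sub>C conj_sum m (young_symmetrizer m \<mu>)"
  by (rule young_symmetrizer_quasi_idempotent) (blast intro: central_idempotent_eq)

lemma central_idempotent_in [simp]: "central_idempotent m \<mu> \<in> group_algebra m"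
  using central_idempotent_conj_sum by force

lemma central_idempotent_central:
  assumes "x \<in> group_algebra m"
  shows "gmult m x (central_idempotent m \<mu>) = gmult m (central_idempotent m \<mu>) x"
  using central_idempotent_conj_sum conj_sum_central[OF assms]
  by (auto simp: gmult_scale_left gmult_scale_right)

text \<open>The star exchanges row sum and column sum, and a sum of conjugates does not see the
  order of two factors. This is the source of the symmetry of the matrices of these
  idempotents.\<close>

lemma gstar_central_idempotent: "gstar m (central_idempotent m \<mu>) = central_idempotent m \<mu>"
proof -
  have "gstar m (conj_sum m YS) = conj_sum m (gmult m (col_sum m \<mu>) (row_sum m \<mu>))"
    by (simp add: gstar_conj_sum young_symmetrizer_eq gstar_gmult gstar_row_sum[OF sum_list_partition] gstar_col_sum[OF sum_list_partition])
  also have "\<dots> = conj_sum m YS"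
    unfolding young_symmetrizer_eq by (rule conj_sum_commute) (simp add: row_sum_in[OF sum_list_partition])
  finally show ?thesis using central_idempotent_conj_sum by (auto simp: gstar_scale)
qed

text \<open>Centrality lets the idempotent reach the Young symmetrizer inside each conjugate, where
  it acts as 1.\<close>

lemma central_idempotent_idem:
  "gmult m (central_idempotent m \<mu>) (central_idempotent m \<mu>) = central_idempotent m \<mu>"
proof -
  let ?P = "central_idempotent m \<mu>"
  obtain k where k: "?P = k *\<^sub>C conj_sum m YS" using central_idempotent_conj_sum by blast
  have "gmult m ?P (conj_sum m YS) = (\<Sum>g\<in>symgrp m. gmult m ?P (gmult m (gelem g) (gmult m YS (gelem (inv g)))))"
    by (simp add: conj_sum_def gmult_sum_right)
  also have "\<dots> = (\<Sum>g\<in>symgrp m. gmult m (gelem g) (gmult m (gmult m ?P YS) (gelem (inv g))))"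
    by (intro sum.cong refl) (simp add: gmult_assoc[symmetric] central_idempotent_central)
  also have "\<dots> = conj_sum m YS"
    by (simp add: central_idempotent_times_young conj_sum_def)
  finally have "gmult m ?P (k *\<^sub>C conj_sum m YS) = k *\<^sub>C conj_sum m YS"
    by (simp add: gmult_scale_right)
  then show ?thesis unfolding k[symmetric] .
qed

end

lemma central_idempotent_orthogonal:
  assumes \<mu>: "\<mu> \<in> partitions m" and \<nu>: "\<nu> \<in> partitions m" and neq: "\<mu> \<noteq> \<nu>"
  shows "gmult m (central_idempotent m \<mu>) (central_idempotent m \<nu>) = 0"
proof -
  obtain k where k: "central_idempotent m \<mu> = k *\<^sub>C conj_sum m (young_symmetrizer m \<mu>)"
    using central_idempotent_conj_sum[OF \<mu>] by blast
  obtain l where l: "central_idempotent m \<nu> = l *\<^sub>C conj_sum m (young_symmetrizer m \<nu>)"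
    using central_idempotent_conj_sum[OF \<nu>] by blast
  have "gmult m (gmult m (gelem g) (gmult m (young_symmetrizer m \<mu>) (gelem (inv g))))
      (gmult m (gelem h) (gmult m (young_symmetrizer m \<nu>) (gelem (inv h)))) = 0"
    if "g \<in> symgrp m" "h \<in> symgrp m" for g h
  proof -
    \<comment> \<open>Between the two Young symmetrizers stands the product of \<open>inv g\<close>
      and \<open>h\<close>, so the vanishing for different shapes applies.\<close>
    have "gmult m (young_symmetrizer m \<mu>) (gmult m (gmult m (gelem (inv g)) (gelem h)) (young_symmetrizer m \<nu>)) = 0"
      by (rule young_x_young_neq[OF \<mu> \<nu> neq]) simp
    from arg_cong[OF this, of "\<lambda>z. gmult m (gelem g) (gmult m z (gelem (inv h)))"]
    show ?thesis by (simp add: gmult_assoc)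
  qed
  then have "gmult m (conj_sum m (young_symmetrizer m \<mu>)) (conj_sum m (young_symmetrizer m \<nu>)) = 0"
    unfolding conj_sum_def gmult_sum_left gmult_sum_right by (intro sum.neutral ballI)
  then show ?thesis by (simp add: k l gmult_scale_left gmult_scale_right)
qed

section \<open>Pairs of pairings\<close>

lemma pairings_symgrp: "\<pi> \<in> pairings n \<Longrightarrow> \<pi> \<in> symgrp (2 * n)"
  by (simp add: pairings_def)

lemma pairings_invol [simp]: "\<pi> \<in> pairings n \<Longrightarrow> \<pi> (\<pi> x) = x"
  by (auto simp: pairings_def fun_eq_iff)

lemma pairings_neq: "\<pi> \<in> pairings n \<Longrightarrow> x \<in> {1..2 * n} \<Longrightarrow> \<pi> x \<noteq> x"
  by (auto simp: pairings_def)

lemma pairings_mem: "\<pi> \<in> pairings n \<Longrightarrow> \<pi> x \<in> {1..2 * n} \<longleftrightarrow> x \<in> {1..2 * n}"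
  by (rule symgrp_mem_iff[OF pairings_symgrp])

lemma pairings_inj: "\<pi> \<in> pairings n \<Longrightarrow> \<pi> x = \<pi> y \<longleftrightarrow> x = y"
  by (metis pairings_invol)

lemma orbit_eq_iff:
  assumes "permutation f"
  shows "y \<in> orbit f x \<longleftrightarrow> orbit f y = orbit f x"
  using assms by (metis orbit_swap orbit_trans permutation_self_in_orbit subsetI subset_antisym)

text \<open>Allows powers to be transferred between orbits of equal size: there they coincide for
  the same pairs of exponents.\<close>

lemma funpow_eq_iff_mod:
  assumes f: "permutation f"
  shows "(f ^^ i) x = (f ^^ j) x \<longleftrightarrow> i mod card (orbit f x) = j mod card (orbit f x)"
proof -
  let ?l = "least_power f x"
  have mod_l: "(f ^^ (i mod ?l)) x = (f ^^ i) x" for i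
    using least_power_of_permutation[OF f] by (intro funpow_mod_eq)
  have inj: "inj_on (\<lambda>i. (f ^^ i) x) {..<?l}"
    using cycle_of_permutation[OF f, of x] by (simp add: distinct_map atLeast_upt)
  have "orbit f x = (\<lambda>i. (f ^^ i) x) ` {..<?l}"
    using orbit_altdef_bounded[OF least_power_of_permutation[OF f]] by auto
  then have l: "card (orbit f x) = ?l" using inj by (simp add: card_image)
  show ?thesis unfolding l
  proof
    assume "(f ^^ i) x = (f ^^ j) x"
    then have "(f ^^ (i mod ?l)) x = (f ^^ (j mod ?l)) x" by (simp add: mod_l)
    then show "i mod ?l = j mod ?l"
      using least_power_of_permutation(2)[OF f, of x] by (intro inj_onD[OF inj]) auto
  next
    assume "i mod ?l = j mod ?l"
    then show "(f ^^ i) x = (f ^^ j) x" using mod_l[of i] mod_l[of j] by simp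
  qed
qed

section \<open>Components of the union of two pairings\<close>

text \<open>The vertex set of the cycle through \<open>x\<close> in the graph whose edges are the
  pairs of both pairings. Every second vertex lies in the orbit of \<open>x\<close>, and the
  remaining ones form its \<open>\<beta>\<close>-image.\<close>

definition component :: "(nat \<Rightarrow> nat) \<Rightarrow> (nat \<Rightarrow> nat) \<Rightarrow> nat \<Rightarrow> nat set"
  where "component \<alpha> \<beta> x = orbit (\<alpha> \<circ> \<beta>) x \<union> \<beta> ` orbit (\<alpha> \<circ> \<beta>) x"

context
  fixes n :: nat and \<alpha> \<beta> :: "nat \<Rightarrow> nat"
  assumes \<alpha>: "\<alpha> \<in> pairings n" and \<beta>: "\<beta> \<in> pairings n"
begin

lemma permutation_pairings: "permutation (\<alpha> \<circ> \<beta>)"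
  using \<alpha> \<beta> by (blast intro: permutation_symgrp comp_symgrp pairings_symgrp)

lemma inv_pairings: "inv (\<alpha> \<circ> \<beta>) = \<beta> \<circ> \<alpha>"
  by (rule inv_equality) (use \<alpha> \<beta> in auto)

text \<open>\<open>\<beta>\<close> conjugates \<open>\<alpha> \<circ> \<beta>\<close> into its
  inverse, and a permutation has the same orbits as its inverse.\<close>

lemma image_orbit: "\<beta> ` orbit (\<alpha> \<circ> \<beta>) x = orbit (\<alpha> \<circ> \<beta>) (\<beta> x)"
proof -
  have pow: "\<beta> (((\<alpha> \<circ> \<beta>) ^^ k) x) = ((\<beta> \<circ> \<alpha>) ^^ k) (\<beta> x)" for k
    by (induction k) auto
  have perm: "permutation (\<beta> \<circ> \<alpha>)"
    using permutation_pairings inv_pairings permutation_inverse by metis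
  have "orbit (\<alpha> \<circ> \<beta>) (\<beta> x) = orbit (\<beta> \<circ> \<alpha>) (\<beta> x)"
    using orbit_inv_eq[OF permutation_pairings] inv_pairings by simp
  also have "\<dots> = {((\<beta> \<circ> \<alpha>) ^^ k) (\<beta> x) | k. True}" by (rule orbit_altdef_permutation[OF perm])
  also have "\<dots> = \<beta> ` {((\<alpha> \<circ> \<beta>) ^^ k) x | k. True}" by (auto simp: pow[symmetric])
  finally show ?thesis by (simp add: orbit_altdef_permutation[OF permutation_pairings])
qed

lemma component_eq: "component \<alpha> \<beta> x = orbit (\<alpha> \<circ> \<beta>) x \<union> orbit (\<alpha> \<circ> \<beta>) (\<beta> x)"
  by (simp add: component_def image_orbit)

text \<open>Otherwise the middle of the path from \<open>x\<close> to \<open>\<beta> x\<close> would be a fixed point of \<open>\<alpha>\<close> or \<open>\<beta>\<close>.\<close>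

lemma not_in_orbit:
  assumes "x \<in> {1..2 * n}"
  shows "\<beta> x \<notin> orbit (\<alpha> \<circ> \<beta>) x"
proof -
  have "((\<alpha> \<circ> \<beta>) ^^ k) x \<noteq> \<beta> x" for k
    using assms
  proof (induction k arbitrary: x rule: less_induct)
    case (less k)
    consider "k = 0" | "k = 1" | j where "k = Suc (Suc j)" by (metis One_nat_def not0_implies_Suc)
    then show ?case
    proof cases
      case 1
      then show ?thesis using pairings_neq[OF \<beta>] less.prems by fastforce
    next
      case 2
      then show ?thesis using pairings_neq[OF \<alpha>] pairings_mem[OF \<beta>] less.prems by simp
    next
      case 3
      let ?y = "(\<alpha> \<circ> \<beta>) x"
      have y: "?y \<in> {1..2 * n}" using less.prems pairings_mem[OF \<alpha>] pairings_mem[OF \<beta>] by simp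
      show ?thesis
      proof
        assume "((\<alpha> \<circ> \<beta>) ^^ k) x = \<beta> x"
        then have "(\<alpha> \<circ> \<beta>) (((\<alpha> \<circ> \<beta>) ^^ j) ?y) = \<beta> x" by (simp add: 3 funpow_swap1)
        then have "\<beta> (\<alpha> (\<alpha> (\<beta> (((\<alpha> \<circ> \<beta>) ^^ j) ?y)))) = \<beta> (\<alpha> (\<beta> x))" by simp
        then have "((\<alpha> \<circ> \<beta>) ^^ j) ?y = \<beta> ?y" using \<alpha> \<beta> by simp
        moreover have "((\<alpha> \<circ> \<beta>) ^^ j) ?y \<noteq> \<beta> ?y"
          by (rule less.IH[OF _ y]) (simp add: 3)
        ultimately show False by contradiction
      qed
    qed
  qed
  then have "\<beta> x \<noteq> ((\<alpha> \<circ> \<beta>) ^^ k) x" for k by metis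
  then show ?thesis unfolding orbit_altdef_permutation[OF permutation_pairings] by blast
qed

lemma orbit_disjoint:
  assumes "x \<in> {1..2 * n}"
  shows "orbit (\<alpha> \<circ> \<beta>) x \<inter> orbit (\<alpha> \<circ> \<beta>) (\<beta> x) = {}"
  using not_in_orbit[OF assms] orbit_eq_iff[OF permutation_pairings] by fastforce

lemma orbit_sub: "x \<in> {1..2 * n} \<Longrightarrow> orbit (\<alpha> \<circ> \<beta>) x \<subseteq> {1..2 * n}"
proof -
  assume x: "x \<in> {1..2 * n}"
  have "((\<alpha> \<circ> \<beta>) ^^ k) x \<in> {1..2 * n}" for k
    by (induction k) (use x pairings_mem[OF \<alpha>] pairings_mem[OF \<beta>] in auto)
  then show ?thesis by (auto simp: orbit_altdef_permutation[OF permutation_pairings])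
qed

lemma component_sub: "x \<in> {1..2 * n} \<Longrightarrow> component \<alpha> \<beta> x \<subseteq> {1..2 * n}"
  unfolding component_eq using orbit_sub[of x] orbit_sub[of "\<beta> x"] pairings_mem[OF \<beta>, of x] by blast

lemma finite_component: "x \<in> {1..2 * n} \<Longrightarrow> finite (component \<alpha> \<beta> x)"
  using component_sub finite_subset by blast

lemma self_in_component: "x \<in> component \<alpha> \<beta> x"
  by (simp add: component_def permutation_self_in_orbit[OF permutation_pairings])

lemma card_component:
  assumes "x \<in> {1..2 * n}"
  shows "card (component \<alpha> \<beta> x) = 2 * card (orbit (\<alpha> \<circ> \<beta>) x)"
proof -
  have "finite (orbit (\<alpha> \<circ> \<beta>) x)" using orbit_sub[OF assms] finite_subset by blast
  moreover have "card (\<beta> ` orbit (\<alpha> \<circ> \<beta>) x) = card (orbit (\<alpha> \<circ> \<beta>) x)"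
    by (rule card_image) (use pairings_inj[OF \<beta>] in \<open>auto simp: inj_on_def\<close>)
  ultimately show ?thesis
    using orbit_disjoint[OF assms] by (simp add: component_def card_Un_disjoint image_orbit[symmetric])
qed

lemma component_snd: "component \<alpha> \<beta> (\<beta> x) = component \<alpha> \<beta> x"
  using \<beta> by (auto simp: component_eq)

lemma component_fst: "component \<alpha> \<beta> (\<alpha> x) = component \<alpha> \<beta> x"
proof -
  have "orbit (\<alpha> \<circ> \<beta>) ((\<alpha> \<circ> \<beta>) (\<beta> x)) = orbit (\<alpha> \<circ> \<beta>) (\<beta> x)"
    by (rule permutation_orbit_step[OF permutation_pairings])
  moreover have "orbit (\<alpha> \<circ> \<beta>) ((\<alpha> \<circ> \<beta>) (\<beta> (\<alpha> x))) = orbit (\<alpha> \<circ> \<beta>) (\<beta> (\<alpha> x))"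
    by (rule permutation_orbit_step[OF permutation_pairings])
  ultimately show ?thesis using \<alpha> \<beta> by (auto simp: component_eq)
qed

lemma component_eq_iff: "y \<in> component \<alpha> \<beta> x \<longleftrightarrow> component \<alpha> \<beta> y = component \<alpha> \<beta> x"
proof
  assume "y \<in> component \<alpha> \<beta> x"
  then consider "y \<in> orbit (\<alpha> \<circ> \<beta>) x" | "y \<in> orbit (\<alpha> \<circ> \<beta>) (\<beta> x)" by (auto simp: component_eq)
  then show "component \<alpha> \<beta> y = component \<alpha> \<beta> x"
  proof cases
    case 1
    then have "orbit (\<alpha> \<circ> \<beta>) y = orbit (\<alpha> \<circ> \<beta>) x" by (simp add: orbit_eq_iff[OF permutation_pairings])
    then show ?thesis by (simp add: component_def)
  next
    case 2
    then have "orbit (\<alpha> \<circ> \<beta>) y = orbit (\<alpha> \<circ> \<beta>) (\<beta> x)" by (simp add: orbit_eq_iff[OF permutation_pairings])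
    then have "component \<alpha> \<beta> y = component \<alpha> \<beta> (\<beta> x)" by (simp add: component_def)
    then show ?thesis by (simp add: component_snd)
  qed
qed (use self_in_component in blast)

lemma component_subset_closed:
  assumes "x \<in> A" and "\<And>y. y \<in> A \<Longrightarrow> \<alpha> y \<in> A" "\<And>y. y \<in> A \<Longrightarrow> \<beta> y \<in> A"
  shows "component \<alpha> \<beta> x \<subseteq> A"
proof -
  have "((\<alpha> \<circ> \<beta>) ^^ k) x \<in> A" for k by (induction k) (use assms in auto)
  then show ?thesis using assms(3) by (auto simp: component_def orbit_altdef_permutation[OF permutation_pairings])
qed

text \<open>The exponents are offset on purpose: \<open>\<alpha>\<close> exchanges the two forms
  with the same \<open>k\<close>, so no separate case of exponent 0 arises.\<close>

lemma component_cases: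
  assumes "y \<in> component \<alpha> \<beta> x"
  obtains k where "y = ((\<alpha> \<circ> \<beta>) ^^ Suc k) x" | k where "y = \<beta> (((\<alpha> \<circ> \<beta>) ^^ k) x)"
  using assms orbit_altdef[of "\<alpha> \<circ> \<beta>" x]
  by (auto simp: component_def gr0_conv_Suc)

text \<open>Each component consists of exactly two orbits, those of \<open>x\<close> and of
  \<open>\<beta> x\<close>. Hence half the number of cycles, the exponent in the Gram matrix, is the
  number of components.\<close>

lemma num_cycles_eq: "num_cycles (2 * n) (\<alpha> \<circ> \<beta>) = 2 * card (component \<alpha> \<beta> ` {1..2 * n})"
proof -
  let ?X = "{1..2 * n}"
  let ?O = "orbit (\<alpha> \<circ> \<beta>)"
  have eq: "?O ` ?X = (\<Union>K\<in>component \<alpha> \<beta> ` ?X. {U \<in> ?O ` ?X. U \<subseteq> K})"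
    by (auto simp: component_def)
  have two: "card {U \<in> ?O ` ?X. U \<subseteq> K} = 2" if "K \<in> component \<alpha> \<beta> ` ?X" for K
  proof -
    obtain x where x: "x \<in> ?X" "K = component \<alpha> \<beta> x" using \<open>K \<in> component \<alpha> \<beta> ` ?X\<close> by auto
    have "{U \<in> ?O ` ?X. U \<subseteq> K} = {?O x, ?O (\<beta> x)}"
    proof
      show "{?O x, ?O (\<beta> x)} \<subseteq> {U \<in> ?O ` ?X. U \<subseteq> K}"
        using x pairings_mem[OF \<beta>, of x] by (auto simp: component_eq)
      show "{U \<in> ?O ` ?X. U \<subseteq> K} \<subseteq> {?O x, ?O (\<beta> x)}"
      proof
        fix U assume "U \<in> {U \<in> ?O ` ?X. U \<subseteq> K}"
        then obtain y where y: "U = ?O y" "?O y \<subseteq> K" by auto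
        then have "y \<in> component \<alpha> \<beta> x" using x permutation_self_in_orbit[OF permutation_pairings] by blast
        then show "U \<in> {?O x, ?O (\<beta> x)}"
          using y by (auto simp: component_eq orbit_eq_iff[OF permutation_pairings])
      qed
    qed
    moreover have "?O x \<noteq> ?O (\<beta> x)"
      using orbit_disjoint[OF x(1)] orbit_nonempty by fastforce
    ultimately show ?thesis by simp
  qed
  have "card (?O ` ?X) = card (\<Union>K\<in>component \<alpha> \<beta> ` ?X. {U \<in> ?O ` ?X. U \<subseteq> K})"
    by (rule arg_cong[OF eq])
  also have "\<dots> = (\<Sum>K\<in>component \<alpha> \<beta> ` ?X. card {U \<in> ?O ` ?X. U \<subseteq> K})"
  proof (rule card_UN_disjoint)
    show "\<forall>K\<in>component \<alpha> \<beta> ` ?X. \<forall>L\<in>component \<alpha> \<beta> ` ?X. K \<noteq> L \<longrightarrow>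
        {U \<in> ?O ` ?X. U \<subseteq> K} \<inter> {U \<in> ?O ` ?X. U \<subseteq> L} = {}"
    proof (intro ballI impI)
      fix K L assume KL: "K \<in> component \<alpha> \<beta> ` ?X" "L \<in> component \<alpha> \<beta> ` ?X" "K \<noteq> L"
      have "K \<inter> L = {}" using KL component_eq_iff by fastforce
      then show "{U \<in> ?O ` ?X. U \<subseteq> K} \<inter> {U \<in> ?O ` ?X. U \<subseteq> L} = {}"
        using orbit_nonempty by fastforce
    qed
  qed auto
  also have "\<dots> = (\<Sum>K\<in>component \<alpha> \<beta> ` ?X. 2)"
    using two by (rule sum.cong[OF refl])
  finally show ?thesis by (simp add: num_cycles_def)
qed

text \<open>A colouring that is constant along both pairings is a function on the components.
  Counting colourings instead of components makes the effect of a local change of a pairing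
  accessible by bijections.\<close>

lemma card_colourings:
  "card {f \<in> {1..2 * n} \<rightarrow>\<^sub>E {..<\<tau>}. \<forall>x\<in>{1..2 * n}. f (\<alpha> x) = f x \<and> f (\<beta> x) = f x}
    = \<tau> ^ card (component \<alpha> \<beta> ` {1..2 * n})"
proof -
  let ?X = "{1..2 * n}"
  let ?Q = "component \<alpha> \<beta> ` ?X"
  have const: "f y = f x" if f: "\<forall>x\<in>?X. f (\<alpha> x) = f x \<and> f (\<beta> x) = f x" and xy: "x \<in> ?X" "y \<in> component \<alpha> \<beta> x"
    for f :: "nat \<Rightarrow> nat" and x y
  proof -
    have "component \<alpha> \<beta> x \<subseteq> {y \<in> ?X. f y = f x}"
      by (rule component_subset_closed) (use xy f pairings_mem[OF \<alpha>] pairings_mem[OF \<beta>] in auto)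
    with xy show ?thesis by blast
  qed
  have "bij_betw (\<lambda>F. \<lambda>x\<in>?X. F (component \<alpha> \<beta> x)) (?Q \<rightarrow>\<^sub>E {..<\<tau>})
      {f \<in> ?X \<rightarrow>\<^sub>E {..<\<tau>}. \<forall>x\<in>?X. f (\<alpha> x) = f x \<and> f (\<beta> x) = f x}"
  proof (rule bij_betwI[where g = "\<lambda>f. \<lambda>K\<in>?Q. f (SOME x. x \<in> K)"])
    show "(\<lambda>F. \<lambda>x\<in>?X. F (component \<alpha> \<beta> x)) \<in> (?Q \<rightarrow>\<^sub>E {..<\<tau>}) \<rightarrow>
        {f \<in> ?X \<rightarrow>\<^sub>E {..<\<tau>}. \<forall>x\<in>?X. f (\<alpha> x) = f x \<and> f (\<beta> x) = f x}"
      using pairings_mem[OF \<alpha>] pairings_mem[OF \<beta>] by (auto simp: component_fst component_snd)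
    have some: "(SOME x. x \<in> K) \<in> K" if "K \<in> ?Q" for K
    proof -
      from that obtain x where "K = component \<alpha> \<beta> x" by auto
      then have "x \<in> K" using self_in_component by simp
      then show ?thesis by (rule someI)
    qed
    show "(\<lambda>f. \<lambda>K\<in>?Q. f (SOME x. x \<in> K)) \<in>
        {f \<in> ?X \<rightarrow>\<^sub>E {..<\<tau>}. \<forall>x\<in>?X. f (\<alpha> x) = f x \<and> f (\<beta> x) = f x} \<rightarrow> (?Q \<rightarrow>\<^sub>E {..<\<tau>})"
    proof
      fix f assume f: "f \<in> {f \<in> ?X \<rightarrow>\<^sub>E {..<\<tau>}. \<forall>x\<in>?X. f (\<alpha> x) = f x \<and> f (\<beta> x) = f x}"
      have "f (SOME x. x \<in> K) \<in> {..<\<tau>}" if "K \<in> ?Q" for K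
        using some[OF that] that component_sub f by blast
      then show "(\<lambda>K\<in>?Q. f (SOME x. x \<in> K)) \<in> ?Q \<rightarrow>\<^sub>E {..<\<tau>}" by (simp add: PiE_def)
    qed
    show "(\<lambda>K\<in>?Q. (\<lambda>x\<in>?X. F (component \<alpha> \<beta> x)) (SOME x. x \<in> K)) = F" if F: "F \<in> ?Q \<rightarrow>\<^sub>E {..<\<tau>}" for F
    proof
      fix K
      show "(\<lambda>K\<in>?Q. (\<lambda>x\<in>?X. F (component \<alpha> \<beta> x)) (SOME x. x \<in> K)) K = F K"
      proof (cases "K \<in> ?Q")
        case True
        then obtain x where x: "x \<in> ?X" "K = component \<alpha> \<beta> x" by auto
        have "component \<alpha> \<beta> (SOME x. x \<in> K) = K" using some[OF True] x component_eq_iff by simp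
        moreover have "(SOME x. x \<in> K) \<in> ?X" using some[OF True] x component_sub by blast
        ultimately show ?thesis using True by simp
      next
        case False
        then show ?thesis using PiE_arb[OF F False] by simp
      qed
    qed
    show "(\<lambda>x\<in>?X. (\<lambda>K\<in>?Q. f (SOME x. x \<in> K)) (component \<alpha> \<beta> x)) = f"
      if f: "f \<in> {f \<in> ?X \<rightarrow>\<^sub>E {..<\<tau>}. \<forall>x\<in>?X. f (\<alpha> x) = f x \<and> f (\<beta> x) = f x}" for f
    proof
      fix x
      show "(\<lambda>x\<in>?X. (\<lambda>K\<in>?Q. f (SOME x. x \<in> K)) (component \<alpha> \<beta> x)) x = f x"
      proof (cases "x \<in> ?X")
        case True
        then have "f (SOME y. y \<in> component \<alpha> \<beta> x) = f x" using f some by (intro const) auto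
        with True show ?thesis by simp
      next
        case False
        then show ?thesis using f by (auto simp: PiE_def extensional_def)
      qed
    qed
  qed
  then have "card {f \<in> ?X \<rightarrow>\<^sub>E {..<\<tau>}. \<forall>x\<in>?X. f (\<alpha> x) = f x \<and> f (\<beta> x) = f x} = card (?Q \<rightarrow>\<^sub>E {..<\<tau>})"
    by (simp add: bij_betw_same_card)
  then show ?thesis by (simp add: card_PiE)
qed

end

section \<open>Gram entries as numbers of colourings\<close>

text \<open>Functions are \<open>undefined\<close> off \<open>{1..2 * n}\<close>, so a colouring is
  determined by the colours of these points.\<close>

definition colourings :: "nat \<Rightarrow> nat \<Rightarrow> (nat \<Rightarrow> nat) \<Rightarrow> (nat \<Rightarrow> nat) \<Rightarrow> (nat \<Rightarrow> nat) set"
  where "colourings n \<tau> \<alpha> \<beta> =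
    {f \<in> {1..2 * n} \<rightarrow>\<^sub>E {..<\<tau>}. \<forall>x\<in>{1..2 * n}. f (\<alpha> x) = f x \<and> f (\<beta> x) = f x}"

lemma gram_eq_colourings:
  assumes "\<alpha> \<in> pairings n" "\<beta> \<in> pairings n" "\<tau> \<ge> 1"
  shows "gram n \<tau> \<alpha> \<beta> = of_nat (card (colourings n \<tau> \<alpha> \<beta>))"
proof -
  have "real \<tau> powr (1 / 2 * real (num_cycles (2 * n) (\<alpha> \<circ> \<beta>))) = real \<tau> ^ card (component \<alpha> \<beta> ` {1..2 * n})"
    using assms(3) by (simp add: num_cycles_eq[OF assms(1,2)] powr_realpow)
  then show ?thesis unfolding gram_def colourings_def card_colourings[OF assms(1,2)] by simp
qed

section \<open>Classification of pairs of pairings up to conjugation\<close>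

text \<open>Powers of \<open>\<alpha> \<circ> \<beta>\<close> applied to \<open>x\<close> are sent
  to the same powers in the other component, and their \<open>\<beta>\<close>-images to the
  corresponding \<open>\<beta>'\<close>-images. Equal orbit sizes make this well defined.\<close>

lemma component_isomorphism:
  assumes p: "\<alpha> \<in> pairings n" "\<beta> \<in> pairings n" and p': "\<alpha>' \<in> pairings n" "\<beta>' \<in> pairings n"
    and x: "x \<in> {1..2 * n}" "x' \<in> {1..2 * n}"
    and card: "card (component \<alpha> \<beta> x) = card (component \<alpha>' \<beta>' x')"
  obtains k where "bij_betw k (component \<alpha> \<beta> x) (component \<alpha>' \<beta>' x')"
    "\<And>y. y \<in> component \<alpha> \<beta> x \<Longrightarrow> k (\<alpha> y) = \<alpha>' (k y)" "\<And>y. y \<in> component \<alpha> \<beta> x \<Longrightarrow> k (\<beta> y) = \<beta>' (k y)"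
proof -
  let ?s = "\<alpha> \<circ> \<beta>" and ?s' = "\<alpha>' \<circ> \<beta>'"
  note perm = permutation_pairings[OF p] and perm' = permutation_pairings[OF p']
  have l: "card (orbit ?s x) = card (orbit ?s' x')"
    using card card_component[OF p x(1)] card_component[OF p' x(2)] by simp
  \<comment> \<open>Any exponent reaching \<open>y\<close> will do: two of them are congruent modulo
    the common orbit size. Off the orbit the value is arbitrary.\<close>
  define k0 where "k0 y = (?s' ^^ (SOME i. y = (?s ^^ i) x)) x'" for y
  have k0: "k0 ((?s ^^ i) x) = (?s' ^^ i) x'" for i
  proof -
    have "(?s ^^ i) x = (?s ^^ (SOME j. (?s ^^ i) x = (?s ^^ j) x)) x" by (rule someI) simp
    then show ?thesis unfolding k0_def by (simp only: funpow_eq_iff_mod[OF perm] funpow_eq_iff_mod[OF perm'] l)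
  qed
  define k where "k y = (if y \<in> orbit ?s x then k0 y else \<beta>' (k0 (\<beta> y)))" for y
  have k1: "k ((?s ^^ i) x) = (?s' ^^ i) x'" for i
  proof -
    have "(?s ^^ i) x \<in> orbit ?s x" unfolding orbit_altdef_permutation[OF perm] by blast
    then show ?thesis by (simp only: k_def k0 if_True)
  qed
  have k2: "k (\<beta> ((?s ^^ i) x)) = \<beta>' ((?s' ^^ i) x')" for i
  proof -
    have "(?s ^^ i) x \<in> orbit ?s x" unfolding orbit_altdef_permutation[OF perm] by blast
    \<comment> \<open>The two orbits inside a component are disjoint, so here the second branch of
      the definition of \<open>k\<close> applies.\<close>
    then have "\<beta> ((?s ^^ i) x) \<in> orbit ?s (\<beta> x)" unfolding image_orbit[OF p, symmetric] by blast
    then have "\<beta> ((?s ^^ i) x) \<notin> orbit ?s x" using orbit_disjoint[OF p x(1)] by blast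
    then show ?thesis by (simp only: k_def k0 if_False pairings_invol[OF p(2)])
  qed
  have pow_Suc: "(?s ^^ Suc i) z = \<alpha> (\<beta> ((?s ^^ i) z))" "(?s' ^^ Suc i) z = \<alpha>' (\<beta>' ((?s' ^^ i) z))" for i z
    by simp_all
  have kb: "k (\<beta> y) = \<beta>' (k y)" if "y \<in> component \<alpha> \<beta> x" for y
    using that
  proof (cases rule: component_cases[OF p, consumes 1, case_names 1 2])
    case (1 i)
    then show ?thesis by (simp only: k1 k2)
  next
    case (2 i)
    then show ?thesis by (simp only: k1 k2 pairings_invol[OF p(2)] pairings_invol[OF p'(2)])
  qed
  have ka: "k (\<alpha> y) = \<alpha>' (k y)" if "y \<in> component \<alpha> \<beta> x" for y
    using that
  proof (cases rule: component_cases[OF p, consumes 1, case_names 1 2])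
    case (1 i)
    then show ?thesis
      by (simp only: k1) (simp only: pow_Suc k2 pairings_invol[OF p(1)] pairings_invol[OF p'(1)])
  next
    case (2 i)
    then show ?thesis by (simp only: k2 pow_Suc[symmetric] k1)
  qed
  have image: "k ` component \<alpha> \<beta> x = component \<alpha>' \<beta>' x'"
  proof
    show "k ` component \<alpha> \<beta> x \<subseteq> component \<alpha>' \<beta>' x'"
    proof clarify
      fix y assume "y \<in> component \<alpha> \<beta> x"
      then show "k y \<in> component \<alpha>' \<beta>' x'"
      proof (cases rule: component_cases[OF p, consumes 1, case_names 1 2])
        case (1 i)
        have "(?s' ^^ Suc i) x' \<in> orbit ?s' x'" unfolding orbit_altdef_permutation[OF perm'] by blast
        then show ?thesis unfolding 1 k1 component_def by blast
      next
        case (2 i)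
        have "(?s' ^^ i) x' \<in> orbit ?s' x'" unfolding orbit_altdef_permutation[OF perm'] by blast
        then show ?thesis unfolding 2 k2 component_def by blast
      qed
    qed
    show "component \<alpha>' \<beta>' x' \<subseteq> k ` component \<alpha> \<beta> x"
    proof
      fix y assume "y \<in> component \<alpha>' \<beta>' x'"
      then show "y \<in> k ` component \<alpha> \<beta> x"
      proof (cases rule: component_cases[OF p', consumes 1, case_names 1 2])
        case (1 i)
        have "(?s ^^ Suc i) x \<in> orbit ?s x" unfolding orbit_altdef_permutation[OF perm] by blast
        then show ?thesis unfolding 1 k1[symmetric] component_def by blast
      next
        case (2 i)
        have "(?s ^^ i) x \<in> orbit ?s x" unfolding orbit_altdef_permutation[OF perm] by blast
        then show ?thesis unfolding 2 k2[symmetric] component_def by blast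
      qed
    qed
  qed
  have "inj_on k (component \<alpha> \<beta> x)"
    by (rule eq_card_imp_inj_on) (simp_all add: image card finite_component[OF p x(1)])
  with image have "bij_betw k (component \<alpha> \<beta> x) (component \<alpha>' \<beta>' x')" by (simp add: bij_betw_def)
  from this ka kb show thesis by (rule that)
qed

text \<open>A partial isomorphism is extended component by component; the equal counts guarantee a
  free component of the required size as long as points remain.\<close>

lemma simultaneous_conjugation:
  assumes p: "\<alpha> \<in> pairings n" "\<beta> \<in> pairings n" and p': "\<alpha>' \<in> pairings n" "\<beta>' \<in> pairings n"
    and count: "\<And>s. card {x \<in> {1..2 * n}. card (component \<alpha> \<beta> x) = s} = card {x \<in> {1..2 * n}. card (component \<alpha>' \<beta>' x) = s}"
  obtains g where "g \<in> symgrp (2 * n)" "g \<circ> \<alpha> = \<alpha>' \<circ> g" "g \<circ> \<beta> = \<beta>' \<circ> g"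
proof -
  let ?X = "{1..2 * n}"
  \<comment> \<open>\<open>A\<close> is a union of components, and \<open>h\<close> carries both
    pairings over to their primed versions on its image. The last clause, preservation of component
    sizes, is what the count in the extension step relies on.\<close>
  define P where "P A h \<longleftrightarrow> A \<subseteq> ?X \<and> (\<forall>x\<in>A. \<alpha> x \<in> A \<and> \<beta> x \<in> A) \<and> inj_on h A \<and> h ` A \<subseteq> ?X \<and>
    (\<forall>x\<in>A. h (\<alpha> x) = \<alpha>' (h x) \<and> h (\<beta> x) = \<beta>' (h x) \<and> card (component \<alpha>' \<beta>' (h x)) = card (component \<alpha> \<beta> x))"
    for A and h :: "nat \<Rightarrow> nat"
  have "\<exists>h. P ?X h" if "P A h" for A h
    using that
  proof (induction "card (?X - A)" arbitrary: A h rule: less_induct)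
    case less
    note P = \<open>P A h\<close>[unfolded P_def]
    show ?case
    proof (cases "A = ?X")
      case True
      with less.prems show ?thesis by blast
    next
      case False
      then obtain x where x: "x \<in> ?X" "x \<notin> A" using P by blast
      define s where "s = card (component \<alpha> \<beta> x)"
      have finA: "finite A" using P finite_subset by blast
      \<comment> \<open>The image has as many points in components of size \<open>s\<close> as
        \<open>A\<close> has, hence fewer than there are in total, because \<open>x\<close> is still
        missing.\<close>
      have "card {y \<in> h ` A. card (component \<alpha>' \<beta>' y) = s} = card (h ` {y \<in> A. card (component \<alpha> \<beta> y) = s})"
        by (rule arg_cong[where f = card]) (use P in auto)
      also have "\<dots> = card {y \<in> A. card (component \<alpha> \<beta> y) = s}"
        by (rule card_image) (use P in \<open>auto intro: inj_on_subset\<close>)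
      also have "\<dots> < card {y \<in> ?X. card (component \<alpha> \<beta> y) = s}"
      proof (rule psubset_card_mono)
        have "x \<in> {y \<in> ?X. card (component \<alpha> \<beta> y) = s}" "x \<notin> {y \<in> A. card (component \<alpha> \<beta> y) = s}"
          using x by (auto simp: s_def)
        then show "{y \<in> A. card (component \<alpha> \<beta> y) = s} \<subset> {y \<in> ?X. card (component \<alpha> \<beta> y) = s}"
          using P by blast
      qed simp
      also have "\<dots> = card {y \<in> ?X. card (component \<alpha>' \<beta>' y) = s}" by (rule count)
      finally have "\<exists>x'. x' \<in> {y \<in> ?X. card (component \<alpha>' \<beta>' y) = s} \<and> x' \<notin> {y \<in> h ` A. card (component \<alpha>' \<beta>' y) = s}"
        using card_mono[of "{y \<in> h ` A. card (component \<alpha>' \<beta>' y) = s}" "{y \<in> ?X. card (component \<alpha>' \<beta>' y) = s}"] finA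
        by (auto simp del: atLeastAtMost_iff simp: not_less[symmetric] subset_iff)
      then obtain x' where x': "x' \<in> ?X" "card (component \<alpha>' \<beta>' x') = s" "x' \<notin> h ` A" by blast
      obtain k where k: "bij_betw k (component \<alpha> \<beta> x) (component \<alpha>' \<beta>' x')"
        "\<And>y. y \<in> component \<alpha> \<beta> x \<Longrightarrow> k (\<alpha> y) = \<alpha>' (k y)" "\<And>y. y \<in> component \<alpha> \<beta> x \<Longrightarrow> k (\<beta> y) = \<beta>' (k y)"
        using component_isomorphism[OF p p' x(1) x'(1)] x'(2) s_def by metis
      let ?B = "A \<union> component \<alpha> \<beta> x"
      define h' where "h' y = (if y \<in> A then h y else k y)" for y
      have disj: "y \<notin> A" if "y \<in> component \<alpha> \<beta> x" for y
      proof
        assume "y \<in> A"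
        then have "component \<alpha> \<beta> y \<subseteq> A" using P by (intro component_subset_closed[OF p]) auto
        moreover have "x \<in> component \<alpha> \<beta> y" using that component_eq_iff[OF p] by simp
        ultimately show False using x by blast
      qed
      \<comment> \<open>The image is closed under both target pairings, so it cannot meet the
        component of \<open>x'\<close> without containing \<open>x'\<close>.\<close>
      have disj': "y \<notin> h ` A" if "y \<in> component \<alpha>' \<beta>' x'" for y
      proof
        assume "y \<in> h ` A"
        have "z' \<in> h ` A \<Longrightarrow> \<alpha>' z' \<in> h ` A \<and> \<beta>' z' \<in> h ` A" for z'
        proof -
          assume "z' \<in> h ` A"
          then obtain z where z: "z \<in> A" "z' = h z" by blast
          then have "\<alpha>' z' = h (\<alpha> z)" "\<beta>' z' = h (\<beta> z)" "\<alpha> z \<in> A" "\<beta> z \<in> A" using P by auto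
          then show ?thesis by blast
        qed
        then have "component \<alpha>' \<beta>' y \<subseteq> h ` A" using \<open>y \<in> h ` A\<close> by (intro component_subset_closed[OF p']) auto
        moreover have "x' \<in> component \<alpha>' \<beta>' y" using that component_eq_iff[OF p'] by simp
        ultimately show False using x' by blast
      qed
      have h'A: "h' y = h y" if "y \<in> A" for y using that by (simp add: h'_def)
      have h'k: "h' y = k y" if "y \<in> component \<alpha> \<beta> x" for y using disj[OF that] by (simp add: h'_def)
      have kin: "k y \<in> component \<alpha>' \<beta>' x'" if "y \<in> component \<alpha> \<beta> x" for y
        using k(1) that by (auto simp: bij_betw_def)
      have closed: "\<alpha> y \<in> component \<alpha> \<beta> x" "\<beta> y \<in> component \<alpha> \<beta> x" if "y \<in> component \<alpha> \<beta> x" for y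
        using that component_eq_iff[OF p] component_fst[OF p] component_snd[OF p] by auto
      have imA: "h' ` A = h ` A" by (rule image_cong[OF refl h'A])
      have imk: "h' ` component \<alpha> \<beta> x = component \<alpha>' \<beta>' x'"
        using k(1) by (subst image_cong[OF refl h'k]) (auto simp: bij_betw_def)
      have "P ?B h'"
        unfolding P_def
      proof (intro conjI ballI)
        show "?B \<subseteq> ?X" using P component_sub[OF p x(1)] by blast
        show "\<alpha> y \<in> ?B" "\<beta> y \<in> ?B" if "y \<in> ?B" for y using that P closed by blast+
        show "h' ` ?B \<subseteq> ?X"
          unfolding image_Un imA imk using P component_sub[OF p' x'(1)] by blast
        have "inj_on h' A" using P inj_on_cong[of A h' h, OF h'A] by blast
        moreover have "inj_on h' (component \<alpha> \<beta> x)"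
          using k(1) inj_on_cong[of "component \<alpha> \<beta> x" h' k, OF h'k] by (simp add: bij_betw_def)
        moreover have "h' ` A \<inter> h' ` component \<alpha> \<beta> x = {}"
          unfolding imA imk using disj' by blast
        ultimately show "inj_on h' ?B" by (auto simp: inj_on_Un)
        fix y assume "y \<in> ?B"
        then consider "y \<in> A" | "y \<in> component \<alpha> \<beta> x" by blast
        note cases = this
        show "h' (\<alpha> y) = \<alpha>' (h' y)" using cases by cases (use P k closed in \<open>simp_all add: h'A h'k\<close>)
        show "h' (\<beta> y) = \<beta>' (h' y)" using cases by cases (use P k closed in \<open>simp_all add: h'A h'k\<close>)
        show "card (component \<alpha>' \<beta>' (h' y)) = card (component \<alpha> \<beta> y)"
          using cases
        proof cases
          case 2
          then have "component \<alpha> \<beta> y = component \<alpha> \<beta> x" "component \<alpha>' \<beta>' (k y) = component \<alpha>' \<beta>' x'"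
            using component_eq_iff[OF p] component_eq_iff[OF p'] kin by blast+
          with 2 x' show ?thesis by (simp add: h'k s_def)
        qed (use P h'A in simp)
      qed
      moreover have "card (?X - ?B) < card (?X - A)"
      proof (rule psubset_card_mono)
        have "x \<in> ?B" using self_in_component[OF p] by blast
        then show "?X - ?B \<subset> ?X - A" using x by blast
      qed simp
      ultimately show ?thesis using less.hyps by blast
    qed
  qed
  moreover have "P {} id" by (simp add: P_def)
  ultimately obtain h where h: "P ?X h" by blast
  define g where "g x = (if x \<in> ?X then h x else x)" for x
  have gh: "g x = h x" if "x \<in> ?X" for x using that by (simp add: g_def)
  have hX: "inj_on h ?X" "h ` ?X \<subseteq> ?X" "\<forall>x\<in>?X. h (\<alpha> x) = \<alpha>' (h x)" "\<forall>x\<in>?X. h (\<beta> x) = \<beta>' (h x)"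
    using h unfolding P_def by blast+
  have "inj_on g ?X" using hX(1) inj_on_cong[of ?X g h, OF gh] by simp
  moreover have "g ` ?X \<subseteq> ?X" using hX(2) image_cong[of ?X ?X g h, OF refl gh] by simp
  ultimately have "bij_betw g ?X ?X" by (simp add: bij_betw_def endo_inj_surj)
  then have g: "g \<in> symgrp (2 * n)"
    unfolding symgrp_def by (auto intro!: bij_imp_permutes simp: g_def)
  have out: "\<pi> x = x" if "\<pi> \<in> pairings n" "x \<notin> ?X" for \<pi> x
    using that by (auto simp: pairings_def symgrp_def permutes_def)
  have eq: "g (\<pi> x) = \<pi>' (g x)"
    if "\<pi> \<in> pairings n" "\<pi>' \<in> pairings n" "\<And>x. x \<in> ?X \<Longrightarrow> h (\<pi> x) = \<pi>' (h x)" for \<pi> \<pi>' x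
  proof (cases "x \<in> ?X")
    case True
    then have "\<pi> x \<in> ?X" using pairings_mem[OF that(1)] by blast
    then show ?thesis using that(3)[OF True] gh[OF True] gh[of "\<pi> x"] by simp
  next
    case False
    then have "g x = x" by (simp only: g_def if_False)
    then show ?thesis using out[OF that(1) False] out[OF that(2) False] by simp
  qed
  show thesis
  proof (rule that[OF g])
    show "g \<circ> \<alpha> = \<alpha>' \<circ> g" using eq[OF p(1) p'(1)] hX(3) by (intro ext) simp
    show "g \<circ> \<beta> = \<beta>' \<circ> g" using eq[OF p(2) p'(2)] hX(4) by (intro ext) simp
  qed
qed

text \<open>Half the component sizes in decreasing order. Relative to a fixed base pairing this is
  the coset type, which indexes the double cosets of the hyperoctahedral group.\<close>

definition coset_type :: "nat \<Rightarrow> (nat \<Rightarrow> nat) \<Rightarrow> (nat \<Rightarrow> nat) \<Rightarrow> nat list"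
  where "coset_type n \<alpha> \<beta> =
    rev (sorted_list_of_multiset (image_mset (\<lambda>K. card K div 2) (mset_set (component \<alpha> \<beta> ` {1..2 * n}))))"

lemma coset_type_partition:
  assumes p: "\<alpha> \<in> pairings n" "\<beta> \<in> pairings n"
  shows "coset_type n \<alpha> \<beta> \<in> partitions n"
proof -
  let ?X = "{1..2 * n}"
  let ?Q = "component \<alpha> \<beta> ` ?X"
  have even: "2 * (card K div 2) = card K" and pos: "card K > 0" if "K \<in> ?Q" for K
    using that card_component[OF p] finite_component[OF p] self_in_component[OF p] by (auto simp: card_gt_0_iff)
  have mset: "mset (coset_type n \<alpha> \<beta>) = image_mset (\<lambda>K. card K div 2) (mset_set ?Q)"
    by (simp add: coset_type_def)
  have "0 \<notin># mset (coset_type n \<alpha> \<beta>)"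
    unfolding mset using even pos by fastforce
  moreover have "sum_list (coset_type n \<alpha> \<beta>) = n"
  proof -
    have "2 * sum_list (coset_type n \<alpha> \<beta>) = 2 * sum_mset (mset (coset_type n \<alpha> \<beta>))" by (simp add: sum_mset_sum_list)
    also have "\<dots> = (\<Sum>K\<in>?Q. 2 * (card K div 2))"
      unfolding mset by (simp add: sum_unfold_sum_mset sum_mset_distrib_left)
    also have "\<dots> = (\<Sum>K\<in>?Q. card K)" using even by (intro sum.cong) auto
    also have "\<dots> = card (\<Union>K\<in>?Q. K)"
    proof (rule card_UN_disjoint[symmetric])
      show "\<forall>K\<in>?Q. finite K" using finite_component[OF p] by blast
      show "\<forall>K\<in>?Q. \<forall>L\<in>?Q. K \<noteq> L \<longrightarrow> K \<inter> L = {}" using component_eq_iff[OF p] by fastforce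
    qed simp
    also have "(\<Union>K\<in>?Q. K) = ?X" using component_sub[OF p] self_in_component[OF p] by blast
    finally show ?thesis by simp
  qed
  moreover have "sorted_wrt (\<ge>) (coset_type n \<alpha> \<beta>)"
    by (simp add: coset_type_def sorted_wrt_rev)
  ultimately show ?thesis by (simp add: partitions_def)
qed

text \<open>Points rather than components are counted, to match the hypothesis of
  \<open>simultaneous_conjugation\<close>. Component sizes are even, so each part
  \<open>s div 2\<close> of the coset type accounts for \<open>s\<close> points.\<close>

lemma card_component_eq_count:
  assumes p: "\<alpha> \<in> pairings n" "\<beta> \<in> pairings n"
  shows "card {x \<in> {1..2 * n}. card (component \<alpha> \<beta> x) = s} =
    (if even s then s * count_list (coset_type n \<alpha> \<beta>) (s div 2) else 0)"
proof -
  let ?X = "{1..2 * n}"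
  let ?Q = "component \<alpha> \<beta> ` ?X"
  have "card {x \<in> ?X. card (component \<alpha> \<beta> x) = s} = card (\<Union>K\<in>{K \<in> ?Q. card K = s}. K)"
  proof (rule arg_cong[where f = card], intro set_eqI iffI)
    fix x assume "x \<in> {x \<in> ?X. card (component \<alpha> \<beta> x) = s}"
    then show "x \<in> (\<Union>K\<in>{K \<in> ?Q. card K = s}. K)" using self_in_component[OF p] by blast
  next
    fix x assume "x \<in> (\<Union>K\<in>{K \<in> ?Q. card K = s}. K)"
    then obtain y where y: "y \<in> ?X" "card (component \<alpha> \<beta> y) = s" "x \<in> component \<alpha> \<beta> y" by auto
    then have "x \<in> ?X" using component_sub[OF p y(1)] by blast
    moreover have "component \<alpha> \<beta> x = component \<alpha> \<beta> y" using y(3) component_eq_iff[OF p] by simp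
    ultimately show "x \<in> {x \<in> ?X. card (component \<alpha> \<beta> x) = s}" using y(2) by simp
  qed
  also have "\<dots> = (\<Sum>K\<in>{K \<in> ?Q. card K = s}. card K)"
  proof (rule card_UN_disjoint)
    show "\<forall>K\<in>{K \<in> ?Q. card K = s}. finite K" using finite_component[OF p] by blast
    show "\<forall>K\<in>{K \<in> ?Q. card K = s}. \<forall>L\<in>{K \<in> ?Q. card K = s}. K \<noteq> L \<longrightarrow> K \<inter> L = {}"
      using component_eq_iff[OF p] by fastforce
  qed simp
  also have "\<dots> = s * card {K \<in> ?Q. card K = s}" by simp
  also have "\<dots> = (if even s then s * card {K \<in> ?Q. card K div 2 = s div 2} else 0)"
  proof (cases "even s")
    case True
    then have "{K \<in> ?Q. card K = s} = {K \<in> ?Q. card K div 2 = s div 2}"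
      using card_component[OF p] by auto
    with True show ?thesis by simp
  next
    case False
    then have "{K \<in> ?Q. card K = s} = {}"
      using card_component[OF p] by auto
    with False show ?thesis by (simp only: card.empty if_False mult_0_right)
  qed
  also have "card {K \<in> ?Q. card K div 2 = s div 2} = count_list (coset_type n \<alpha> \<beta>) (s div 2)"
  proof -
    have "count_list (coset_type n \<alpha> \<beta>) (s div 2) = count (mset (coset_type n \<alpha> \<beta>)) (s div 2)"
      by (simp add: count_mset)
    also have "\<dots> = size (filter_mset (\<lambda>K. s div 2 = card K div 2) (mset_set ?Q))"
      by (simp add: coset_type_def count_image_mset')
    finally show ?thesis by (simp add: eq_commute[of "s div 2"])
  qed
  finally show ?thesis .
qed

lemma coset_type_conjugate:
  assumes p: "\<alpha> \<in> pairings n" "\<beta> \<in> pairings n" and p': "\<alpha>' \<in> pairings n" "\<beta>' \<in> pairings n"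
    and "coset_type n \<alpha> \<beta> = coset_type n \<alpha>' \<beta>'"
  obtains g where "g \<in> symgrp (2 * n)" "\<alpha>' = g \<circ> \<alpha> \<circ> inv g" "\<beta>' = g \<circ> \<beta> \<circ> inv g"
proof -
  have "card {x \<in> {1..2 * n}. card (component \<alpha> \<beta> x) = s} = card {x \<in> {1..2 * n}. card (component \<alpha>' \<beta>' x) = s}" for s
    by (simp only: card_component_eq_count[OF p] card_component_eq_count[OF p'] assms(5))
  then obtain g where g: "g \<in> symgrp (2 * n)" "g \<circ> \<alpha> = \<alpha>' \<circ> g" "g \<circ> \<beta> = \<beta>' \<circ> g"
    by (rule simultaneous_conjugation[OF p p'])
  have "\<alpha>' = g \<circ> \<alpha> \<circ> inv g" "\<beta>' = g \<circ> \<beta> \<circ> inv g"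
    using g(1) by (simp_all add: g(2,3) comp_assoc)
  with g(1) show thesis by (rule that)
qed

text \<open>The pairs \<open>(\<pi>, \<pi>)\<close> and \<open>(\<pi>', \<pi>')\<close> have only
  components of size 2 and are therefore simultaneously conjugate.\<close>

lemma pairings_conjugate:
  assumes "\<pi> \<in> pairings n" "\<pi>' \<in> pairings n"
  obtains g where "g \<in> symgrp (2 * n)" "\<pi>' = g \<circ> \<pi> \<circ> inv g"
proof (rule simultaneous_conjugation[OF assms(1,1) assms(2,2)])
  have "card (component \<rho> \<rho> x) = 2" if "\<rho> \<in> pairings n" "x \<in> {1..2 * n}" for \<rho> x
  proof -
    have "\<rho> \<circ> \<rho> = id" using that by (auto simp: fun_eq_iff)
    then have "orbit (\<rho> \<circ> \<rho>) x = {x}" by (simp add: orbit_eq_singleton_iff)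
    with card_component[OF that(1,1,2)] show ?thesis by simp
  qed
  then show "card {x \<in> {1..2 * n}. card (component \<pi> \<pi> x) = s} = card {x \<in> {1..2 * n}. card (component \<pi>' \<pi>' x) = s}" for s
    by (intro arg_cong[where f = card] Collect_cong) (auto simp: assms simp del: atLeastAtMost_iff)
next
  fix g assume g: "g \<in> symgrp (2 * n)" "g \<circ> \<pi> = \<pi>' \<circ> g"
  then have "\<pi>' = g \<circ> \<pi> \<circ> inv g" by (simp add: comp_assoc)
  with g(1) show thesis by (rule that)
qed

section \<open>The action on pairings and its commutant\<close>

definition pconj :: "(nat \<Rightarrow> nat) \<Rightarrow> (nat \<Rightarrow> nat) \<Rightarrow> nat \<Rightarrow> nat"
  where "pconj g \<pi> = g \<circ> \<pi> \<circ> inv g"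

lemma pconj_in:
  assumes g: "g \<in> symgrp (2 * n)" and \<pi>: "\<pi> \<in> pairings n"
  shows "pconj g \<pi> \<in> pairings n"
proof -
  have "g (\<pi> (inv g x)) \<noteq> x" if "x \<in> {1..2 * n}" for x
  proof
    assume eq: "g (\<pi> (inv g x)) = x"
    then have "\<pi> (inv g x) = inv g x" using symgrp_simps(5)[OF g, of "\<pi> (inv g x)"] by simp
    moreover have "inv g x \<in> {1..2 * n}" using that symgrp_mem_iff[OF inv_symgrp[OF g]] by blast
    ultimately show False using pairings_neq[OF \<pi>] by blast
  qed
  moreover have "pconj g \<pi> \<circ> pconj g \<pi> = id"
    using \<pi> g by (auto simp: pconj_def fun_eq_iff)
  moreover have "pconj g \<pi> \<in> symgrp (2 * n)"
    using g pairings_symgrp[OF \<pi>] by (simp add: pconj_def)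
  ultimately show ?thesis by (auto simp: pairings_def pconj_def)
qed

lemma pconj_comp:
  assumes "g \<in> symgrp m" "h \<in> symgrp m"
  shows "pconj g (pconj h \<pi>) = pconj (g \<circ> h) \<pi>"
  using assms by (simp add: pconj_def inv_comp_symgrp[of _ m] comp_assoc)

lemma pconj_id [simp]: "pconj id \<pi> = \<pi>"
  by (simp add: pconj_def)

lemma pconj_inv_cancel:
  assumes "g \<in> symgrp m"
  shows "pconj (inv g) (pconj g \<pi>) = \<pi>" "pconj g (pconj (inv g) \<pi>) = \<pi>"
  using assms by (simp_all add: pconj_comp[of _ m])

lemma pconj_eq_iff:
  assumes "g \<in> symgrp m"
  shows "pconj g \<pi> = \<pi>' \<longleftrightarrow> \<pi> = pconj (inv g) \<pi>'"
  using pconj_inv_cancel[OF assms] by metis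

definition act_mat :: "nat \<Rightarrow> galg \<Rightarrow> pmat"
  where "act_mat n x \<pi>' \<pi> = (\<Sum>\<rho>\<in>symgrp (2 * n). if pconj \<rho> \<pi> = \<pi>' then x \<rho> else 0)"

lemma act_mat_scale: "act_mat n (c *\<^sub>C x) \<pi>' \<pi> = c * act_mat n x \<pi>' \<pi>"
  by (simp add: act_mat_def fscale_apply sum_distrib_left if_distrib cong: if_cong)

lemma act_mat_sum: "act_mat n (\<Sum>i\<in>I. f i) \<pi>' \<pi> = (\<Sum>i\<in>I. act_mat n (f i) \<pi>' \<pi>)"
proof -
  have "act_mat n (\<Sum>i\<in>I. f i) \<pi>' \<pi> = (\<Sum>\<rho>\<in>symgrp (2 * n). \<Sum>i\<in>I. if pconj \<rho> \<pi> = \<pi>' then f i \<rho> else 0)"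
    unfolding act_mat_def by (intro sum.cong) (auto simp: fun_sum_apply)
  also have "\<dots> = (\<Sum>i\<in>I. act_mat n (f i) \<pi>' \<pi>)"
    unfolding act_mat_def by (rule sum.swap)
  finally show ?thesis .
qed

lemma act_mat_zero [simp]: "act_mat n 0 \<pi>' \<pi> = 0"
  by (simp add: act_mat_def cong: if_cong)

text \<open>Of the intermediate pairings \<kappa> in the matrix product, each pair
  \<open>\<rho>\<close>, \<open>\<eta>\<close> uses exactly one, namely
  \<open>pconj \<eta> \<pi>\<close>.\<close>

lemma act_mat_gmult:
  assumes \<pi>: "\<pi> \<in> pairings n"
  shows "act_mat n (gmult (2 * n) x y) \<pi>' \<pi> = mmult_on (pairings n) (act_mat n x) (act_mat n y) \<pi>' \<pi>"
proof -
  let ?S = "symgrp (2 * n)"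
  have "act_mat n (gmult (2 * n) x y) \<pi>' \<pi> =
      (\<Sum>\<rho>\<in>?S. \<Sum>\<eta>\<in>?S. x \<rho> * y \<eta> * act_mat n (gelem (\<rho> \<circ> \<eta>)) \<pi>' \<pi>)"
    by (simp add: gmult_def act_mat_sum act_mat_scale)
  also have "\<dots> = (\<Sum>\<rho>\<in>?S. \<Sum>\<eta>\<in>?S. x \<rho> * y \<eta> * (if pconj (\<rho> \<circ> \<eta>) \<pi> = \<pi>' then 1 else 0))"
  proof (intro sum.cong refl)
    fix \<rho> \<eta> assume in': "\<rho> \<in> ?S" "\<eta> \<in> ?S"
    have "act_mat n (gelem (\<rho> \<circ> \<eta>)) \<pi>' \<pi> =
        (\<Sum>\<sigma>\<in>?S. if \<sigma> = \<rho> \<circ> \<eta> then (if pconj (\<rho> \<circ> \<eta>) \<pi> = \<pi>' then 1 else 0) else 0)"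
      unfolding act_mat_def by (intro sum.cong) (auto simp: gelem_apply)
    also have "\<dots> = (if pconj (\<rho> \<circ> \<eta>) \<pi> = \<pi>' then 1 else 0)"
      using in' by (simp add: finite_symgrp)
    finally show "x \<rho> * y \<eta> * act_mat n (gelem (\<rho> \<circ> \<eta>)) \<pi>' \<pi> =
        x \<rho> * y \<eta> * (if pconj (\<rho> \<circ> \<eta>) \<pi> = \<pi>' then 1 else 0)" by simp
  qed
  also have "\<dots> = (\<Sum>\<rho>\<in>?S. \<Sum>\<eta>\<in>?S. \<Sum>\<kappa>\<in>pairings n.
      (if pconj \<rho> \<kappa> = \<pi>' then x \<rho> else 0) * (if pconj \<eta> \<pi> = \<kappa> then y \<eta> else 0))"
  proof (intro sum.cong refl)
    fix \<rho> \<eta> assume in': "\<rho> \<in> ?S" "\<eta> \<in> ?S"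
    have "(\<Sum>\<kappa>\<in>pairings n. (if pconj \<rho> \<kappa> = \<pi>' then x \<rho> else 0) * (if pconj \<eta> \<pi> = \<kappa> then y \<eta> else 0))
      = (\<Sum>\<kappa>\<in>pairings n. if \<kappa> = pconj \<eta> \<pi> then (if pconj \<rho> (pconj \<eta> \<pi>) = \<pi>' then x \<rho> else 0) * y \<eta> else 0)"
      by (intro sum.cong) auto
    also have "\<dots> = (if pconj \<rho> (pconj \<eta> \<pi>) = \<pi>' then x \<rho> else 0) * y \<eta>"
      using pconj_in[OF in'(2) \<pi>] by (simp add: finite_pairings)
    finally show "x \<rho> * y \<eta> * (if pconj (\<rho> \<circ> \<eta>) \<pi> = \<pi>' then 1 else 0) =
        (\<Sum>\<kappa>\<in>pairings n. (if pconj \<rho> \<kappa> = \<pi>' then x \<rho> else 0) * (if pconj \<eta> \<pi> = \<kappa> then y \<eta> else 0))"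
      by (simp add: pconj_comp[OF in'])
  qed
  also have "\<dots> = (\<Sum>\<rho>\<in>?S. \<Sum>\<kappa>\<in>pairings n. \<Sum>\<eta>\<in>?S.
      (if pconj \<rho> \<kappa> = \<pi>' then x \<rho> else 0) * (if pconj \<eta> \<pi> = \<kappa> then y \<eta> else 0))"
    by (rule sum.cong[OF refl], rule sum.swap)
  also have "\<dots> = (\<Sum>\<kappa>\<in>pairings n. \<Sum>\<rho>\<in>?S. \<Sum>\<eta>\<in>?S.
      (if pconj \<rho> \<kappa> = \<pi>' then x \<rho> else 0) * (if pconj \<eta> \<pi> = \<kappa> then y \<eta> else 0))"
    by (rule sum.swap)
  also have "\<dots> = mmult_on (pairings n) (act_mat n x) (act_mat n y) \<pi>' \<pi>"
    by (simp only: mmult_on_def act_mat_def sum_product)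
  finally show ?thesis .
qed

text \<open>Inverting a permutation exchanges the pairing it starts from with the one it reaches, so
  the star becomes transposition.\<close>

lemma act_mat_gstar: "act_mat n (gstar (2 * n) x) \<pi>' \<pi> = act_mat n x \<pi> \<pi>'"
proof -
  have "act_mat n (gstar (2 * n) x) \<pi>' \<pi> = (\<Sum>\<rho>\<in>symgrp (2 * n). if pconj (inv (inv \<rho>)) \<pi> = \<pi>' then x (inv \<rho>) else 0)"
    unfolding act_mat_def by (intro sum.cong) (auto simp: gstar_apply)
  also have "\<dots> = (\<Sum>\<rho>\<in>symgrp (2 * n). if pconj (inv \<rho>) \<pi> = \<pi>' then x \<rho> else 0)"
    by (rule sum_inv_symgrp)
  also have "\<dots> = act_mat n x \<pi> \<pi>'"
    unfolding act_mat_def by (intro sum.cong) (auto simp: pconj_inv_cancel[of _ "2 * n"])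
  finally show ?thesis .
qed

definition invariant_kernel :: "nat \<Rightarrow> pmat \<Rightarrow> bool"
  where "invariant_kernel n K \<longleftrightarrow>
    (\<forall>g\<in>symgrp (2 * n). \<forall>\<alpha>\<in>pairings n. \<forall>\<beta>\<in>pairings n. K (pconj g \<alpha>) (pconj g \<beta>) = K \<alpha> \<beta>)"

text \<open>A central element is a class function; conjugating the summation variable by
  \<open>g\<close> therefore moves both pairings by \<open>g\<close>.\<close>

lemma invariant_kernel_act_mat:
  assumes x: "x \<in> group_algebra (2 * n)"
    and central: "\<And>y. y \<in> group_algebra (2 * n) \<Longrightarrow> gmult (2 * n) y x = gmult (2 * n) x y"
  shows "invariant_kernel n (act_mat n x)"
  unfolding invariant_kernel_def
proof (intro ballI)
  fix g \<alpha> \<beta> assume g: "g \<in> symgrp (2 * n)"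
  let ?S = "symgrp (2 * n)"
  have cls: "x (g \<circ> \<rho> \<circ> inv g) = x \<rho>" if \<rho>: "\<rho> \<in> ?S" for \<rho>
  proof -
    have "gmult (2 * n) (gelem (inv g)) x (\<rho> \<circ> inv g) = gmult (2 * n) x (gelem (inv g)) (\<rho> \<circ> inv g)"
      using central[of "gelem (inv g)"] g by simp
    then show ?thesis using g \<rho> by (simp add: gmult_gelem_left gmult_gelem_right comp_assoc)
  qed
  have "act_mat n x (pconj g \<alpha>) (pconj g \<beta>) =
      (\<Sum>\<rho>\<in>?S. if pconj (\<rho> \<circ> inv g) (pconj g \<beta>) = pconj g \<alpha> then x (\<rho> \<circ> inv g) else 0)"
    unfolding act_mat_def by (rule sum_mult_right[symmetric]) (use g in simp)
  also have "\<dots> = (\<Sum>\<rho>\<in>?S. if pconj (g \<circ> \<rho> \<circ> inv g) (pconj g \<beta>) = pconj g \<alpha> then x (g \<circ> \<rho> \<circ> inv g) else 0)"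
    by (rule sum_mult_left[OF g, symmetric])
  also have "\<dots> = act_mat n x \<alpha> \<beta>"
    unfolding act_mat_def
  proof (intro sum.cong refl)
    fix \<rho> assume \<rho>: "\<rho> \<in> ?S"
    have "pconj (g \<circ> \<rho> \<circ> inv g) (pconj g \<beta>) = pconj g (pconj \<rho> \<beta>)"
      using g \<rho> by (simp add: pconj_comp[of _ "2 * n"] comp_assoc)
    moreover have "pconj g (pconj \<rho> \<beta>) = pconj g \<alpha> \<longleftrightarrow> pconj \<rho> \<beta> = \<alpha>"
      using pconj_inv_cancel(1)[OF g] by metis
    ultimately show "(if pconj (g \<circ> \<rho> \<circ> inv g) (pconj g \<beta>) = pconj g \<alpha> then x (g \<circ> \<rho> \<circ> inv g) else 0) =
        (if pconj \<rho> \<beta> = \<alpha> then x \<rho> else 0)"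
      by (simp add: cls[OF \<rho>])
  qed
  finally show "act_mat n x (pconj g \<alpha>) (pconj g \<beta>) = act_mat n x \<alpha> \<beta>" .
qed

lemma mmult_act_right:
  assumes \<sigma>: "\<sigma> \<in> pairings n"
  shows "mmult_on (pairings n) K (act_mat n x) \<pi> \<sigma> = (\<Sum>\<rho>\<in>symgrp (2 * n). x \<rho> * K \<pi> (pconj \<rho> \<sigma>))"
proof -
  have "mmult_on (pairings n) K (act_mat n x) \<pi> \<sigma> =
      (\<Sum>\<rho>\<in>symgrp (2 * n). \<Sum>\<kappa>\<in>pairings n. K \<pi> \<kappa> * (if pconj \<rho> \<sigma> = \<kappa> then x \<rho> else 0))"
    unfolding mmult_on_def act_mat_def sum_distrib_left by (rule sum.swap)
  also have "\<dots> = (\<Sum>\<rho>\<in>symgrp (2 * n). x \<rho> * K \<pi> (pconj \<rho> \<sigma>))"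
  proof (rule sum.cong[OF refl])
    fix \<rho> assume \<rho>: "\<rho> \<in> symgrp (2 * n)"
    have "(\<Sum>\<kappa>\<in>pairings n. K \<pi> \<kappa> * (if pconj \<rho> \<sigma> = \<kappa> then x \<rho> else 0)) =
        (\<Sum>\<kappa>\<in>pairings n. if pconj \<rho> \<sigma> = \<kappa> then x \<rho> * K \<pi> \<kappa> else 0)"
      by (intro sum.cong) auto
    then show "(\<Sum>\<kappa>\<in>pairings n. K \<pi> \<kappa> * (if pconj \<rho> \<sigma> = \<kappa> then x \<rho> else 0)) = x \<rho> * K \<pi> (pconj \<rho> \<sigma>)"
      using pconj_in[OF \<rho> \<sigma>] by (simp add: finite_pairings)
  qed
  finally show ?thesis .
qed

lemma mmult_act_left:
  assumes \<pi>: "\<pi> \<in> pairings n"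
  shows "mmult_on (pairings n) (act_mat n x) K \<pi> \<sigma> = (\<Sum>\<rho>\<in>symgrp (2 * n). x \<rho> * K (pconj (inv \<rho>) \<pi>) \<sigma>)"
proof -
  have "mmult_on (pairings n) (act_mat n x) K \<pi> \<sigma> =
      (\<Sum>\<rho>\<in>symgrp (2 * n). \<Sum>\<kappa>\<in>pairings n. (if pconj \<rho> \<kappa> = \<pi> then x \<rho> else 0) * K \<kappa> \<sigma>)"
    unfolding mmult_on_def act_mat_def sum_distrib_right by (rule sum.swap)
  also have "\<dots> = (\<Sum>\<rho>\<in>symgrp (2 * n). x \<rho> * K (pconj (inv \<rho>) \<pi>) \<sigma>)"
  proof (rule sum.cong[OF refl])
    fix \<rho> assume \<rho>: "\<rho> \<in> symgrp (2 * n)"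
    have "(\<Sum>\<kappa>\<in>pairings n. (if pconj \<rho> \<kappa> = \<pi> then x \<rho> else 0) * K \<kappa> \<sigma>) =
        (\<Sum>\<kappa>\<in>pairings n. if \<kappa> = pconj (inv \<rho>) \<pi> then x \<rho> * K \<kappa> \<sigma> else 0)"
      by (intro sum.cong) (auto simp: pconj_eq_iff[OF \<rho>])
    then show "(\<Sum>\<kappa>\<in>pairings n. (if pconj \<rho> \<kappa> = \<pi> then x \<rho> else 0) * K \<kappa> \<sigma>) = x \<rho> * K (pconj (inv \<rho>) \<pi>) \<sigma>"
      using pconj_in[OF inv_symgrp[OF \<rho>] \<pi>] by (simp add: finite_pairings)
  qed
  finally show ?thesis .
qed

text \<open>Invariance moves \<open>\<rho>\<close> from the second argument of \<open>K\<close> to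
  the first, where it appears as its inverse; this holds term by term in both matrix
  products.\<close>

lemma invariant_kernel_commute:
  assumes K: "invariant_kernel n K" and \<pi>: "\<pi> \<in> pairings n" and \<pi>': "\<pi>' \<in> pairings n"
  shows "mmult_on (pairings n) K (act_mat n x) \<pi>' \<pi> = mmult_on (pairings n) (act_mat n x) K \<pi>' \<pi>"
  unfolding mmult_act_right[OF \<pi>] mmult_act_left[OF \<pi>']
proof (rule sum.cong[OF refl])
  fix \<rho> assume \<rho>: "\<rho> \<in> symgrp (2 * n)"
  have "K (pconj \<rho> (pconj (inv \<rho>) \<pi>')) (pconj \<rho> \<pi>) = K (pconj (inv \<rho>) \<pi>') \<pi>"
    using K \<rho> \<pi> pconj_in[OF inv_symgrp[OF \<rho>] \<pi>'] by (simp add: invariant_kernel_def)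
  then show "x \<rho> * K \<pi>' (pconj \<rho> \<pi>) = x \<rho> * K (pconj (inv \<rho>) \<pi>') \<pi>"
    by (simp add: pconj_inv_cancel[OF \<rho>])
qed

lemma invariant_kernel_coset_type:
  assumes K: "invariant_kernel n K" and "\<alpha> \<in> pairings n" "\<beta> \<in> pairings n" "\<alpha>' \<in> pairings n" "\<beta>' \<in> pairings n"
    and "coset_type n \<alpha> \<beta> = coset_type n \<alpha>' \<beta>'"
  shows "K \<alpha> \<beta> = K \<alpha>' \<beta>'"
proof -
  obtain g where "g \<in> symgrp (2 * n)" "\<alpha>' = g \<circ> \<alpha> \<circ> inv g" "\<beta>' = g \<circ> \<beta> \<circ> inv g"
    using coset_type_conjugate[OF assms(2-6)] .
  with K assms show ?thesis by (simp add: invariant_kernel_def pconj_def[symmetric])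
qed

text \<open>The commutant has dimension at most the number of partitions of \<open>n\<close>, so as many nonzero
  orthogonal idempotents in it must span it.\<close>

lemma invariant_kernel_span:
  fixes F :: "nat list \<Rightarrow> galg"
  assumes F: "\<And>\<nu>. \<nu> \<in> partitions n \<Longrightarrow> invariant_kernel n (act_mat n (F \<nu>))"
    and idem: "\<And>\<nu>. \<nu> \<in> partitions n \<Longrightarrow> gmult (2 * n) (F \<nu>) (F \<nu>) = F \<nu>"
    and orth: "\<And>\<nu> \<rho>. \<nu> \<in> partitions n \<Longrightarrow> \<rho> \<in> partitions n \<Longrightarrow> \<nu> \<noteq> \<rho> \<Longrightarrow> gmult (2 * n) (F \<nu>) (F \<rho>) = 0"
    and nz: "\<And>\<nu>. \<nu> \<in> partitions n \<Longrightarrow> \<exists>\<alpha>\<in>pairings n. \<exists>\<beta>\<in>pairings n. act_mat n (F \<nu>) \<alpha> \<beta> \<noteq> 0"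
    and K: "invariant_kernel n K"
  obtains f where "\<And>\<alpha> \<beta>. \<alpha> \<in> pairings n \<Longrightarrow> \<beta> \<in> pairings n \<Longrightarrow>
    K \<alpha> \<beta> = (\<Sum>\<nu>\<in>partitions n. f \<nu> * act_mat n (F \<nu>) \<alpha> \<beta>)"
proof -
  let ?B = "pairings n"
  \<comment> \<open>Kernels become functions on pairs, with the irrelevant entries set to 0, so that
    the linear algebra of complex functions applies to them.\<close>
  define r where "r M = (\<lambda>(\<alpha>, \<beta>). if \<alpha> \<in> ?B \<and> \<beta> \<in> ?B then M \<alpha> \<beta> else 0)" for M :: pmat
  define A where "A \<nu> = r (act_mat n (F \<nu>))" for \<nu>
  define E where "E \<nu> = r (\<lambda>\<alpha> \<beta>. if coset_type n \<alpha> \<beta> = \<nu> then 1 else 0)" for \<nu>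
  have in_span: "r M \<in> fun_vs.span (E ` partitions n)" if M: "invariant_kernel n M" for M
  proof -
    \<comment> \<open>The common value of \<open>M\<close> on all pairs of type
      \<open>\<nu>\<close>. For a type that does not occur it is arbitrary, but then
      \<open>E \<nu>\<close> is 0.\<close>
    define k where "k \<nu> = (SOME c. \<exists>\<alpha>\<in>?B. \<exists>\<beta>\<in>?B. coset_type n \<alpha> \<beta> = \<nu> \<and> c = M \<alpha> \<beta>)" for \<nu>
    have k: "k (coset_type n \<alpha> \<beta>) = M \<alpha> \<beta>" if "\<alpha> \<in> ?B" "\<beta> \<in> ?B" for \<alpha> \<beta>
    proof -
      have "\<exists>\<alpha>'\<in>?B. \<exists>\<beta>'\<in>?B. coset_type n \<alpha>' \<beta>' = coset_type n \<alpha> \<beta> \<and> k (coset_type n \<alpha> \<beta>) = M \<alpha>' \<beta>'"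
        unfolding k_def by (rule someI[of _ "M \<alpha> \<beta>"]) (use that in blast)
      then show ?thesis using invariant_kernel_coset_type[OF M] that by metis
    qed
    have "r M = (\<Sum>\<nu>\<in>partitions n. k \<nu> *\<^sub>C E \<nu>)"
    proof
      fix p :: "(nat \<Rightarrow> nat) \<times> (nat \<Rightarrow> nat)"
      obtain \<alpha> \<beta> where p: "p = (\<alpha>, \<beta>)" by (cases p)
      show "r M p = (\<Sum>\<nu>\<in>partitions n. k \<nu> *\<^sub>C E \<nu>) p"
      proof (cases "\<alpha> \<in> ?B \<and> \<beta> \<in> ?B")
        case True
        have "(\<Sum>\<nu>\<in>partitions n. k \<nu> *\<^sub>C E \<nu>) p = (\<Sum>\<nu>\<in>partitions n. if coset_type n \<alpha> \<beta> = \<nu> then k \<nu> else 0)"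
          using True by (auto simp: p fun_sum_apply fscale_apply E_def r_def intro!: sum.cong)
        also have "\<dots> = M \<alpha> \<beta>"
          using True by (simp add: finite_partitions coset_type_partition k)
        finally show ?thesis using True by (simp add: p r_def)
      next
        case False
        then show ?thesis by (auto simp: p r_def fun_sum_apply fscale_apply E_def)
      qed
    qed
    then show ?thesis by (auto intro!: fun_vs.span_sum fun_vs.span_scale intro: fun_vs.span_base)
  qed
  have mult: "(\<Sum>\<nu>\<in>partitions n. u \<nu> * mmult_on ?B (act_mat n (F \<nu>)) (act_mat n (F \<rho>)) \<alpha> \<beta>) = u \<rho> * act_mat n (F \<rho>) \<alpha> \<beta>"
    if \<rho>: "\<rho> \<in> partitions n" and "\<beta> \<in> ?B" for u \<rho> \<alpha> \<beta>
  proof -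
    have "(\<Sum>\<nu>\<in>partitions n. u \<nu> * mmult_on ?B (act_mat n (F \<nu>)) (act_mat n (F \<rho>)) \<alpha> \<beta>) =
        (\<Sum>\<nu>\<in>partitions n. if \<nu> = \<rho> then u \<rho> * act_mat n (F \<rho>) \<alpha> \<beta> else 0)"
      using that by (intro sum.cong refl) (auto simp: act_mat_gmult[symmetric] idem orth)
    then show ?thesis using \<rho> by (simp add: finite_partitions)
  qed
  \<comment> \<open>Multiplying a linear relation by one of the idempotents isolates its
    coefficient, which a nonzero entry then forces to vanish.\<close>
  have zero: "u \<rho> = 0" if u: "(\<Sum>\<nu>\<in>partitions n. u \<nu> *\<^sub>C A \<nu>) = 0" and \<rho>: "\<rho> \<in> partitions n" for u \<rho>
  proof -
    have u0: "(\<Sum>\<nu>\<in>partitions n. u \<nu> * act_mat n (F \<nu>) \<alpha> \<kappa>) = 0" if "\<alpha> \<in> ?B" "\<kappa> \<in> ?B" for \<alpha> \<kappa>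
      using fun_cong[OF u, of "(\<alpha>, \<kappa>)"] that by (simp add: fun_sum_apply fscale_apply A_def r_def)
    obtain \<alpha> \<beta> where ab: "\<alpha> \<in> ?B" "\<beta> \<in> ?B" "act_mat n (F \<rho>) \<alpha> \<beta> \<noteq> 0" using nz[OF \<rho>] by blast
    have "0 = (\<Sum>\<kappa>\<in>?B. (\<Sum>\<nu>\<in>partitions n. u \<nu> * act_mat n (F \<nu>) \<alpha> \<kappa>) * act_mat n (F \<rho>) \<kappa> \<beta>)"
      using ab u0 by simp
    also have "\<dots> = (\<Sum>\<nu>\<in>partitions n. u \<nu> * mmult_on ?B (act_mat n (F \<nu>)) (act_mat n (F \<rho>)) \<alpha> \<beta>)"
      unfolding mmult_on_def sum_distrib_left sum_distrib_right mult.assoc by (rule sum.swap)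
    also have "\<dots> = u \<rho> * act_mat n (F \<rho>) \<alpha> \<beta>" by (rule mult[OF \<rho> ab(2)])
    finally show ?thesis using ab by simp
  qed
  have inj: "inj_on A (partitions n)"
  proof (rule inj_onI, rule ccontr)
    fix \<nu> \<rho> assume *: "\<nu> \<in> partitions n" "\<rho> \<in> partitions n" "A \<nu> = A \<rho>" "\<nu> \<noteq> \<rho>"
    \<comment> \<open>Two equal matrices would satisfy the relation with coefficients 1 and -1.
      Hence the matrices are as many as the partitions and the count below is exact.\<close>
    let ?u = "\<lambda>\<kappa>. if \<kappa> = \<nu> then 1 else if \<kappa> = \<rho> then - 1 else (0 :: complex)"
    have "(\<Sum>\<kappa>\<in>partitions n. ?u \<kappa> *\<^sub>C A \<kappa>) = (\<Sum>\<kappa>\<in>{\<nu>, \<rho>}. ?u \<kappa> *\<^sub>C A \<kappa>)"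
      using * by (intro sum.mono_neutral_right) (auto simp: finite_partitions)
    also have "\<dots> = 0" using * by (simp add: fun_vs.scale_minus_left)
    finally have "?u \<nu> = 0" by (rule zero) (rule *)
    then show False by simp
  qed
  have indep: "fun_vs.independent (A ` partitions n)"
  proof (subst fun_vs.dependent_finite)
    show "finite (A ` partitions n)" by (simp add: finite_partitions)
    show "\<not> (\<exists>u. (\<exists>v\<in>A ` partitions n. u v \<noteq> 0) \<and> (\<Sum>v\<in>A ` partitions n. u v *\<^sub>C v) = 0)"
      using zero[of "\<lambda>\<nu>. _ (A \<nu>)"] by (auto simp: sum.reindex[OF inj])
  qed
  \<comment> \<open>All invariant kernels lie in the span of at most
    \<open>card (partitions n)\<close> indicators; one further independent vector would exceed this
    number.\<close>
  have "r K \<in> fun_vs.span (A ` partitions n)"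
  proof (rule ccontr)
    assume notin: "r K \<notin> fun_vs.span (A ` partitions n)"
    then have "fun_vs.independent (insert (r K) (A ` partitions n))"
      by (intro fun_vs.independent_insertI indep)
    moreover have "insert (r K) (A ` partitions n) \<subseteq> fun_vs.span (E ` partitions n)"
      using in_span K F by (auto simp: A_def)
    ultimately have "card (insert (r K) (A ` partitions n)) \<le> card (E ` partitions n)"
      using fun_vs.independent_span_bound finite_partitions by blast
    also have "\<dots> \<le> card (partitions n)" by (intro card_image_le finite_partitions)
    finally have "card (insert (r K) (A ` partitions n)) \<le> card (partitions n)" .
    moreover have "r K \<notin> A ` partitions n" using notin fun_vs.span_base by blast
    ultimately show False by (simp add: finite_partitions card_image[OF inj])
  qed
  then obtain u where "r K = (\<Sum>v\<in>A ` partitions n. u v *\<^sub>C v)"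
    using fun_vs.span_finite[of "A ` partitions n"] by (auto simp: finite_partitions)
  then have rK: "r K = (\<Sum>\<nu>\<in>partitions n. u (A \<nu>) *\<^sub>C A \<nu>)" by (simp add: sum.reindex[OF inj])
  show thesis
  proof (rule that[of "\<lambda>\<nu>. u (A \<nu>)"])
    fix \<alpha> \<beta> assume "\<alpha> \<in> ?B" "\<beta> \<in> ?B"
    then show "K \<alpha> \<beta> = (\<Sum>\<nu>\<in>partitions n. u (A \<nu>) * act_mat n (F \<nu>) \<alpha> \<beta>)"
      using fun_cong[OF rK, of "(\<alpha>, \<beta>)"] by (simp add: fun_sum_apply fscale_apply A_def r_def)
  qed
qed

section \<open>Evaluation of the Gram matrix on a Young vector\<close>

lemma base_pairing_outside: "x \<notin> {1..2 * n} \<Longrightarrow> base_pairing n x = x"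
  by (induction n) (auto simp: transpose_def)

lemma base_pairing_apply:
  "x \<in> {1..2 * n} \<Longrightarrow> base_pairing n x = (if even x then x - 1 else x + 1)"
proof (induction n)
  case (Suc n)
  consider "x \<in> {1..2 * n}" | "x = 2 * n + 1" | "x = 2 * n + 2" using Suc.prems by force
  then show ?case
  proof cases
    case 1
    then show ?thesis using Suc.IH by (auto simp: transpose_def)
  qed (auto simp: transpose_def base_pairing_outside)
qed simp

section \<open>Adding a domino to a pairing\<close>

text \<open>Outside \<open>{1..2 * n}\<close> a pairing is the identity, so the composition adds the
  pair \<open>2 * n + 1\<close>, \<open>2 * n + 2\<close> and changes nothing else.\<close>

definition extend :: "nat \<Rightarrow> (nat \<Rightarrow> nat) \<Rightarrow> nat \<Rightarrow> nat"
  where "extend n \<pi> = \<pi> \<circ> transpose (2 * n + 1) (2 * n + 2)"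

lemma base_pairing_Suc: "base_pairing (Suc n) = extend n (base_pairing n)"
  by (simp add: extend_def)

lemma pairings_outside: "\<pi> \<in> pairings n \<Longrightarrow> x \<notin> {1..2 * n} \<Longrightarrow> \<pi> x = x"
  by (auto simp: pairings_def symgrp_def permutes_def)

lemma symgrp_outside: "\<pi> \<in> symgrp m \<Longrightarrow> x \<notin> {1..m} \<Longrightarrow> \<pi> x = x"
  by (auto simp: symgrp_def permutes_def)

lemma symgrp_mono: "\<sigma> \<in> symgrp m \<Longrightarrow> m \<le> m' \<Longrightarrow> \<sigma> \<in> symgrp m'"
  unfolding symgrp_def by (auto intro: permutes_subset)

lemma extend_simps:
  assumes "\<pi> \<in> pairings n"
  shows "extend n \<pi> (2 * n + 1) = 2 * n + 2" "extend n \<pi> (2 * n + 2) = 2 * n + 1"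
    "x \<in> {1..2 * n} \<Longrightarrow> extend n \<pi> x = \<pi> x" "x \<noteq> 2 * n + 1 \<Longrightarrow> x \<noteq> 2 * n + 2 \<Longrightarrow> extend n \<pi> x = \<pi> x"
  using pairings_outside[OF assms] by (auto simp: extend_def transpose_def)

lemma range_Suc_split: "x \<in> {1..2 * Suc n} \<longleftrightarrow> x \<in> {1..2 * n} \<or> x = 2 * n + 1 \<or> x = 2 * n + 2"
  by auto

lemma pairingsI:
  assumes "\<And>x. x \<notin> {1..2 * n} \<Longrightarrow> \<pi> x = x" "\<And>x. \<pi> (\<pi> x) = x"
    "\<And>x. x \<in> {1..2 * n} \<Longrightarrow> \<pi> x \<noteq> x"
  shows "\<pi> \<in> pairings n"
proof -
  have "\<pi> x \<in> {1..2 * n}" if "x \<in> {1..2 * n}" for x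
    using assms(1)[of "\<pi> x"] assms(2)[of x] assms(3)[of x] that by metis
  moreover have "inj \<pi>" by (metis assms(2) injI)
  ultimately have "\<pi> permutes {1..2 * n}" using assms(1) by (intro inj_imp_permutes) (auto simp del: atLeastAtMost_iff intro: inj_on_subset)
  with assms show ?thesis by (auto simp: pairings_def symgrp_def)
qed

lemma extend_in:
  assumes \<pi>: "\<pi> \<in> pairings n"
  shows "extend n \<pi> \<in> pairings (Suc n)"
proof (rule pairingsI)
  fix x
  show "x \<notin> {1..2 * Suc n} \<Longrightarrow> extend n \<pi> x = x"
    using extend_simps(4)[OF \<pi>, of x] pairings_outside[OF \<pi>, of x] by auto
  show "extend n \<pi> (extend n \<pi> x) = x"
  proof (cases "x \<in> {1..2 * n}")
    case True
    then have "\<pi> x \<in> {1..2 * n}" using pairings_mem[OF \<pi>] by blast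
    with True show ?thesis using extend_simps(3)[OF \<pi>] \<pi> by simp
  next
    case False
    show ?thesis
    proof (cases "x = 2 * n + 1 \<or> x = 2 * n + 2")
      case True
      then show ?thesis using extend_simps(1,2)[OF \<pi>] by metis
    next
      case F: False
      then show ?thesis using extend_simps(4)[OF \<pi>, of x] pairings_outside[OF \<pi> False] by metis
    qed
  qed
  assume "x \<in> {1..2 * Suc n}"
  then consider "x \<in> {1..2 * n}" | "x = 2 * n + 1" | "x = 2 * n + 2" using range_Suc_split by blast
  then show "extend n \<pi> x \<noteq> x"
    using extend_simps(1-3)[OF \<pi>] pairings_neq[OF \<pi>] by cases fastforce+
qed

lemma base_pairing_in: "base_pairing n \<in> pairings n"
proof (induction n)
  case 0
  show ?case by (auto intro: pairingsI)
next
  case (Suc n)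
  then show ?case unfolding base_pairing_Suc by (rule extend_in)
qed

lemma pconj_extend:
  assumes g: "g \<in> symgrp (2 * n)"
  shows "pconj g (extend n \<pi>) = extend n (pconj g \<pi>)"
proof -
  have "inv g (2 * n + 1) = 2 * n + 1" "inv g (2 * n + 2) = 2 * n + 2"
    by (rule symgrp_outside[OF inv_symgrp[OF g]]; simp)+
  moreover have "inj (inv g)" using inv_symgrp[OF g] bij_symgrp bij_is_inj by blast
  ultimately have "transpose (2 * n + 1) (2 * n + 2) \<circ> inv g = inv g \<circ> transpose (2 * n + 1) (2 * n + 2)"
    by (auto simp: fun_eq_iff transpose_def inj_def)
  then show ?thesis by (simp add: pconj_def extend_def comp_assoc)
qed

lemma colourings_pconj:
  assumes g: "g \<in> symgrp (2 * n)"
  shows "card (colourings n \<tau> (pconj g \<alpha>) (pconj g \<beta>)) = card (colourings n \<tau> \<alpha> \<beta>)"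
proof (rule bij_betw_same_card[of "\<lambda>f. f \<circ> g"], rule bij_betwI[where g = "\<lambda>f. f \<circ> inv g"])
  have mem: "g x \<in> {1..2 * n} \<longleftrightarrow> x \<in> {1..2 * n}" "inv g x \<in> {1..2 * n} \<longleftrightarrow> x \<in> {1..2 * n}" for x
    using symgrp_mem_iff[OF g] symgrp_mem_iff[OF inv_symgrp[OF g]] by blast+
  have out: "g x = x" "inv g x = x" if "x \<notin> {1..2 * n}" for x
    using symgrp_outside[OF g that] symgrp_outside[OF inv_symgrp[OF g] that] by blast+
  have *: "f \<circ> h \<in> {1..2 * n} \<rightarrow>\<^sub>E {..<\<tau>}" if f: "f \<in> {1..2 * n} \<rightarrow>\<^sub>E {..<\<tau>}"
    and h: "\<And>x. h x \<in> {1..2 * n} \<longleftrightarrow> x \<in> {1..2 * n}" "\<And>x. x \<notin> {1..2 * n} \<Longrightarrow> h x = x" for f h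
  proof (rule PiE_I)
    show "(f \<circ> h) x \<in> {..<\<tau>}" if "x \<in> {1..2 * n}" for x
      using PiE_mem[OF f, of "h x"] h(1) that by simp
    show "(f \<circ> h) x = undefined" if "x \<notin> {1..2 * n}" for x
      using PiE_arb[OF f, of x] h(2)[OF that] that by simp
  qed
  show "(\<lambda>f. f \<circ> g) \<in> colourings n \<tau> (pconj g \<alpha>) (pconj g \<beta>) \<rightarrow> colourings n \<tau> \<alpha> \<beta>"
  proof
    fix f assume f: "f \<in> colourings n \<tau> (pconj g \<alpha>) (pconj g \<beta>)"
    have "f (g (\<alpha> x)) = f (g x) \<and> f (g (\<beta> x)) = f (g x)" if "x \<in> {1..2 * n}" for x
    proof -
      have "g x \<in> {1..2 * n}" using that mem by blast
      with f have "f (pconj g \<alpha> (g x)) = f (g x) \<and> f (pconj g \<beta> (g x)) = f (g x)"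
        by (simp only: colourings_def mem_Collect_eq)
      then show ?thesis using g by (simp add: pconj_def)
    qed
    moreover have "f \<circ> g \<in> {1..2 * n} \<rightarrow>\<^sub>E {..<\<tau>}"
      by (rule *) (use f mem out in \<open>auto simp: colourings_def\<close>)
    ultimately show "f \<circ> g \<in> colourings n \<tau> \<alpha> \<beta>" by (simp add: colourings_def)
  qed
  show "(\<lambda>f. f \<circ> inv g) \<in> colourings n \<tau> \<alpha> \<beta> \<rightarrow> colourings n \<tau> (pconj g \<alpha>) (pconj g \<beta>)"
  proof
    fix f assume f: "f \<in> colourings n \<tau> \<alpha> \<beta>"
    have "f (\<alpha> (inv g x)) = f (inv g x) \<and> f (\<beta> (inv g x)) = f (inv g x)" if "x \<in> {1..2 * n}" for x
    proof -
      have "inv g x \<in> {1..2 * n}" using that mem by blast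
      with f show ?thesis by (simp only: colourings_def mem_Collect_eq)
    qed
    moreover have "f \<circ> inv g \<in> {1..2 * n} \<rightarrow>\<^sub>E {..<\<tau>}"
      by (rule *) (use f mem out in \<open>auto simp: colourings_def\<close>)
    ultimately show "f \<circ> inv g \<in> colourings n \<tau> (pconj g \<alpha>) (pconj g \<beta>)"
      using g by (simp add: colourings_def pconj_def)
  qed
qed (use g in \<open>auto simp: comp_assoc\<close>)

lemma colourings_commute: "colourings n \<tau> \<alpha> \<beta> = colourings n \<tau> \<beta> \<alpha>"
  by (auto simp: colourings_def)

lemma colourings_PiE: "f \<in> colourings n \<tau> \<alpha> \<beta> \<Longrightarrow> f \<in> {1..2 * n} \<rightarrow>\<^sub>E {..<\<tau>}"
  by (simp add: colourings_def)

lemma colourings_apply: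
  assumes "f \<in> colourings n \<tau> \<alpha> \<beta>" "x \<in> {1..2 * n}"
  shows "f (\<alpha> x) = f x" "f (\<beta> x) = f x"
  using assms by (simp_all add: colourings_def)

lemma colouringsI:
  assumes "\<And>x. x \<in> {1..2 * n} \<Longrightarrow> f x < \<tau>" "\<And>x. x \<notin> {1..2 * n} \<Longrightarrow> f x = undefined"
    "\<And>x. x \<in> {1..2 * n} \<Longrightarrow> f (\<alpha> x) = f x" "\<And>x. x \<in> {1..2 * n} \<Longrightarrow> f (\<beta> x) = f x"
  shows "f \<in> colourings n \<tau> \<alpha> \<beta>"
  using assms by (auto simp: colourings_def intro!: PiE_I)

text \<open>The new pair lies in both pairings and is a component of its own, whose colour is
  free.\<close>

lemma card_colourings_extend:
  assumes \<alpha>: "\<alpha> \<in> pairings n" and \<beta>: "\<beta> \<in> pairings n"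
  shows "card (colourings (Suc n) \<tau> (extend n \<alpha>) (extend n \<beta>)) = \<tau> * card (colourings n \<tau> \<alpha> \<beta>)"
proof -
  let ?x = "2 * n + 1" and ?x' = "2 * n + 2"
  have ne: "z \<noteq> ?x \<and> z \<noteq> ?x'" if "z \<in> {1..2 * n}" for z using that by auto
  have "bij_betw (\<lambda>(c, f). f(?x := c, ?x' := c)) ({..<\<tau>} \<times> colourings n \<tau> \<alpha> \<beta>)
      (colourings (Suc n) \<tau> (extend n \<alpha>) (extend n \<beta>))"
  proof (rule bij_betwI[where g = "\<lambda>f. (f ?x, restrict f {1..2 * n})"])
    show "(\<lambda>(c, f). f(?x := c, ?x' := c)) \<in> {..<\<tau>} \<times> colourings n \<tau> \<alpha> \<beta> \<rightarrow>
        colourings (Suc n) \<tau> (extend n \<alpha>) (extend n \<beta>)"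
    proof
      fix p assume "p \<in> {..<\<tau>} \<times> colourings n \<tau> \<alpha> \<beta>"
      then obtain c f where p: "p = (c, f)" and c: "c \<in> {..<\<tau>}" and f: "f \<in> colourings n \<tau> \<alpha> \<beta>"
        by auto
      have "f(?x := c, ?x' := c) \<in> colourings (Suc n) \<tau> (extend n \<alpha>) (extend n \<beta>)"
      proof (rule colouringsI)
        show "(f(?x := c, ?x' := c)) z < \<tau>" if "z \<in> {1..2 * Suc n}" for z
          using that[unfolded range_Suc_split] PiE_mem[OF colourings_PiE[OF f], of z] c by auto
        show "(f(?x := c, ?x' := c)) z = undefined" if "z \<notin> {1..2 * Suc n}" for z
          using that[unfolded range_Suc_split] PiE_arb[OF colourings_PiE[OF f], of z] by auto
        have *: "(f(?x := c, ?x' := c)) (extend n \<gamma> z) = (f(?x := c, ?x' := c)) z"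
          if \<gamma>: "\<gamma> \<in> pairings n" "\<And>x. x \<in> {1..2 * n} \<Longrightarrow> f (\<gamma> x) = f x" and z: "z \<in> {1..2 * Suc n}" for \<gamma> z
        proof -
          consider "z \<in> {1..2 * n}" | "z = ?x" | "z = ?x'" using z range_Suc_split by blast
          then show ?thesis
          proof cases
            case 1
            then have "\<gamma> z \<in> {1..2 * n}" using pairings_mem[OF \<gamma>(1)] by blast
            then show ?thesis using 1 ne[of z] ne[of "\<gamma> z"] extend_simps(3)[OF \<gamma>(1) 1] \<gamma>(2) by simp
          next
            case 2
            then show ?thesis by (simp only: extend_simps[OF \<gamma>(1)]) simp
          next
            case 3
            then show ?thesis by (simp only: extend_simps[OF \<gamma>(1)]) simp
          qed
        qed
        show "(f(?x := c, ?x' := c)) (extend n \<alpha> z) = (f(?x := c, ?x' := c)) z" if "z \<in> {1..2 * Suc n}" for z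
          by (rule *[OF \<alpha> colourings_apply(1)[OF f] that])
        show "(f(?x := c, ?x' := c)) (extend n \<beta> z) = (f(?x := c, ?x' := c)) z" if "z \<in> {1..2 * Suc n}" for z
          by (rule *[OF \<beta> colourings_apply(2)[OF f] that])
      qed
      then show "(case p of (c, f) \<Rightarrow> f(?x := c, ?x' := c)) \<in> colourings (Suc n) \<tau> (extend n \<alpha>) (extend n \<beta>)"
        by (simp add: p)
    qed
    show "(\<lambda>f. (f ?x, restrict f {1..2 * n})) \<in> colourings (Suc n) \<tau> (extend n \<alpha>) (extend n \<beta>) \<rightarrow>
        {..<\<tau>} \<times> colourings n \<tau> \<alpha> \<beta>"
    proof
      fix f assume f: "f \<in> colourings (Suc n) \<tau> (extend n \<alpha>) (extend n \<beta>)"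
      have *: "(restrict f {1..2 * n}) (\<gamma> z) = (restrict f {1..2 * n}) z"
        if \<gamma>: "\<gamma> \<in> pairings n" "\<And>x. x \<in> {1..2 * Suc n} \<Longrightarrow> f (extend n \<gamma> x) = f x" and z: "z \<in> {1..2 * n}" for \<gamma> z
      proof -
        have "\<gamma> z \<in> {1..2 * n}" using pairings_mem[OF \<gamma>(1)] z by blast
        moreover have "f (\<gamma> z) = f z" using \<gamma>(2)[of z] extend_simps(3)[OF \<gamma>(1) z] z by auto
        ultimately show ?thesis using z by (simp only: restrict_apply' if_True)
      qed
      have "restrict f {1..2 * n} \<in> colourings n \<tau> \<alpha> \<beta>"
      proof (rule colouringsI)
        show "(restrict f {1..2 * n}) z < \<tau>" if "z \<in> {1..2 * n}" for z
          using PiE_mem[OF colourings_PiE[OF f], of z] that by auto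
      qed (use *[OF \<alpha> colourings_apply(1)[OF f]] *[OF \<beta> colourings_apply(2)[OF f]] in auto)
      moreover have "f ?x < \<tau>" using PiE_mem[OF colourings_PiE[OF f], of ?x] by auto
      ultimately show "(f ?x, restrict f {1..2 * n}) \<in> {..<\<tau>} \<times> colourings n \<tau> \<alpha> \<beta>" by simp
    qed
    show "(\<lambda>f. (f ?x, restrict f {1..2 * n})) ((\<lambda>(c, f). f(?x := c, ?x' := c)) p) = p"
      if p: "p \<in> {..<\<tau>} \<times> colourings n \<tau> \<alpha> \<beta>" for p
    proof -
      obtain c f where cf: "p = (c, f)" "f \<in> colourings n \<tau> \<alpha> \<beta>" using p by auto
      have "restrict (f(?x := c, ?x' := c)) {1..2 * n} = f"
        using PiE_arb[OF colourings_PiE[OF cf(2)]] by (auto simp: fun_eq_iff restrict_def)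
      then show ?thesis by (simp add: cf)
    qed
    show "(\<lambda>(c, f). f(?x := c, ?x' := c)) ((\<lambda>f. (f ?x, restrict f {1..2 * n})) f) = f"
      if f: "f \<in> colourings (Suc n) \<tau> (extend n \<alpha>) (extend n \<beta>)" for f
    proof -
      have "f ?x' = f ?x" using colourings_apply(1)[OF f, of ?x] extend_simps(1)[OF \<alpha>] by simp
      moreover have "f z = undefined" if "z \<notin> {1..2 * n}" "z \<noteq> ?x" "z \<noteq> ?x'" for z
        by (rule PiE_arb[OF colourings_PiE[OF f]]) (use that range_Suc_split in blast)
      ultimately show ?thesis by (auto simp: fun_eq_iff restrict_def)
    qed
  qed
  from bij_betw_same_card[OF this] show ?thesis by (simp add: card_cartesian_product)
qed

text \<open>Conjugation pairs \<open>a\<close> with \<open>2 * n + 2\<close> and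
  \<open>\<alpha> a\<close> with \<open>2 * n + 1\<close>. Together with the last pair of the other
  pairing this subdivides the edge from \<open>a\<close> to \<open>\<alpha> a\<close>, so the new
  points inherit the colour of \<open>a\<close>.\<close>

lemma card_colourings_insert:
  assumes \<alpha>: "\<alpha> \<in> pairings n" and \<beta>: "\<beta> \<in> pairings n" and a: "a \<in> {1..2 * n}"
  shows "card (colourings (Suc n) \<tau> (pconj (transpose a (2 * n + 1)) (extend n \<alpha>)) (extend n \<beta>)) =
    card (colourings n \<tau> \<alpha> \<beta>)"
proof -
  let ?x = "2 * n + 1" and ?x' = "2 * n + 2"
  let ?\<pi> = "pconj (transpose a ?x) (extend n \<alpha>)"
  have ne: "z \<noteq> ?x \<and> z \<noteq> ?x'" if "z \<in> {1..2 * n}" for z using that by auto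
  have \<alpha>a: "\<alpha> a \<in> {1..2 * n}" "\<alpha> a \<noteq> a" using a pairings_mem[OF \<alpha>] pairings_neq[OF \<alpha>] by blast+
  have ap: "?\<pi> z = transpose a ?x (extend n \<alpha> (transpose a ?x z))" for z
    by (simp add: pconj_def)
  have p1: "?\<pi> ?x' = a"
    unfolding ap using ne[OF a] extend_simps(2)[OF \<alpha>] by (simp add: transpose_def)
  have p2: "?\<pi> ?x = \<alpha> a"
    unfolding ap using ne[OF a] ne[OF \<alpha>a(1)] \<alpha>a extend_simps(3)[OF \<alpha> a] by (simp add: transpose_def)
  have p3: "?\<pi> a = ?x'"
    unfolding ap using ne[OF a] extend_simps(1)[OF \<alpha>] by (simp add: transpose_def)
  have p4: "?\<pi> (\<alpha> a) = ?x"
    unfolding ap using ne[OF a] ne[OF \<alpha>a(1)] \<alpha>a extend_simps(3)[OF \<alpha> \<alpha>a(1)] \<alpha> by (simp add: transpose_def)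
  have p5: "?\<pi> z = \<alpha> z" if z: "z \<in> {1..2 * n}" "z \<noteq> a" "z \<noteq> \<alpha> a" for z
  proof -
    have "\<alpha> z \<in> {1..2 * n}" using z pairings_mem[OF \<alpha>] by blast
    moreover have "\<alpha> z \<noteq> a" using z(3) \<alpha> pairings_invol by metis
    ultimately show ?thesis
      unfolding ap using ne[OF z(1)] ne[of "\<alpha> z"] z extend_simps(3)[OF \<alpha> z(1)] by (simp add: transpose_def)
  qed
  have "bij_betw (\<lambda>f. f(?x := f a, ?x' := f a)) (colourings n \<tau> \<alpha> \<beta>) (colourings (Suc n) \<tau> ?\<pi> (extend n \<beta>))"
  proof (rule bij_betwI[where g = "\<lambda>f. restrict f {1..2 * n}"])
    show "(\<lambda>f. f(?x := f a, ?x' := f a)) \<in> colourings n \<tau> \<alpha> \<beta> \<rightarrow> colourings (Suc n) \<tau> ?\<pi> (extend n \<beta>)"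
    proof
      fix f assume f: "f \<in> colourings n \<tau> \<alpha> \<beta>"
      let ?f = "f(?x := f a, ?x' := f a)"
      have f_in: "?f z = f z" if "z \<in> {1..2 * n}" for z using ne[OF that] by simp
      have f_x: "?f ?x = f a" "?f ?x' = f a" by simp_all
      have f_\<alpha>a: "f (\<alpha> a) = f a" by (rule colourings_apply(1)[OF f a])
      show "?f \<in> colourings (Suc n) \<tau> ?\<pi> (extend n \<beta>)"
      proof (rule colouringsI)
        show "?f z < \<tau>" if "z \<in> {1..2 * Suc n}" for z
          using that[unfolded range_Suc_split] PiE_mem[OF colourings_PiE[OF f], of z]
            PiE_mem[OF colourings_PiE[OF f] a] by auto
        show "?f z = undefined" if "z \<notin> {1..2 * Suc n}" for z
          using that[unfolded range_Suc_split] PiE_arb[OF colourings_PiE[OF f], of z] by auto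
        show "?f (?\<pi> z) = ?f z" if z: "z \<in> {1..2 * Suc n}" for z
        proof -
          consider "z = ?x" | "z = ?x'" | "z = a" | "z = \<alpha> a" | "z \<in> {1..2 * n}" "z \<noteq> a" "z \<noteq> \<alpha> a"
            using z range_Suc_split by blast
          then show ?thesis
          proof cases
            case 5
            then have "\<alpha> z \<in> {1..2 * n}" using pairings_mem[OF \<alpha>] by blast
            then show ?thesis
              unfolding p5[OF 5] f_in[OF 5(1)] by (simp only: f_in colourings_apply(1)[OF f 5(1)])
          next
            case 1
            show ?thesis unfolding 1 p2 f_in[OF \<alpha>a(1)] f_x f_\<alpha>a ..
          next
            case 2
            show ?thesis unfolding 2 p1 f_in[OF a] f_x ..
          next
            case 3
            show ?thesis unfolding 3 p3 f_in[OF a] f_x ..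
          next
            case 4
            show ?thesis unfolding 4 p4 f_in[OF \<alpha>a(1)] f_x f_\<alpha>a ..
          qed
        qed
        show "?f (extend n \<beta> z) = ?f z" if z: "z \<in> {1..2 * Suc n}" for z
        proof -
          consider "z \<in> {1..2 * n}" | "z = ?x" | "z = ?x'" using z range_Suc_split by blast
          then show ?thesis
          proof cases
            case 1
            then have "\<beta> z \<in> {1..2 * n}" using pairings_mem[OF \<beta>] by blast
            with 1 show ?thesis by (simp only: extend_simps(3)[OF \<beta>] f_in colourings_apply(2)[OF f])
          next
            case 2
            show ?thesis unfolding 2 extend_simps(1)[OF \<beta>] f_x ..
          next
            case 3
            show ?thesis unfolding 3 extend_simps(2)[OF \<beta>] f_x ..
          qed
        qed
      qed
    qed
    have fa: "f ?x = f a" "f ?x' = f a" "f (\<alpha> a) = f a" if f: "f \<in> colourings (Suc n) \<tau> ?\<pi> (extend n \<beta>)" for f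
    proof -
      have mem: "?x \<in> {1..2 * Suc n}" "?x' \<in> {1..2 * Suc n}" by auto
      show 1: "f ?x' = f a" using colourings_apply(1)[OF f mem(2)] by (simp only: p1)
      then show 2: "f ?x = f a" using colourings_apply(2)[OF f mem(1)] by (simp only: extend_simps[OF \<beta>])
      show "f (\<alpha> a) = f a" using colourings_apply(1)[OF f mem(1)] 2 by (simp only: p2)
    qed
    show "(\<lambda>f. restrict f {1..2 * n}) \<in> colourings (Suc n) \<tau> ?\<pi> (extend n \<beta>) \<rightarrow> colourings n \<tau> \<alpha> \<beta>"
    proof
      fix f assume f: "f \<in> colourings (Suc n) \<tau> ?\<pi> (extend n \<beta>)"
      have mem: "z \<in> {1..2 * Suc n}" if "z \<in> {1..2 * n}" for z using that by auto
      have r: "(restrict f {1..2 * n}) z = f z" if "z \<in> {1..2 * n}" for z using that by simp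
      show "restrict f {1..2 * n} \<in> colourings n \<tau> \<alpha> \<beta>"
      proof (rule colouringsI)
        show "(restrict f {1..2 * n}) z < \<tau>" if "z \<in> {1..2 * n}" for z
          using PiE_mem[OF colourings_PiE[OF f] mem[OF that]] that by simp
        show "(restrict f {1..2 * n}) (\<alpha> z) = (restrict f {1..2 * n}) z" if z: "z \<in> {1..2 * n}" for z
        proof -
          have "\<alpha> z \<in> {1..2 * n}" using pairings_mem[OF \<alpha>] z by blast
          moreover have "f (\<alpha> z) = f z"
          proof (cases "z = a \<or> z = \<alpha> a")
            case True
            then show ?thesis using fa(3)[OF f] \<alpha> by auto
          next
            case False
            then show ?thesis using colourings_apply(1)[OF f mem[OF z]] p5[OF z] by simp
          qed
          ultimately show ?thesis by (simp only: r z)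
        qed
        show "(restrict f {1..2 * n}) (\<beta> z) = (restrict f {1..2 * n}) z" if z: "z \<in> {1..2 * n}" for z
        proof -
          have "\<beta> z \<in> {1..2 * n}" using pairings_mem[OF \<beta>] z by blast
          moreover have "f (\<beta> z) = f z"
            using colourings_apply(2)[OF f mem[OF z]] extend_simps(3)[OF \<beta> z] by simp
          ultimately show ?thesis by (simp only: r z)
        qed
      qed auto
    qed
    show "restrict (f(?x := f a, ?x' := f a)) {1..2 * n} = f" if f: "f \<in> colourings n \<tau> \<alpha> \<beta>" for f
      using PiE_arb[OF colourings_PiE[OF f]] by (auto simp: fun_eq_iff restrict_def)
    show "(restrict f {1..2 * n})(?x := restrict f {1..2 * n} a, ?x' := restrict f {1..2 * n} a) = f"
      if f: "f \<in> colourings (Suc n) \<tau> ?\<pi> (extend n \<beta>)" for f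
    proof -
      have "f z = undefined" if "z \<notin> {1..2 * n}" "z \<noteq> ?x" "z \<noteq> ?x'" for z
        by (rule PiE_arb[OF colourings_PiE[OF f]]) (use that range_Suc_split in blast)
      then show ?thesis using fa[OF f] a by (auto simp: fun_eq_iff restrict_def)
    qed
  qed
  from bij_betw_same_card[OF this] show ?thesis by simp
qed

section \<open>Dominoes and antisymmetry under column permutations\<close>

definition domino :: "nat \<Rightarrow> nat"
  where "domino x = (x + 1) div 2"

definition row_pairings :: "nat \<Rightarrow> (nat \<Rightarrow> nat) \<Rightarrow> (nat \<Rightarrow> nat) set"
  where "row_pairings n R = {\<pi> \<in> pairings n. \<forall>x\<in>{1..2 * n}. R (domino (\<pi> x)) = R (domino x)}"

text \<open>In the tableau of shape \<open>2\<nu>\<close> the numbers \<open>2k - 1\<close> and \<open>2k\<close> form a horizontal domino, placed where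
  \<open>k\<close> stands in the tableau of shape \<open>\<nu>\<close>. Hence odd numbers are left halves, and the second
  component of the labels below freezes the right halves, respectively the left halves.\<close>

definition odd_group :: "nat \<Rightarrow> (nat \<Rightarrow> nat) \<Rightarrow> (nat \<Rightarrow> nat) set"
  where "odd_group n C = label_group (2 * n) (\<lambda>x. (C (domino x), if even x then x else 0))"

definition even_group :: "nat \<Rightarrow> (nat \<Rightarrow> nat) \<Rightarrow> (nat \<Rightarrow> nat) set"
  where "even_group n C = label_group (2 * n) (\<lambda>x. (C (domino x), if odd x then x else 0))"

lemma domino_simps [simp]:
  "domino (2 * n + 1) = Suc n" "domino (2 * n + 2) = Suc n"
  "domino (Suc (2 * n)) = Suc n" "domino (Suc (Suc (2 * n))) = Suc n"
  by (simp_all add: domino_def)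

lemma domino_mem: "x \<in> {1..2 * n} \<Longrightarrow> domino x \<in> {1..n}"
  by (auto simp: domino_def)

text \<open>One statement for both groups, with \<open>b\<close> telling which parity is frozen. The
  filler label 0 is not in \<open>{1..2 * n}\<close>, so a movable point never carries the label of
  a frozen one.\<close>

lemma label_parityD:
  assumes "u \<in> label_group (2 * n) (\<lambda>x. (C (domino x), if even x = b then x else 0))"
  shows "u \<in> symgrp (2 * n)" "even x = b \<Longrightarrow> u x = x" "odd (u x) \<longleftrightarrow> odd x"
    "x \<in> {1..2 * n} \<Longrightarrow> C (domino (u x)) = C (domino x)"
proof -
  show u: "u \<in> symgrp (2 * n)" using assms by (rule label_group_symgrp)
  have lab: "C (domino (u x)) = C (domino x) \<and> (if even (u x) = b then u x else 0) = (if even x = b then x else 0)"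
    if "x \<in> {1..2 * n}" for x
    using assms that by (auto simp: label_group_def simp del: atLeastAtMost_iff)
  then show "x \<in> {1..2 * n} \<Longrightarrow> C (domino (u x)) = C (domino x)" by blast
  show "even x = b \<Longrightarrow> u x = x"
    using lab[of x] symgrp_outside[OF u, of x] by (cases "x \<in> {1..2 * n}") (auto split: if_splits)
  show "odd (u x) \<longleftrightarrow> odd x"
  proof (cases "x \<in> {1..2 * n}")
    case True
    then have "u x \<in> {1..2 * n}" using symgrp_mem_iff[OF u] by blast
    with True lab[OF True] show ?thesis by (auto split: if_splits)
  next
    case False
    then show ?thesis using symgrp_outside[OF u] by simp
  qed
qed

lemma odd_groupD:
  assumes "u \<in> odd_group n C"
  shows "u \<in> symgrp (2 * n)" "even x \<Longrightarrow> u x = x" "odd (u x) \<longleftrightarrow> odd x"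
    "x \<in> {1..2 * n} \<Longrightarrow> C (domino (u x)) = C (domino x)"
  using label_parityD[of u n C True] assms unfolding odd_group_def by simp_all

lemma even_groupD:
  assumes "u \<in> even_group n C"
  shows "u \<in> symgrp (2 * n)" "odd x \<Longrightarrow> u x = x" "odd (u x) \<longleftrightarrow> odd x"
    "x \<in> {1..2 * n} \<Longrightarrow> C (domino (u x)) = C (domino x)"
  using label_parityD[of u n C False] assms unfolding even_group_def by simp_all

lemma odd_groupI:
  assumes "u \<in> symgrp (2 * n)" "\<And>x. even x \<Longrightarrow> u x = x" "\<And>x. odd x \<Longrightarrow> odd (u x)"
    "\<And>x. x \<in> {1..2 * n} \<Longrightarrow> C (domino (u x)) = C (domino x)"
  shows "u \<in> odd_group n C"
  using assms by (auto simp: odd_group_def label_group_def simp del: atLeastAtMost_iff)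

lemma even_groupI:
  assumes "u \<in> symgrp (2 * n)" "\<And>x. odd x \<Longrightarrow> u x = x" "\<And>x. even x \<Longrightarrow> even (u x)"
    "\<And>x. x \<in> {1..2 * n} \<Longrightarrow> C (domino (u x)) = C (domino x)"
  shows "u \<in> even_group n C"
  using assms by (auto simp: even_group_def label_group_def simp del: atLeastAtMost_iff)

text \<open>The supports are disjoint: odd numbers on one side, even numbers on the other.\<close>

lemma odd_even_commute:
  assumes "u \<in> odd_group n C" "w \<in> even_group n C"
  shows "u \<circ> w = w \<circ> u"
proof
  fix x
  show "(u \<circ> w) x = (w \<circ> u) x"
    using odd_groupD(2,3)[OF assms(1)] even_groupD(2,3)[OF assms(2)] by (cases "even x") auto
qed

lemma base_pairing_domino:
  assumes "x \<in> {1..2 * n}"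
  shows "domino (base_pairing n x) = domino x" "odd (base_pairing n x) \<longleftrightarrow> even x"
  using assms by (auto simp: base_pairing_apply domino_def elim!: evenE oddE)

lemma sign_conj_inv:
  assumes "e \<in> symgrp m" "b \<in> symgrp m"
  shows "sign (b \<circ> inv e \<circ> b) = sign e"
  using assms by (simp add: sign_symgrp_comp[of _ m] sign_symgrp_inv[of _ m])

text \<open>\<open>q\<close> permutes left halves and right halves separately, keeping column
  labels. Its right-half part acts on the base pairing like a permutation of left halves, so a
  signed reindexing of the sum absorbs all of \<open>q\<close>.\<close>

lemma odd_group_antisym:
  fixes F :: "(nat \<Rightarrow> nat) \<Rightarrow> complex"
  assumes q: "q \<in> label_group (2 * n) (\<lambda>x. (C (domino x), even x))"
  shows "(\<Sum>r\<in>odd_group n C. of_int (sign r) * F (pconj q (pconj r (base_pairing n)))) =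
    of_int (sign q) * (\<Sum>r\<in>odd_group n C. of_int (sign r) * F (pconj r (base_pairing n)))"
proof -
  let ?b = "base_pairing n"
  have bS: "?b \<in> symgrp (2 * n)" using base_pairing_in pairings_symgrp by blast
  have b_inv [simp]: "?b (?b x) = x" for x by (rule pairings_invol[OF base_pairing_in])
  have bb: "?b \<circ> ?b = id" by (simp add: fun_eq_iff)
  have inv_b: "inv ?b = ?b" by (rule inv_equality) simp_all
  have qS: "q \<in> symgrp (2 * n)" using q by (rule label_group_symgrp)
  have qinj: "q x = q y \<longleftrightarrow> x = y" for x y using bij_symgrp[OF qS] by (auto simp: bij_def inj_def)
  have qlab: "C (domino (q x)) = C (domino x)" "even (q x) \<longleftrightarrow> even x" if "x \<in> {1..2 * n}" for x
    using q that by (auto simp: label_group_def simp del: atLeastAtMost_iff)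
  have qout: "q x = x" if "x \<notin> {1..2 * n}" for x by (rule symgrp_outside[OF qS that])
  have qpar: "even (q x) \<longleftrightarrow> even x" for x
    using qlab(2)[of x] qout[of x] by (cases "x \<in> {1..2 * n}") auto
  have qmem: "q x \<in> {1..2 * n}" if "x \<in> {1..2 * n}" for x using that symgrp_mem_iff[OF qS] by blast
  define v where "v x = (if odd x then q x else x)" for x
  define e where "e x = (if even x then q x else x)" for x
  have "v permutes {1..2 * n}"
  proof (rule inj_imp_permutes)
    show "inj_on v {1..2 * n}" using qinj qpar by (auto simp: v_def inj_on_def)
  qed (use qmem qout in \<open>auto simp: v_def simp del: atLeastAtMost_iff\<close>)
  then have vS: "v \<in> symgrp (2 * n)" by (simp add: symgrp_def)
  have "e permutes {1..2 * n}"
  proof (rule inj_imp_permutes)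
    show "inj_on e {1..2 * n}" using qinj qpar by (auto simp: e_def inj_on_def)
  qed (use qmem qout in \<open>auto simp: e_def simp del: atLeastAtMost_iff\<close>)
  then have eS: "e \<in> symgrp (2 * n)" by (simp add: symgrp_def)
  have v: "v \<in> odd_group n C"
    by (rule odd_groupI[OF vS]) (use qpar qlab in \<open>auto simp: v_def simp del: atLeastAtMost_iff\<close>)
  have e: "e \<in> even_group n C"
    by (rule even_groupI[OF eS]) (use qpar qlab in \<open>auto simp: e_def simp del: atLeastAtMost_iff\<close>)
  have qve: "q = v \<circ> e" using qpar by (auto simp: fun_eq_iff v_def e_def)
  \<comment> \<open>Conjugating \<open>inv e\<close> by the base pairing turns a permutation of
    right halves into one of left halves with the same sign and the same effect on the base
    pairing.\<close>
  define e' where "e' = ?b \<circ> inv e \<circ> ?b"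
  have ie: "inv e \<in> even_group n C" using e label_group_inv by (simp add: even_group_def)
  have e'S: "e' \<in> symgrp (2 * n)" using eS bS by (simp add: e'_def)
  have e': "e' \<in> odd_group n C"
  proof (rule odd_groupI[OF e'S])
    fix x
    have bx: "?b x \<in> {1..2 * n}" "inv e (?b x) \<in> {1..2 * n}" if "x \<in> {1..2 * n}"
      using that pairings_mem[OF base_pairing_in] symgrp_mem_iff[OF even_groupD(1)[OF ie]] by blast+
    show "e' x = x" if "even x"
    proof (cases "x \<in> {1..2 * n}")
      case True
      then have "odd (?b x)" using base_pairing_domino(2) that by blast
      then show ?thesis using even_groupD(2)[OF ie] by (simp add: e'_def)
    qed (rule symgrp_outside[OF e'S])
    show "odd (e' x)" if "odd x"
    proof (cases "x \<in> {1..2 * n}")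
      case True
      then have "even (inv e (?b x))" using base_pairing_domino(2)[OF True] that even_groupD(3)[OF ie] by blast
      then show ?thesis using base_pairing_domino(2)[OF bx(2)[OF True]] by (simp add: e'_def)
    next
      case False
      then show ?thesis using symgrp_outside[OF e'S] that by simp
    qed
    show "C (domino (e' x)) = C (domino x)" if "x \<in> {1..2 * n}"
      using base_pairing_domino(1)[OF that] base_pairing_domino(1)[OF bx(2)[OF that]]
        even_groupD(4)[OF ie bx(1)[OF that]] by (simp add: e'_def)
  qed
  have pe: "pconj e ?b = pconj e' ?b"
  proof -
    have "inv e' = ?b \<circ> e \<circ> ?b"
      by (rule inv_equality) (use eS in \<open>simp_all add: e'_def\<close>)
    then have "pconj e' ?b = e' \<circ> ?b \<circ> ?b \<circ> e \<circ> ?b" by (simp add: pconj_def comp_assoc)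
    also have "\<dots> = (e' \<circ> e) \<circ> ?b" by (simp add: fun_eq_iff)
    also have "\<dots> = (e \<circ> e') \<circ> ?b" using odd_even_commute[OF e' e] by simp
    also have "\<dots> = e \<circ> ?b \<circ> inv e" by (simp add: e'_def fun_eq_iff)
    finally show ?thesis by (simp add: pconj_def)
  qed
  \<comment> \<open>\<open>e\<close> commutes with \<open>r\<close>, reaches the base pairing and is
    replaced there by \<open>e'\<close>, while \<open>v\<close> stays on the left.\<close>
  have key: "pconj q (pconj r ?b) = pconj (v \<circ> r \<circ> e') ?b"
    and sgn: "sign (v \<circ> r \<circ> e') = sign q * sign r" if r: "r \<in> odd_group n C" for r
  proof -
    have rS: "r \<in> symgrp (2 * n)" by (rule odd_groupD(1)[OF r])
    have "pconj q (pconj r ?b) = pconj (v \<circ> (e \<circ> r)) ?b"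
      using qS rS by (simp add: pconj_comp[of _ "2 * n"] qve comp_assoc)
    also have "e \<circ> r = r \<circ> e" using odd_even_commute[OF r e] by simp
    also have "pconj (v \<circ> (r \<circ> e)) ?b = pconj (v \<circ> r) (pconj e ?b)"
      using vS rS eS by (simp add: pconj_comp[of _ "2 * n"] comp_assoc)
    also have "\<dots> = pconj (v \<circ> r \<circ> e') ?b"
      unfolding pe using vS rS e'S by (simp add: pconj_comp[of _ "2 * n"])
    finally show "pconj q (pconj r ?b) = pconj (v \<circ> r \<circ> e') ?b" .
    have "sign e' = sign e" unfolding e'_def by (rule sign_conj_inv[OF eS bS])
    then show "sign (v \<circ> r \<circ> e') = sign q * sign r"
      unfolding qve using vS rS eS e'S by (simp add: sign_symgrp_comp[of _ "2 * n"])
  qed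
  have v': "v \<in> label_group (2 * n) (\<lambda>x. (C (domino x), if even x then x else 0))"
    and e'': "e' \<in> label_group (2 * n) (\<lambda>x. (C (domino x), if even x then x else 0))"
    using v e' by (simp_all add: odd_group_def)
  have "(\<Sum>r\<in>odd_group n C. of_int (sign r) * F (pconj r ?b)) =
      (\<Sum>r\<in>odd_group n C. of_int (sign (v \<circ> r)) * F (pconj (v \<circ> r) ?b))"
    unfolding odd_group_def by (rule sum.reindex_bij_betw[OF bij_betw_label_group_left[OF v'], symmetric])
  also have "\<dots> = (\<Sum>r\<in>odd_group n C. of_int (sign (v \<circ> (r \<circ> e'))) * F (pconj (v \<circ> (r \<circ> e')) ?b))"
    unfolding odd_group_def by (rule sum.reindex_bij_betw[OF bij_betw_label_group_right[OF e''], symmetric])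
  also have "\<dots> = (\<Sum>r\<in>odd_group n C. of_int (sign q) * (of_int (sign r) * F (pconj q (pconj r ?b))))"
    by (rule sum.cong[OF refl]) (simp add: key sgn comp_assoc[symmetric] mult.assoc)
  finally have "(\<Sum>r\<in>odd_group n C. of_int (sign r) * F (pconj r ?b)) =
      of_int (sign q) * (\<Sum>r\<in>odd_group n C. of_int (sign r) * F (pconj q (pconj r ?b)))"
    by (simp add: sum_distrib_left)
  then show ?thesis by (simp add: sign_mult_self)
qed

lemma pconj_transpose_apply: "pconj (transpose a b) \<pi> z = transpose a b (\<pi> (transpose a b z))"
  by (simp add: pconj_def)

text \<open>Undoes \<open>extend\<close> on a pairing that contains the last domino as a
  pair.\<close>

lemma extend_obtain:
  assumes \<sigma>: "\<sigma> \<in> pairings (Suc n)" and eq: "\<sigma> (2 * n + 2) = 2 * n + 1"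
  shows "\<sigma> \<circ> transpose (2 * n + 1) (2 * n + 2) \<in> pairings n"
proof (rule pairingsI)
  let ?x = "2 * n + 1" and ?x' = "2 * n + 2"
  let ?p = "\<sigma> \<circ> transpose ?x ?x'"
  have eq': "\<sigma> ?x = ?x'" using pairings_invol[OF \<sigma>, of ?x'] eq by simp
  have in': "?p z = \<sigma> z" if "z \<in> {1..2 * n}" for z
    using that by (auto simp: transpose_def)
  have mem: "\<sigma> z \<in> {1..2 * n}" if z: "z \<in> {1..2 * n}" for z
  proof -
    have "\<sigma> z \<in> {1..2 * Suc n}" using pairings_mem[OF \<sigma>, of z] z by auto
    moreover have "\<sigma> z \<noteq> ?x" using pairings_inj[OF \<sigma>, of z ?x'] eq z by auto
    moreover have "\<sigma> z \<noteq> ?x'" using pairings_inj[OF \<sigma>, of z ?x] eq' z by auto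
    ultimately show ?thesis using range_Suc_split by blast
  qed
  fix z
  show out: "z \<notin> {1..2 * n} \<Longrightarrow> ?p z = z" for z
    using eq eq' pairings_outside[OF \<sigma>, of z] by (auto simp: transpose_def)
  show "?p (?p z) = z"
  proof (cases "z \<in> {1..2 * n}")
    case True
    then show ?thesis using in'[OF True] in'[OF mem[OF True]] \<sigma> by simp
  next
    case False
    show ?thesis unfolding out[OF False] ..
  qed
  show "z \<in> {1..2 * n} \<Longrightarrow> ?p z \<noteq> z"
    using in'[of z] pairings_neq[OF \<sigma>, of z] by auto
qed

text \<open>A row-preserving pairing on \<open>Suc n\<close> dominoes is determined by the partner
  \<open>a\<close> of \<open>2 * n + 2\<close> and by what remains after exchanging \<open>a\<close>
  with \<open>2 * n + 1\<close> and removing the last domino. The choice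
  \<open>a = 2 * n + 1\<close> exchanges nothing.\<close>

lemma sum_row_pairings_Suc:
  "(\<Sum>\<pi>\<in>row_pairings (Suc n) R. F \<pi>) =
    (\<Sum>a\<in>insert (2 * n + 1) {a \<in> {1..2 * n}. R (domino a) = R (Suc n)}.
      \<Sum>\<pi>\<in>row_pairings n R. F (pconj (transpose a (2 * n + 1)) (extend n \<pi>)))"
proof -
  let ?x = "2 * n + 1" and ?x' = "2 * n + 2"
  let ?A = "insert ?x {a \<in> {1..2 * n}. R (domino a) = R (Suc n)}"
  have Ain: "a \<in> {1..2 * Suc n}" "a \<noteq> ?x'" "R (domino a) = R (domino ?x)" if "a \<in> ?A" for a using that by auto
  have tS: "transpose a ?x \<in> symgrp (2 * Suc n)" if "a \<in> {1..2 * Suc n}" for a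
    by (rule transpose_symgrp) (use that in auto)
  have Rt: "R (domino (transpose a ?x z)) = R (domino z)" if "R (domino a) = R (domino ?x)" for a z
    using that by (simp only: transpose_def) (simp split: if_splits)
  have tmem: "transpose a ?x z \<in> {1..2 * Suc n} \<longleftrightarrow> z \<in> {1..2 * Suc n}" if "a \<in> {1..2 * Suc n}" for a z
    by (rule symgrp_mem_iff[OF tS[OF that]])
  have tt: "pconj (transpose a ?x) (pconj (transpose a ?x) \<rho>) = \<rho>" for a \<rho>
    by (rule ext) (simp add: pconj_transpose_apply)
  have "bij_betw (\<lambda>(a, \<pi>). pconj (transpose a ?x) (extend n \<pi>)) (?A \<times> row_pairings n R) (row_pairings (Suc n) R)"
  proof (rule bij_betwI[where g = "\<lambda>\<rho>. (\<rho> ?x', pconj (transpose (\<rho> ?x') ?x) \<rho> \<circ> transpose ?x ?x')"])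
    show "(\<lambda>(a, \<pi>). pconj (transpose a ?x) (extend n \<pi>)) \<in> ?A \<times> row_pairings n R \<rightarrow> row_pairings (Suc n) R"
    proof
      fix p assume "p \<in> ?A \<times> row_pairings n R"
      then obtain a \<pi> where p: "p = (a, \<pi>)" and a: "a \<in> ?A" and \<pi>: "\<pi> \<in> pairings n"
        and row: "\<And>z. z \<in> {1..2 * n} \<Longrightarrow> R (domino (\<pi> z)) = R (domino z)"
        by (auto simp: row_pairings_def simp del: atLeastAtMost_iff)
      have "R (domino (extend n \<pi> z)) = R (domino z)" if z: "z \<in> {1..2 * Suc n}" for z
      proof -
        consider "z \<in> {1..2 * n}" | "z = ?x" | "z = ?x'" using z range_Suc_split by blast
        then show ?thesis
        proof cases
          case 1
          then show ?thesis using row extend_simps(3)[OF \<pi> 1] by simp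
        next
          case 2
          show ?thesis unfolding 2 extend_simps(1)[OF \<pi>] by simp
        next
          case 3
          show ?thesis unfolding 3 extend_simps(2)[OF \<pi>] by simp
        qed
      qed
      then have "R (domino (pconj (transpose a ?x) (extend n \<pi>) z)) = R (domino z)" if "z \<in> {1..2 * Suc n}" for z
        unfolding pconj_transpose_apply Rt[OF Ain(3)[OF a]]
        using that tmem[OF Ain(1)[OF a]] Rt[OF Ain(3)[OF a]] by metis
      moreover have "pconj (transpose a ?x) (extend n \<pi>) \<in> pairings (Suc n)"
        by (rule pconj_in[OF tS[OF Ain(1)[OF a]] extend_in[OF \<pi>]])
      ultimately show "(case p of (a, \<pi>) \<Rightarrow> pconj (transpose a ?x) (extend n \<pi>)) \<in> row_pairings (Suc n) R"
        by (simp add: p row_pairings_def)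
    qed
    show "(\<lambda>\<rho>. (\<rho> ?x', pconj (transpose (\<rho> ?x') ?x) \<rho> \<circ> transpose ?x ?x')) \<in> row_pairings (Suc n) R \<rightarrow> ?A \<times> row_pairings n R"
    proof
      fix \<rho> assume "\<rho> \<in> row_pairings (Suc n) R"
      then have \<rho>: "\<rho> \<in> pairings (Suc n)"
        and row: "\<And>z. z \<in> {1..2 * Suc n} \<Longrightarrow> R (domino (\<rho> z)) = R (domino z)"
        by (auto simp: row_pairings_def simp del: atLeastAtMost_iff)
      let ?a = "\<rho> ?x'" and ?s = "pconj (transpose (\<rho> ?x') ?x) \<rho>"
      have x': "?x' \<in> {1..2 * Suc n}" by simp
      have a: "?a \<in> {1..2 * Suc n}" "?a \<noteq> ?x'" "R (domino ?a) = R (domino ?x)"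
        using pairings_mem[OF \<rho>] x' pairings_neq[OF \<rho> x'] row[OF x'] by auto
      then have aA: "?a \<in> ?A" using range_Suc_split[of ?a n] by auto
      have s: "?s \<in> pairings (Suc n)" by (rule pconj_in[OF tS[OF a(1)] \<rho>])
      have "?s ?x' = ?x" unfolding pconj_transpose_apply using a(2) by (simp add: transpose_def)
      then have p: "?s \<circ> transpose ?x ?x' \<in> pairings n" by (rule extend_obtain[OF s])
      have "R (domino ((?s \<circ> transpose ?x ?x') z)) = R (domino z)" if z: "z \<in> {1..2 * n}" for z
      proof -
        have "(?s \<circ> transpose ?x ?x') z = ?s z" using z by (auto simp: transpose_def)
        moreover have "R (domino (?s z)) = R (domino z)"
          unfolding pconj_transpose_apply Rt[OF a(3)]
          using row[of "transpose ?a ?x z"] tmem[OF a(1), of z] Rt[OF a(3)] z by auto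
        ultimately show ?thesis by simp
      qed
      with p aA show "(\<rho> ?x', ?s \<circ> transpose ?x ?x') \<in> ?A \<times> row_pairings n R"
        by (simp add: row_pairings_def)
    qed
    show "(\<lambda>\<rho>. (\<rho> ?x', pconj (transpose (\<rho> ?x') ?x) \<rho> \<circ> transpose ?x ?x'))
        ((\<lambda>(a, \<pi>). pconj (transpose a ?x) (extend n \<pi>)) p) = p" if "p \<in> ?A \<times> row_pairings n R" for p
    proof -
      obtain a \<pi> where p: "p = (a, \<pi>)" and a: "a \<in> ?A" and \<pi>: "\<pi> \<in> pairings n"
        using \<open>p \<in> ?A \<times> row_pairings n R\<close> by (auto simp: row_pairings_def)
      have 1: "pconj (transpose a ?x) (extend n \<pi>) ?x' = a"
      proof -
        have "transpose a ?x ?x' = ?x'" using Ain(2)[OF a] by (simp add: transpose_def)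
        then show ?thesis unfolding pconj_transpose_apply by (simp only: extend_simps(2)[OF \<pi>]) simp
      qed
      have 2: "extend n \<pi> \<circ> transpose ?x ?x' = \<pi>" by (simp add: extend_def comp_assoc fun_eq_iff)
      show ?thesis unfolding p by (simp only: prod.case 1 tt 2)
    qed
    show "(\<lambda>(a, \<pi>). pconj (transpose a ?x) (extend n \<pi>))
        ((\<lambda>\<rho>. (\<rho> ?x', pconj (transpose (\<rho> ?x') ?x) \<rho> \<circ> transpose ?x ?x')) \<rho>) = \<rho>" for \<rho>
    proof -
      have "extend n (s \<circ> transpose ?x ?x') = s" for s by (simp add: extend_def fun_eq_iff)
      then show ?thesis by (simp only: prod.case tt)
    qed
  qed
  from sum.reindex_bij_betw[OF this, of F] show ?thesis
    by (simp only: sum.cartesian_product split_def)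
qed

lemma symgrp_restrict:
  assumes s: "s \<in> symgrp (2 * Suc n)" and "s (2 * n + 1) = 2 * n + 1" "s (2 * n + 2) = 2 * n + 2"
  shows "s \<in> symgrp (2 * n)"
proof -
  have out: "s x = x" if "x \<notin> {1..2 * n}" for x
    using symgrp_outside[OF s, of x] assms(2,3) that range_Suc_split[of x n] by metis
  have inj: "inj s" using s bij_symgrp bij_is_inj by blast
  have "s x \<in> {1..2 * n}" if "x \<in> {1..2 * n}" for x
  proof (rule ccontr)
    assume "s x \<notin> {1..2 * n}"
    then have "s (s x) = s x" by (rule out)
    then have "s x = x" using inj by (simp add: inj_def)
    with \<open>s x \<notin> {1..2 * n}\<close> that show False by simp
  qed
  with inj out have "s permutes {1..2 * n}"
    by (intro inj_imp_permutes) (auto simp del: atLeastAtMost_iff intro: inj_on_subset)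
  then show ?thesis by (simp add: symgrp_def)
qed

text \<open>Coset decomposition by the image \<open>b\<close> of \<open>2 * n + 1\<close>; parity is
  preserved, so only odd \<open>b\<close> occur.\<close>

lemma sum_odd_group_Suc:
  "(\<Sum>r\<in>odd_group (Suc n) C. F r) =
    (\<Sum>b\<in>insert (2 * n + 1) {b \<in> {1..2 * n}. odd b \<and> C (domino b) = C (Suc n)}.
      \<Sum>r\<in>odd_group n C. F (transpose b (2 * n + 1) \<circ> r))"
proof -
  let ?x = "2 * n + 1" and ?x' = "2 * n + 2"
  let ?B = "insert ?x {b \<in> {1..2 * n}. odd b \<and> C (domino b) = C (Suc n)}"
  have Bin: "b \<in> {1..2 * Suc n}" "odd b" "C (domino b) = C (domino ?x)" if "b \<in> ?B" for b using that by auto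
  have tO: "transpose b ?x \<in> odd_group (Suc n) C" if "b \<in> {1..2 * Suc n}" "odd b" "C (domino b) = C (domino ?x)" for b
    unfolding odd_group_def by (rule transpose_label_group) (use that in auto)
  have "bij_betw (\<lambda>(b, r). transpose b ?x \<circ> r) (?B \<times> odd_group n C) (odd_group (Suc n) C)"
  proof (rule bij_betwI[where g = "\<lambda>r. (r ?x, transpose (r ?x) ?x \<circ> r)"])
    show "(\<lambda>(b, r). transpose b ?x \<circ> r) \<in> ?B \<times> odd_group n C \<rightarrow> odd_group (Suc n) C"
    proof
      fix p assume "p \<in> ?B \<times> odd_group n C"
      then obtain b r where p: "p = (b, r)" and b: "b \<in> ?B" and r: "r \<in> odd_group n C" by auto
      have "r \<in> odd_group (Suc n) C"
      proof (rule odd_groupI)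
        show "r \<in> symgrp (2 * Suc n)" by (rule symgrp_mono[OF odd_groupD(1)[OF r]]) simp
        show "C (domino (r x)) = C (domino x)" for x
          using odd_groupD(4)[OF r, of x] symgrp_outside[OF odd_groupD(1)[OF r], of x] by metis
      qed (use odd_groupD(2,3)[OF r] in auto)
      with tO[OF Bin[OF b]] have "transpose b ?x \<circ> r \<in> odd_group (Suc n) C"
        unfolding odd_group_def by (rule label_group_comp)
      then show "(case p of (b, r) \<Rightarrow> transpose b ?x \<circ> r) \<in> odd_group (Suc n) C" by (simp add: p)
    qed
    show "(\<lambda>r. (r ?x, transpose (r ?x) ?x \<circ> r)) \<in> odd_group (Suc n) C \<rightarrow> ?B \<times> odd_group n C"
    proof
      fix r assume r: "r \<in> odd_group (Suc n) C"
      have xin: "?x \<in> {1..2 * Suc n}" by simp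
      have b: "r ?x \<in> {1..2 * Suc n}" "odd (r ?x)" "C (domino (r ?x)) = C (domino ?x)"
        using symgrp_mem_iff[OF odd_groupD(1)[OF r]] xin odd_groupD(3,4)[OF r, of ?x] by auto
      then have bB: "r ?x \<in> ?B" using range_Suc_split[of "r ?x" n] by auto
      let ?s = "transpose (r ?x) ?x \<circ> r"
      have s: "?s \<in> odd_group (Suc n) C"
        using tO[OF b] r unfolding odd_group_def by (rule label_group_comp)
      have "?s \<in> odd_group n C"
      proof (rule odd_groupI)
        show "?s \<in> symgrp (2 * n)"
          by (rule symgrp_restrict[OF odd_groupD(1)[OF s]]) (use odd_groupD(2)[OF s, of ?x'] in simp_all)
        show "C (domino (?s x)) = C (domino x)" if "x \<in> {1..2 * n}" for x
          by (rule odd_groupD(4)[OF s]) (use that in auto)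
      qed (use odd_groupD(2,3)[OF s] in auto)
      with bB show "(r ?x, ?s) \<in> ?B \<times> odd_group n C" by simp
    qed
    show "(\<lambda>r. (r ?x, transpose (r ?x) ?x \<circ> r)) ((\<lambda>(b, r). transpose b ?x \<circ> r) p) = p"
      if "p \<in> ?B \<times> odd_group n C" for p
    proof -
      obtain b r where p: "p = (b, r)" and r: "r \<in> odd_group n C" using \<open>p \<in> ?B \<times> odd_group n C\<close> by auto
      have "r ?x = ?x" by (rule symgrp_outside[OF odd_groupD(1)[OF r]]) simp
      then show ?thesis by (simp add: p fun_eq_iff)
    qed
  qed (simp add: fun_eq_iff)
  from sum.reindex_bij_betw[OF this, of F] show ?thesis
    by (simp only: sum.cartesian_product split_def)
qed

text \<open>Conjugating both pairings by the exchange of \<open>a\<close> and \<open>?x\<close>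
  frees the first one. On the second, the exchanges compose as (a x)(b x) = (b x)(a b), which is an
  insertion at \<open>b\<close> into a pairing altered by the exchange of \<open>a\<close> and
  \<open>b\<close>.\<close>

lemma card_colourings_insert2:
  assumes \<alpha>: "\<alpha> \<in> pairings n" and \<rho>: "\<rho> \<in> pairings n"
    and a: "a \<in> {1..2 * n}" and b: "b \<in> {1..2 * n}" and ab: "a \<noteq> b"
  shows "card (colourings (Suc n) \<tau> (pconj (transpose a (2 * n + 1)) (extend n \<alpha>))
      (pconj (transpose b (2 * n + 1)) (extend n \<rho>))) = card (colourings n \<tau> \<alpha> (pconj (transpose a b) \<rho>))"
proof -
  let ?x = "2 * n + 1"
  have tS: "transpose a ?x \<in> symgrp (2 * Suc n)" "transpose b ?x \<in> symgrp (2 * Suc n)"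
    by (rule transpose_symgrp; use a b in auto)+
  have ab_S: "transpose a b \<in> symgrp (2 * n)" by (rule transpose_symgrp[OF a b])
  then have ab_S': "transpose a b \<in> symgrp (2 * Suc n)" by (rule symgrp_mono) simp
  have cancel: "pconj (transpose a ?x) (pconj (transpose a ?x) \<pi>) = \<pi>" for \<pi>
    by (rule ext) (simp add: pconj_transpose_apply)
  have "card (colourings (Suc n) \<tau> (pconj (transpose a ?x) (extend n \<alpha>)) (pconj (transpose b ?x) (extend n \<rho>)))
    = card (colourings (Suc n) \<tau> (pconj (transpose a ?x) (pconj (transpose a ?x) (extend n \<alpha>)))
        (pconj (transpose a ?x) (pconj (transpose b ?x) (extend n \<rho>))))"
    by (rule colourings_pconj[OF tS(1), symmetric])
  also have "\<dots> = card (colourings (Suc n) \<tau> (extend n \<alpha>) (pconj (transpose a ?x \<circ> transpose b ?x) (extend n \<rho>)))"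
    by (simp only: cancel pconj_comp[OF tS])
  also have "transpose a ?x \<circ> transpose b ?x = transpose b ?x \<circ> transpose a b"
    using a b ab by (auto simp: fun_eq_iff transpose_def)
  also have "pconj (transpose b ?x \<circ> transpose a b) (extend n \<rho>) =
      pconj (transpose b ?x) (extend n (pconj (transpose a b) \<rho>))"
    by (simp only: pconj_comp[OF tS(2) ab_S', symmetric] pconj_extend[OF ab_S])
  also have "card (colourings (Suc n) \<tau> (extend n \<alpha>) (pconj (transpose b ?x) (extend n (pconj (transpose a b) \<rho>))))
      = card (colourings n \<tau> (pconj (transpose a b) \<rho>) \<alpha>)"
    unfolding colourings_commute[of "Suc n" \<tau> "extend n \<alpha>"]
    by (rule card_colourings_insert[OF pconj_in[OF ab_S \<rho>] \<alpha> b])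
  finally show ?thesis by (simp add: colourings_commute)
qed

lemma row_pairings_in: "\<pi> \<in> row_pairings n R \<Longrightarrow> \<pi> \<in> pairings n"
  by (simp add: row_pairings_def)

lemma row_pairings_pconj:
  assumes g: "g \<in> label_group (2 * n) (\<lambda>x. R (domino x))" and \<pi>: "\<pi> \<in> row_pairings n R"
  shows "pconj g \<pi> \<in> row_pairings n R"
proof -
  have gS: "g \<in> symgrp (2 * n)" by (rule label_group_symgrp[OF g])
  have R: "R (domino (g x)) = R (domino x)" "R (domino (inv g x)) = R (domino x)" if "x \<in> {1..2 * n}" for x
    using g label_group_inv[OF g] that by (simp_all add: label_group_def)
  have "R (domino (pconj g \<pi> x)) = R (domino x)" if x: "x \<in> {1..2 * n}" for x
  proof -
    have 1: "inv g x \<in> {1..2 * n}" using x symgrp_mem_iff[OF inv_symgrp[OF gS]] by blast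
    then have "\<pi> (inv g x) \<in> {1..2 * n}" using pairings_mem[OF row_pairings_in[OF \<pi>]] by blast
    then have "R (domino (g (\<pi> (inv g x)))) = R (domino (\<pi> (inv g x)))" by (rule R)
    also have "\<dots> = R (domino (inv g x))" using \<pi> 1 by (simp add: row_pairings_def)
    also have "\<dots> = R (domino x)" by (rule R(2)[OF x])
    finally show ?thesis by (simp add: pconj_def)
  qed
  with pconj_in[OF gS row_pairings_in[OF \<pi>]] show ?thesis by (simp add: row_pairings_def)
qed

lemma sum_row_pairings_pconj:
  assumes g: "g \<in> label_group (2 * n) (\<lambda>x. R (domino x))"
  shows "(\<Sum>\<pi>\<in>row_pairings n R. F (pconj g \<pi>)) = (\<Sum>\<pi>\<in>row_pairings n R. F \<pi>)"
proof (rule sum.reindex_bij_betw, rule bij_betwI[where g = "pconj (inv g)"])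
  show "pconj g \<in> row_pairings n R \<rightarrow> row_pairings n R" using row_pairings_pconj[OF g] by blast
  show "pconj (inv g) \<in> row_pairings n R \<rightarrow> row_pairings n R" using row_pairings_pconj[OF label_group_inv[OF g]] by blast
qed (simp_all add: pconj_inv_cancel[OF label_group_symgrp[OF g]])

lemma inj_on_double: "inj_on (\<lambda>j::nat. 2 * j) A"
  by (rule inj_onI) simp

lemma inj_on_double_minus_1: "0 \<notin> A \<Longrightarrow> inj_on (\<lambda>j::nat. 2 * j - 1) A"
proof (rule inj_onI)
  fix x y :: nat assume "0 \<notin> A" "x \<in> A" "y \<in> A" and eq: "2 * x - 1 = 2 * y - 1"
  then have "x \<noteq> 0" "y \<noteq> 0" by metis+
  with eq show "x = y" by linarith
qed

section \<open>Induction over the dominoes of a filling\<close>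

text \<open>The properties of the row-by-row filling of a diagram that drive the induction.
  \<open>row_count\<close> and \<open>col_count\<close> say that every box finds the boxes to its
  left and above it already placed; \<open>corner\<close> supplies the box in the row of
  \<open>b\<close> and the column of \<open>a\<close>, through which the mixed terms cancel.\<close>

locale domino_filling =
  fixes N :: nat and R C :: "nat \<Rightarrow> nat"
  assumes pos: "k \<in> {1..N} \<Longrightarrow> 1 \<le> R k \<and> 1 \<le> C k"
    and row_count: "k \<in> {1..N} \<Longrightarrow> card {j \<in> {1..<k}. R j = R k} = C k - 1"
    and col_count: "k \<in> {1..N} \<Longrightarrow> card {j \<in> {1..<k}. C j = C k} = R k - 1"
    and inject: "j \<in> {1..N} \<Longrightarrow> k \<in> {1..N} \<Longrightarrow> R j = R k \<Longrightarrow> C j = C k \<Longrightarrow> j = k"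
    and corner: "k \<in> {1..N} \<Longrightarrow> a \<in> {1..<k} \<Longrightarrow> b \<in> {1..<k} \<Longrightarrow> R a = R k \<Longrightarrow> C b = C k \<Longrightarrow>
      \<exists>d\<in>{1..<k}. R d = R b \<and> C d = C a"
begin

text \<open>The pairing with the Gram matrix cut down to the first \<open>n\<close> dominoes, with
  numbers of colourings in place of Gram entries, so that dominoes can be removed one at a
  time.\<close>

definition young_gram :: "nat \<Rightarrow> nat \<Rightarrow> complex"
  where "young_gram \<tau> n = (\<Sum>\<pi>\<in>row_pairings n R. \<Sum>r\<in>odd_group n C.
    of_int (sign r) * of_nat (card (colourings n \<tau> \<pi> (pconj r (base_pairing n)))))"

text \<open>For \<open>d\<close> in the row of \<open>b\<close> and the column of \<open>a\<close>, \<open>(d b) (a b) (a d) = (a b)\<close>: the sum is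
  invariant under \<open>(d b)\<close> acting on \<open>\<pi>\<close> and changes sign under \<open>(a d)\<close> acting on the other pairing.\<close>

lemma cross_term:
  assumes n: "n < N" and a: "a \<in> {1..2 * n}" "R (domino a) = R (Suc n)"
    and b: "b \<in> {1..2 * n}" "C (domino b) = C (Suc n)"
  shows "(\<Sum>\<pi>\<in>row_pairings n R. \<Sum>r\<in>odd_group n C. of_int (sign r) *
    of_nat (card (colourings n \<tau> \<pi> (pconj (transpose a b) (pconj r (base_pairing n)))))) = (0 :: complex)"
    (is "?S = 0") and "a \<noteq> b"
proof -
  have Suc: "Suc n \<in> {1..N}" using n by simp
  have dom: "domino a \<in> {1..<Suc n}" "domino b \<in> {1..<Suc n}"
    using domino_mem[OF a(1)] domino_mem[OF b(1)] by auto
  obtain k where k: "k \<in> {1..<Suc n}" "R k = R (domino b)" "C k = C (domino a)"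
    using corner[OF Suc dom a(2) b(2)] by blast
  have Rab: "R (domino a) \<noteq> R (domino b)"
    using inject[of "domino b" "Suc n"] a b dom n by fastforce
  then show "a \<noteq> b" by auto
  have Cab: "C (domino a) \<noteq> C (domino b)"
    using inject[of "domino a" "Suc n"] a b dom n by fastforce
  \<comment> \<open>The half of domino \<open>k\<close> with the parity of \<open>a\<close>, so that
    exchanging \<open>a\<close> and \<open>d\<close> mixes no left half with a right half.\<close>
  define d where "d = (if even a then 2 * k else 2 * k - 1)"
  have d: "d \<in> {1..2 * n}" "domino d = k" "even d \<longleftrightarrow> even a"
    using k(1) by (auto simp: d_def domino_def)
  have neq: "a \<noteq> d" "b \<noteq> d" "a \<noteq> b" using Rab Cab k d by auto
  have ad: "transpose a d \<in> label_group (2 * n) (\<lambda>x. (C (domino x), even x))"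
    using a d k by (intro transpose_label_group) auto
  have db: "transpose d b \<in> label_group (2 * n) (\<lambda>x. R (domino x))"
    using b d k by (intro transpose_label_group) auto
  have S: "transpose d b \<in> symgrp (2 * n)" "transpose a b \<in> symgrp (2 * n)" "transpose a d \<in> symgrp (2 * n)"
    by (rule transpose_symgrp; fact a b d)+
  have id: "transpose d b \<circ> (transpose a b \<circ> transpose a d) = transpose a b"
    using neq by (auto simp: fun_eq_iff transpose_def)
  let ?G = "\<lambda>\<pi> \<rho>. of_nat (card (colourings n \<tau> \<pi> \<rho>)) :: complex"
  let ?b = "base_pairing n"
  have "?S = (\<Sum>\<pi>\<in>row_pairings n R. \<Sum>r\<in>odd_group n C. of_int (sign r) *
      ?G (pconj (transpose d b) \<pi>) (pconj (transpose a b) (pconj r ?b)))"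
    by (rule sum_row_pairings_pconj[OF db, symmetric])
  also have "\<dots> = (\<Sum>\<pi>\<in>row_pairings n R. \<Sum>r\<in>odd_group n C. of_int (sign r) *
      ?G \<pi> (pconj (transpose a b) (pconj (transpose a d) (pconj r ?b))))"
  proof (intro sum.cong refl)
    fix \<pi> r
    have dd: "pconj (transpose d b) (pconj (transpose d b) \<sigma>) = \<sigma>" for \<sigma>
      by (rule ext) (simp add: pconj_transpose_apply)
    have "pconj (transpose a b) \<rho> = pconj (transpose d b) (pconj (transpose a b) (pconj (transpose a d) \<rho>))" for \<rho>
      using S by (subst id[symmetric]) (simp add: pconj_comp[of _ "2 * n"] comp_assoc)
    then show "of_int (sign r) * ?G (pconj (transpose d b) \<pi>) (pconj (transpose a b) (pconj r ?b)) =
        of_int (sign r) * ?G \<pi> (pconj (transpose a b) (pconj (transpose a d) (pconj r ?b)))"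
      using colourings_pconj[OF S(1)] by metis
  qed
  also have "\<dots> = (\<Sum>\<pi>\<in>row_pairings n R. of_int (sign (transpose a d)) * (\<Sum>r\<in>odd_group n C. of_int (sign r) *
      ?G \<pi> (pconj (transpose a b) (pconj r ?b))))"
    by (rule sum.cong[OF refl], rule odd_group_antisym[OF ad])
  also have "\<dots> = - ?S"
    using neq by (simp add: sign_swap_id sum_negf)
  finally have "?S = - ?S" .
  moreover have "z = 0" if "z = - z" for z :: complex using that by (simp add: complex_eq_iff)
  ultimately show "?S = 0" by blast
qed

text \<open>Each domino to the left in the row offers both of its halves as exchange
  partners.\<close>

lemma card_row_new:
  assumes n: "n < N"
  shows "card {a \<in> {1..2 * n}. R (domino a) = R (Suc n)} = 2 * (C (Suc n) - 1)"
proof -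
  let ?J = "{j \<in> {1..<Suc n}. R j = R (Suc n)}"
  have "{a \<in> {1..2 * n}. R (domino a) = R (Suc n)} = (\<lambda>j. 2 * j) ` ?J \<union> (\<lambda>j. 2 * j - 1) ` ?J"
  proof (intro set_eqI iffI)
    fix a assume a: "a \<in> {a \<in> {1..2 * n}. R (domino a) = R (Suc n)}"
    then have J: "domino a \<in> ?J" using domino_mem[of a n] by auto
    show "a \<in> (\<lambda>j. 2 * j) ` ?J \<union> (\<lambda>j. 2 * j - 1) ` ?J"
    proof (cases "even a")
      case True
      then have "a = 2 * domino a" by (auto simp: domino_def)
      with J show ?thesis by blast
    next
      case False
      then have "a = 2 * domino a - 1" by (auto simp: domino_def elim: oddE)
      with J show ?thesis by blast
    qed
  next
    fix a assume "a \<in> (\<lambda>j. 2 * j) ` ?J \<union> (\<lambda>j. 2 * j - 1) ` ?J"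
    then obtain j where j: "j \<in> ?J" "a = 2 * j \<or> a = 2 * j - 1" by blast
    then have "domino a = j" by (auto simp: domino_def)
    with j show "a \<in> {a \<in> {1..2 * n}. R (domino a) = R (Suc n)}" by auto
  qed
  then have "card {a \<in> {1..2 * n}. R (domino a) = R (Suc n)} = card ((\<lambda>j. 2 * j) ` ?J \<union> (\<lambda>j. 2 * j - 1) ` ?J)"
    by simp
  also have "\<dots> = card ((\<lambda>j. 2 * j) ` ?J) + card ((\<lambda>j. 2 * j - 1) ` ?J)"
  proof (rule card_Un_disjoint)
    have "2 * i \<noteq> 2 * j - 1" if "j \<ge> 1" for i j :: nat using that by presburger
    then show "(\<lambda>j. 2 * j) ` ?J \<inter> (\<lambda>j. 2 * j - 1) ` ?J = {}" by fastforce
  qed auto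
  also have "\<dots> = card ?J + card ?J"
    by (subst card_image[OF inj_on_double], subst card_image[OF inj_on_double_minus_1]) simp_all
  also have "\<dots> = 2 * (C (Suc n) - 1)"
    using row_count[of "Suc n"] n by simp
  finally show ?thesis .
qed

text \<open>Only left halves are exchanged within columns, one for each domino above.\<close>

lemma card_col_new:
  assumes n: "n < N"
  shows "card {b \<in> {1..2 * n}. odd b \<and> C (domino b) = C (Suc n)} = R (Suc n) - 1"
proof -
  let ?J = "{j \<in> {1..<Suc n}. C j = C (Suc n)}"
  have "{b \<in> {1..2 * n}. odd b \<and> C (domino b) = C (Suc n)} = (\<lambda>j. 2 * j - 1) ` ?J"
  proof (intro set_eqI iffI)
    fix b assume b: "b \<in> {b \<in> {1..2 * n}. odd b \<and> C (domino b) = C (Suc n)}"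
    then have J: "domino b \<in> ?J" using domino_mem[of b n] by auto
    have "b = 2 * domino b - 1" using b by (auto simp: domino_def elim: oddE)
    with J show "b \<in> (\<lambda>j. 2 * j - 1) ` ?J" by blast
  next
    fix b assume "b \<in> (\<lambda>j. 2 * j - 1) ` ?J"
    then obtain j where j: "j \<in> ?J" "b = 2 * j - 1" by blast
    then have "domino b = j" "odd b" by (auto simp: domino_def)
    with j show "b \<in> {b \<in> {1..2 * n}. odd b \<and> C (domino b) = C (Suc n)}" by auto
  qed
  also have "card \<dots> = card ?J" by (rule card_image[OF inj_on_double_minus_1]) simp
  also have "card ?J = R (Suc n) - 1" by (rule col_count) (use n in simp)
  finally show ?thesis .
qed

lemma young_gram_Suc:
  assumes n: "n < N"
  shows "young_gram \<tau> (Suc n) =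
    young_gram \<tau> n * (of_nat \<tau> + 2 * of_nat (C (Suc n)) - 1 - of_nat (R (Suc n)))"
proof -
  let ?x = "2 * n + 1"
  let ?b = "base_pairing n"
  define A where "A = {a \<in> {1..2 * n}. R (domino a) = R (Suc n)}"
  define B where "B = {b \<in> {1..2 * n}. odd b \<and> C (domino b) = C (Suc n)}"
  have fin: "finite A" "finite B" and xA: "?x \<notin> A" and xB: "?x \<notin> B" by (auto simp: A_def B_def)
  \<comment> \<open>\<open>T a b\<close> collects the terms in which the new domino takes part in a
    row exchange with \<open>a\<close> and a column exchange with \<open>b\<close>; the value
    \<open>?x\<close> stands for no exchange.\<close>
  define T where "T a b = (\<Sum>\<pi>\<in>row_pairings n R. \<Sum>r\<in>odd_group n C. of_int (sign r) *
    (of_nat (card (colourings (Suc n) \<tau> (pconj (transpose a ?x) (extend n \<pi>))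
      (pconj (transpose b ?x) (extend n (pconj r ?b))))) :: complex))" for a b
  have bin: "pconj r ?b \<in> pairings n" if "r \<in> odd_group n C" for r
    by (rule pconj_in[OF odd_groupD(1)[OF that] base_pairing_in])
  \<comment> \<open>A genuine column exchange is an odd permutation. This is the origin of the minus
    sign in front of the row index.\<close>
  have step: "(\<Sum>r\<in>odd_group n C. of_int (sign (transpose b ?x \<circ> r)) *
      of_nat (card (colourings (Suc n) \<tau> \<pi> (pconj (transpose b ?x \<circ> r) (base_pairing (Suc n)))))) =
    (if b = ?x then 1 else - 1) * (\<Sum>r\<in>odd_group n C. of_int (sign r) *
      (of_nat (card (colourings (Suc n) \<tau> \<pi> (pconj (transpose b ?x) (extend n (pconj r ?b))))) :: complex))"
    if b: "b \<in> insert ?x B" for b \<pi>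
    unfolding sum_distrib_left
  proof (rule sum.cong[OF refl])
    fix r assume r: "r \<in> odd_group n C"
    have tS: "transpose b ?x \<in> symgrp (2 * Suc n)" by (rule transpose_symgrp) (use b in \<open>auto simp: B_def\<close>)
    have rS: "r \<in> symgrp (2 * Suc n)" by (rule symgrp_mono[OF odd_groupD(1)[OF r]]) simp
    have 1: "pconj (transpose b ?x \<circ> r) (base_pairing (Suc n)) = pconj (transpose b ?x) (extend n (pconj r ?b))"
      unfolding base_pairing_Suc pconj_comp[OF tS rS, symmetric] pconj_extend[OF odd_groupD(1)[OF r]] ..
    have 2: "sign (transpose b ?x \<circ> r) = (if b = ?x then 1 else - 1) * sign r"
      unfolding sign_symgrp_comp[OF tS rS] sign_swap_id ..
    show "of_int (sign (transpose b ?x \<circ> r)) *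
        of_nat (card (colourings (Suc n) \<tau> \<pi> (pconj (transpose b ?x \<circ> r) (base_pairing (Suc n))))) =
      (if b = ?x then 1 else - 1) * (of_int (sign r) *
        (of_nat (card (colourings (Suc n) \<tau> \<pi> (pconj (transpose b ?x) (extend n (pconj r ?b))))) :: complex))"
      unfolding 1 2 by simp
  qed
  have "young_gram \<tau> (Suc n) = (\<Sum>a\<in>insert ?x A. \<Sum>\<pi>\<in>row_pairings n R. \<Sum>b\<in>insert ?x B.
      (if b = ?x then 1 else - 1) * (\<Sum>r\<in>odd_group n C. of_int (sign r) *
      (of_nat (card (colourings (Suc n) \<tau> (pconj (transpose a ?x) (extend n \<pi>))
        (pconj (transpose b ?x) (extend n (pconj r ?b))))) :: complex)))"
    unfolding young_gram_def sum_row_pairings_Suc sum_odd_group_Suc A_def[symmetric] B_def[symmetric]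
    by (rule sum.cong[OF refl], rule sum.cong[OF refl], rule sum.cong[OF refl], rule step)
  also have "\<dots> = (\<Sum>a\<in>insert ?x A. \<Sum>b\<in>insert ?x B. (if b = ?x then 1 else - 1) * T a b)"
    unfolding T_def sum_distrib_left[of _ _ "row_pairings n R"]
    by (rule sum.cong[OF refl], rule sum.swap)
  also have "\<dots> = T ?x ?x - (\<Sum>b\<in>B. T ?x b) + (\<Sum>a\<in>A. T a ?x - (\<Sum>b\<in>B. T a b))"
  proof -
    have "(\<Sum>b\<in>insert ?x B. (if b = ?x then 1 else - 1) * T a b) = T a ?x - (\<Sum>b\<in>B. T a b)" for a
    proof -
      have "(\<Sum>b\<in>B. (if b = ?x then 1 else - 1) * T a b) = (\<Sum>b\<in>B. - T a b)"
        by (rule sum.cong[OF refl]) (use xB in auto)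
      then show ?thesis using fin xB by (simp add: sum_negf)
    qed
    then show ?thesis using fin xA by simp
  qed
  also have "T ?x ?x = of_nat \<tau> * young_gram \<tau> n"
  proof -
    have "pconj (transpose ?x ?x) \<sigma> = \<sigma>" for \<sigma> by (simp only: transpose_same pconj_id)
    then show ?thesis
      unfolding T_def young_gram_def sum_distrib_left
      by (intro sum.cong refl)
        (simp only: card_colourings_extend[OF row_pairings_in bin] of_nat_mult mult.left_commute)
  qed
  also have "(\<Sum>b\<in>B. T ?x b) = of_nat (card B) * young_gram \<tau> n"
  proof -
    have "T ?x b = young_gram \<tau> n" if "b \<in> B" for b
    proof -
      have b: "b \<in> {1..2 * n}" using that by (simp add: B_def)
      have "pconj (transpose ?x ?x) \<sigma> = \<sigma>" for \<sigma> by (simp only: transpose_same pconj_id)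
      then have "card (colourings (Suc n) \<tau> (pconj (transpose ?x ?x) (extend n \<pi>))
          (pconj (transpose b ?x) (extend n \<rho>))) = card (colourings n \<tau> \<pi> \<rho>)"
        if "\<pi> \<in> pairings n" "\<rho> \<in> pairings n" for \<pi> \<rho>
        using card_colourings_insert[OF that(2,1) b, of \<tau>] by (simp only: colourings_commute[of _ \<tau> \<pi>] colourings_commute[of _ \<tau> "extend n \<pi>"])
      then show ?thesis
        unfolding T_def young_gram_def by (intro sum.cong refl) (simp only: row_pairings_in bin)
    qed
    then show ?thesis by simp
  qed
  \<comment> \<open>A row exchange alone contributes with positive sign and leaves the colourings of
    the smaller configuration; combined with any column exchange it falls under
    \<open>cross_term\<close>.\<close>
  also have "(\<Sum>a\<in>A. T a ?x - (\<Sum>b\<in>B. T a b)) = (\<Sum>a\<in>A. young_gram \<tau> n)"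
  proof (rule sum.cong[OF refl])
    fix a assume "a \<in> A"
    then have a: "a \<in> {1..2 * n}" "R (domino a) = R (Suc n)" by (auto simp: A_def)
    have "T a b = 0" if "b \<in> B" for b
    proof -
      have b: "b \<in> {1..2 * n}" "C (domino b) = C (Suc n)" using that by (auto simp: B_def)
      have "T a b = (\<Sum>\<pi>\<in>row_pairings n R. \<Sum>r\<in>odd_group n C. of_int (sign r) *
          of_nat (card (colourings n \<tau> \<pi> (pconj (transpose a b) (pconj r ?b)))))"
        unfolding T_def
        by (intro sum.cong refl)
          (simp only: card_colourings_insert2[OF row_pairings_in bin a(1) b(1) cross_term(2)[OF n a b]])
      then show ?thesis by (simp only: cross_term(1)[OF n a b])
    qed
    moreover have "T a ?x = young_gram \<tau> n"
    proof -
      have "pconj (transpose ?x ?x) \<sigma> = \<sigma>" for \<sigma> by (simp only: transpose_same pconj_id)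
      then show ?thesis
        unfolding T_def young_gram_def
        by (intro sum.cong refl) (simp only: card_colourings_insert[OF row_pairings_in bin a(1)])
    qed
    ultimately show "T a ?x - (\<Sum>b\<in>B. T a b) = young_gram \<tau> n" by simp
  qed
  finally have "young_gram \<tau> (Suc n) = of_nat \<tau> * young_gram \<tau> n - of_nat (card B) * young_gram \<tau> n
      + of_nat (card A) * young_gram \<tau> n" by simp
  moreover have "of_nat (card A) = (2 * of_nat (C (Suc n)) - 2 :: complex)"
    using card_row_new[OF n] pos[of "Suc n"] n by (simp add: A_def of_nat_diff)
  moreover have "of_nat (card B) = (of_nat (R (Suc n)) - 1 :: complex)"
    using card_col_new[OF n] pos[of "Suc n"] n by (simp add: B_def of_nat_diff)
  ultimately show ?thesis by (simp add: algebra_simps)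
qed

lemma young_gram_eq:
  "n \<le> N \<Longrightarrow> young_gram \<tau> n = (\<Prod>k=1..n. of_nat \<tau> + 2 * of_nat (C k) - 1 - of_nat (R k))"
proof (induction n)
  case 0
  have "pairings 0 = {id}" by (auto simp: pairings_def symgrp_def)
  then have 1: "row_pairings 0 R = {id}" by (auto simp: row_pairings_def)
  have "symgrp 0 = {id}" by (auto simp: symgrp_def)
  then have 2: "odd_group 0 C = {id}" by (auto simp: odd_group_def label_group_def)
  have 3: "card (colourings 0 \<tau> id id) = 1" by (simp add: colourings_def)
  show ?case unfolding young_gram_def 1 2 base_pairing.simps by (simp add: 3 sign_id)
next
  case (Suc n)
  then show ?case by (simp add: young_gram_Suc)
qed

text \<open>For odd \<open>x\<close> the conjugated base pairing pairs \<open>r x\<close> with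
  \<open>x + 1\<close>, so these share a row, while \<open>r\<close> keeps columns. Hence
  \<open>r x\<close> lies in the domino of \<open>x\<close>, and by parity it is
  \<open>x\<close>.\<close>

lemma row_odd_disjoint:
  assumes n: "n \<le> N" and r: "r \<in> odd_group n C" and row: "pconj r (base_pairing n) \<in> row_pairings n R"
  shows "r = id"
proof
  fix x
  show "r x = id x"
  proof (cases "odd x \<and> x \<in> {1..2 * n}")
    case True
    let ?b = "base_pairing n"
    have rx: "r x \<in> {1..2 * n}" using True symgrp_mem_iff[OF odd_groupD(1)[OF r]] by blast
    have bx: "?b x = x + 1" using True by (simp add: base_pairing_apply)
    have "pconj r ?b (r x) = r (x + 1)" using odd_groupD(1)[OF r] by (simp add: pconj_def bx)
    also have "\<dots> = x + 1" using odd_groupD(2)[OF r] True by simp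
    finally have "R (domino (x + 1)) = R (domino (r x))"
      using row rx by (auto simp: row_pairings_def simp del: atLeastAtMost_iff)
    moreover have "domino (x + 1) = domino x" using True by (auto simp: domino_def elim: oddE)
    moreover have "C (domino (r x)) = C (domino x)" using odd_groupD(4)[OF r] True by blast
    ultimately have "domino (r x) = domino x"
      using inject[of "domino (r x)" "domino x"] domino_mem[OF rx] domino_mem[of x n] True n by auto
    moreover have "odd (r x)" using odd_groupD(3)[OF r] True by blast
    ultimately show ?thesis using True by (auto simp: domino_def elim!: oddE)
  next
    case False
    then show ?thesis using odd_groupD(2)[OF r] symgrp_outside[OF odd_groupD(1)[OF r]] by auto
  qed
qed

end

section \<open>The tableau of a doubled partition\<close>

lemma tableau_same_row: "tableau \<mu> (i, j) < tableau \<mu> (i, j') \<longleftrightarrow> j < j'"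
  by (simp add: tableau_def)

lemma boxes_left: "(i, j) \<in> boxes \<mu> \<Longrightarrow> 1 \<le> j' \<Longrightarrow> j' \<le> j \<Longrightarrow> (i, j') \<in> boxes \<mu>"
  by (auto simp: boxes_def)

text \<open>Numbers increase along rows and down columns, so the boxes to the left of a box and
  above it carry exactly the smaller numbers of its row and column.\<close>

lemma domino_filling_tableau:
  assumes \<nu>: "\<nu> \<in> partitions n"
  shows "domino_filling n (rowof \<nu>) (colof \<nu>)"
proof
  have s: "sum_list \<nu> = n" using \<nu> by (simp add: partitions_def)
  note box = cell_in_boxes[OF s] and tab = tableau_cell[OF s]
  have row_le: "rowof \<nu> j \<le> rowof \<nu> k" if "j \<in> {1..n}" "k \<in> {1..n}" "j < k" for j k
    using tableau_less[OF box[OF that(2)] box[OF that(1)]] tab[OF that(1)] tab[OF that(2)] that(3)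
    by (metis less_asym not_less)
  have col_less: "colof \<nu> j < colof \<nu> k" if "j \<in> {1..n}" "k \<in> {1..n}" "rowof \<nu> j = rowof \<nu> k" "j < k" for j k
    using tableau_same_row[of \<nu> "rowof \<nu> k" "colof \<nu> j" "colof \<nu> k"] tab[OF that(1)] tab[OF that(2)] that by simp
  have row_less: "rowof \<nu> j < rowof \<nu> k" if "j \<in> {1..n}" "k \<in> {1..n}" "colof \<nu> j = colof \<nu> k" "j < k" for j k
    using row_le[OF that(1,2,4)] cell_inject[OF s that(1,2)] that by fastforce
  show pos: "1 \<le> rowof \<nu> k \<and> 1 \<le> colof \<nu> k" if "k \<in> {1..n}" for k
    using box[OF that] by (auto simp: boxes_def)
  show "j = k" if "j \<in> {1..n}" "k \<in> {1..n}" "rowof \<nu> j = rowof \<nu> k" "colof \<nu> j = colof \<nu> k" for j k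
    using cell_inject[OF s] that by blast
  show "card {j \<in> {1..<k}. rowof \<nu> j = rowof \<nu> k} = colof \<nu> k - 1" if k: "k \<in> {1..n}" for k
  proof -
    have left: "(rowof \<nu> k, j) \<in> boxes \<nu>" if "j \<in> {1..<colof \<nu> k}" for j
      by (rule boxes_left[OF box[OF k]]) (use that in auto)
    have "bij_betw (colof \<nu>) {j \<in> {1..<k}. rowof \<nu> j = rowof \<nu> k} {1..<colof \<nu> k}"
    proof (rule bij_betwI[where g = "\<lambda>j. tableau \<nu> (rowof \<nu> k, j)"])
      show "colof \<nu> \<in> {j \<in> {1..<k}. rowof \<nu> j = rowof \<nu> k} \<rightarrow> {1..<colof \<nu> k}"
        using col_less[OF _ k] pos k by auto
      show "(\<lambda>j. tableau \<nu> (rowof \<nu> k, j)) \<in> {1..<colof \<nu> k} \<rightarrow> {j \<in> {1..<k}. rowof \<nu> j = rowof \<nu> k}"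
      proof
        fix j assume j: "j \<in> {1..<colof \<nu> k}"
        have "tableau \<nu> (rowof \<nu> k, j) < tableau \<nu> (rowof \<nu> k, colof \<nu> k)"
          using j by (simp add: tableau_same_row)
        then show "tableau \<nu> (rowof \<nu> k, j) \<in> {j \<in> {1..<k}. rowof \<nu> j = rowof \<nu> k}"
          using tab[OF k] left[OF j] tableau_in[OF s left[OF j]] by simp
      qed
    next
      fix j assume "j \<in> {j \<in> {1..<k}. rowof \<nu> j = rowof \<nu> k}"
      then have "j \<in> {1..n}" "rowof \<nu> j = rowof \<nu> k" using k by auto
      then show "tableau \<nu> (rowof \<nu> k, colof \<nu> j) = j" using tab by metis
    next
      fix j assume "j \<in> {1..<colof \<nu> k}"
      then show "colof \<nu> (tableau \<nu> (rowof \<nu> k, j)) = j" using left by simp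
    qed
    from bij_betw_same_card[OF this] show ?thesis by simp
  qed
  show "card {j \<in> {1..<k}. colof \<nu> j = colof \<nu> k} = rowof \<nu> k - 1" if k: "k \<in> {1..n}" for k
  proof -
    have up: "(i, colof \<nu> k) \<in> boxes \<nu>" if "i \<in> {1..<rowof \<nu> k}" for i
      by (rule boxes_down[OF \<nu> box[OF k]]) (use that in auto)
    have "bij_betw (rowof \<nu>) {j \<in> {1..<k}. colof \<nu> j = colof \<nu> k} {1..<rowof \<nu> k}"
    proof (rule bij_betwI[where g = "\<lambda>i. tableau \<nu> (i, colof \<nu> k)"])
      show "rowof \<nu> \<in> {j \<in> {1..<k}. colof \<nu> j = colof \<nu> k} \<rightarrow> {1..<rowof \<nu> k}"
        using row_less[OF _ k] pos k by auto
      show "(\<lambda>i. tableau \<nu> (i, colof \<nu> k)) \<in> {1..<rowof \<nu> k} \<rightarrow> {j \<in> {1..<k}. colof \<nu> j = colof \<nu> k}"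
      proof
        fix i assume i: "i \<in> {1..<rowof \<nu> k}"
        have "tableau \<nu> (i, colof \<nu> k) < tableau \<nu> (rowof \<nu> k, colof \<nu> k)"
          by (rule tableau_less[OF up[OF i] box[OF k]]) (use i in simp)
        then show "tableau \<nu> (i, colof \<nu> k) \<in> {j \<in> {1..<k}. colof \<nu> j = colof \<nu> k}"
          using tab[OF k] up[OF i] tableau_in[OF s up[OF i]] by simp
      qed
    next
      fix j assume "j \<in> {j \<in> {1..<k}. colof \<nu> j = colof \<nu> k}"
      then have "j \<in> {1..n}" "colof \<nu> j = colof \<nu> k" using k by auto
      then show "tableau \<nu> (rowof \<nu> j, colof \<nu> k) = j" using tab by metis
    next
      fix i assume "i \<in> {1..<rowof \<nu> k}"
      then show "rowof \<nu> (tableau \<nu> (i, colof \<nu> k)) = i" using up by simp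
    qed
    from bij_betw_same_card[OF this] show ?thesis by simp
  qed
  show "\<exists>d\<in>{1..<k}. rowof \<nu> d = rowof \<nu> b \<and> colof \<nu> d = colof \<nu> a"
    if k: "k \<in> {1..n}" and a: "a \<in> {1..<k}" "rowof \<nu> a = rowof \<nu> k" and b: "b \<in> {1..<k}" "colof \<nu> b = colof \<nu> k"
    for k a b
  proof -
    have in': "a \<in> {1..n}" "b \<in> {1..n}" using a b k by auto
    \<comment> \<open>\<open>a\<close> precedes \<open>k\<close> in its row, so its column is to the
      left of the column shared by \<open>k\<close> and \<open>b\<close>. The required box thus lies
      in the row of \<open>b\<close>, to the left of \<open>b\<close>.\<close>
    have ca: "colof \<nu> a < colof \<nu> b" using col_less[OF in'(1) k a(2)] a(1) b(2) by simp
    have d: "(rowof \<nu> b, colof \<nu> a) \<in> boxes \<nu>"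
      by (rule boxes_left[OF box[OF in'(2)]]) (use ca pos[OF in'(1)] in auto)
    have "tableau \<nu> (rowof \<nu> b, colof \<nu> a) < tableau \<nu> (rowof \<nu> b, colof \<nu> b)"
      using ca by (simp add: tableau_same_row)
    then have "tableau \<nu> (rowof \<nu> b, colof \<nu> a) \<in> {1..<k}"
      using tab[OF in'(2)] tableau_in[OF s d] b(1) by simp
    with d show ?thesis by (intro bexI[of _ "tableau \<nu> (rowof \<nu> b, colof \<nu> a)"]) simp_all
  qed
qed

lemma double_partition: "\<nu> \<in> partitions n \<Longrightarrow> map ((*) 2) \<nu> \<in> partitions (2 * n)"
  by (auto simp: partitions_def sorted_wrt_map sum_list_const_mult)

text \<open>Doubling the parts doubles the partial sums, so the box of domino \<open>k\<close>
  becomes two adjacent boxes, numbered \<open>2 * k - 1\<close> and \<open>2 * k\<close>.\<close>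

lemma double_cell:
  assumes \<nu>: "\<nu> \<in> partitions n" and x: "x \<in> {1..2 * n}"
  shows "rowof (map ((*) 2) \<nu>) x = rowof \<nu> (domino x)"
    and "colof (map ((*) 2) \<nu>) x = 2 * colof \<nu> (domino x) - (if odd x then 1 else 0)"
proof -
  have s: "sum_list \<nu> = n" using \<nu> by (simp add: partitions_def)
  let ?i = "rowof \<nu> (domino x)" and ?j = "colof \<nu> (domino x)"
  let ?j' = "2 * ?j - (if odd x then 1 else 0)"
  have b: "(?i, ?j) \<in> boxes \<nu>" by (rule cell_in_boxes[OF s domino_mem[OF x]])
  then have b': "(?i, ?j') \<in> boxes (map ((*) 2) \<nu>)" by (auto simp: boxes_def)
  have "tableau \<nu> (?i, ?j) = domino x" by (rule tableau_cell[OF s domino_mem[OF x]])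
  then have "sum_list (take (?i - 1) \<nu>) + ?j = domino x" by (simp add: tableau_def)
  moreover have "tableau (map ((*) 2) \<nu>) (?i, ?j') = 2 * sum_list (take (?i - 1) \<nu>) + ?j'"
    by (simp add: tableau_def take_map sum_list_const_mult)
  moreover have "?j \<ge> 1" using b by (simp add: boxes_def)
  moreover have "x = 2 * domino x - (if odd x then 1 else 0)" by (auto simp: domino_def elim: oddE)
  ultimately have "tableau (map ((*) 2) \<nu>) (?i, ?j') = x" by auto
  with rowof_tableau[OF b'] colof_tableau[OF b']
  show "rowof (map ((*) 2) \<nu>) x = ?i" "colof (map ((*) 2) \<nu>) x = ?j'" by simp_all
qed

lemma row_group_double:
  assumes \<nu>: "\<nu> \<in> partitions n"
  shows "row_group (2 * n) (map ((*) 2) \<nu>) = label_group (2 * n) (\<lambda>x. rowof \<nu> (domino x))"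
proof -
  have s: "sum_list (map ((*) 2) \<nu>) = 2 * n" using double_partition[OF \<nu>] by (simp add: partitions_def)
  show ?thesis
    unfolding row_group_label[OF s] label_group_def
    by (intro Collect_cong conj_cong refl ball_cong) (metis double_cell(1)[OF \<nu>] symgrp_mem_iff)
qed

text \<open>Columns \<open>2 * j - 1\<close> and \<open>2 * j\<close> of the doubled diagram hold
  the left and the right halves of column \<open>j\<close>, so the column in the doubled diagram
  determines both labels.\<close>

lemma col_group_double:
  assumes \<nu>: "\<nu> \<in> partitions n" and q: "q \<in> col_group (2 * n) (map ((*) 2) \<nu>)"
  shows "q \<in> label_group (2 * n) (\<lambda>x. (colof \<nu> (domino x), even x))"
proof -
  have s: "sum_list (map ((*) 2) \<nu>) = 2 * n" using double_partition[OF \<nu>] by (simp add: partitions_def)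
  have s': "sum_list \<nu> = n" using \<nu> by (simp add: partitions_def)
  have qS: "q \<in> symgrp (2 * n)" by (rule col_group_symgrp[OF q])
  have "(colof \<nu> (domino (q x)), even (q x)) = (colof \<nu> (domino x), even x)" if x: "x \<in> {1..2 * n}" for x
  proof -
    have qx: "q x \<in> {1..2 * n}" using x symgrp_mem_iff[OF qS] by blast
    have "colof (map ((*) 2) \<nu>) (q x) = colof (map ((*) 2) \<nu>) x"
      using q x by (simp add: col_group_label[OF s] label_group_def)
    then have eq: "2 * colof \<nu> (domino (q x)) - (if odd (q x) then 1 else 0) = 2 * colof \<nu> (domino x) - (if odd x then 1 else 0)"
      unfolding double_cell(2)[OF \<nu> x] double_cell(2)[OF \<nu> qx] .
    have "1 \<le> colof \<nu> (domino x)" "1 \<le> colof \<nu> (domino (q x))"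
      using cell_in_boxes[OF s' domino_mem[OF x]] cell_in_boxes[OF s' domino_mem[OF qx]] by (simp_all add: boxes_def)
    with eq show ?thesis by (auto split: if_splits) presburger+
  qed
  with qS show ?thesis by (simp add: label_group_def)
qed

lemma content_prod_eq:
  assumes \<nu>: "\<nu> \<in> partitions n"
  shows "content_prod \<tau> \<nu> = (\<Prod>k=1..n. of_nat \<tau> + 2 * of_nat (colof \<nu> k) - 1 - of_nat (rowof \<nu> k))"
proof -
  have s: "sum_list \<nu> = n" using \<nu> by (simp add: partitions_def)
  have "(\<Prod>k\<in>{1..n}. of_nat \<tau> + 2 * of_nat (colof \<nu> k) - 1 - of_nat (rowof \<nu> k)) =
      (\<Prod>b\<in>boxes \<nu>. of_nat \<tau> + 2 * of_nat (colof \<nu> (tableau \<nu> b)) - 1 - of_nat (rowof \<nu> (tableau \<nu> b)) :: complex)"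
    by (rule prod.reindex_bij_betw[OF bij_betw_tableau[OF s], symmetric])
  also have "\<dots> = content_prod \<tau> \<nu>"
    unfolding content_prod_def by (intro prod.cong refl) auto
  finally show ?thesis by simp
qed

section \<open>The spectral decomposition of the Gram matrix\<close>

lemma mmult_on_cong:
  assumes "\<And>k. k \<in> I \<Longrightarrow> A i k = A' i k" "\<And>k. k \<in> I \<Longrightarrow> B k j = B' k j"
  shows "mmult_on I A B i j = mmult_on I A' B' i j"
  unfolding mmult_on_def by (intro sum.cong refl) (simp add: assms)

text \<open>The value of a kernel between two vectors on pairings. The left one, the sum of the
  row-preserving pairings, is fixed by the row group of the doubled diagram; the right one, the
  signed sum of images of the base pairing, is multiplied by the sign under its column
  group.\<close>

definition young_form :: "nat \<Rightarrow> nat list \<Rightarrow> pmat \<Rightarrow> complex"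
  where "young_form n \<nu> K = (\<Sum>\<pi>\<in>row_pairings n (rowof \<nu>). \<Sum>r\<in>odd_group n (colof \<nu>).
    of_int (sign r) * K \<pi> (pconj r (base_pairing n)))"

lemma young_form_cong:
  assumes "\<And>\<pi> \<sigma>. \<pi> \<in> pairings n \<Longrightarrow> \<sigma> \<in> pairings n \<Longrightarrow> K \<pi> \<sigma> = L \<pi> \<sigma>"
  shows "young_form n \<nu> K = young_form n \<nu> L"
  unfolding young_form_def
  by (intro sum.cong refl) (simp add: assms row_pairings_in pconj_in[OF odd_groupD(1) base_pairing_in])

lemma young_form_scale: "young_form n \<nu> (\<lambda>\<pi> \<sigma>. c * K \<pi> \<sigma>) = c * young_form n \<nu> K"
  by (simp add: young_form_def sum_distrib_left mult.left_commute)

lemma sum_row_sum: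
  assumes s: "sum_list \<mu> = m"
  shows "(\<Sum>\<rho>\<in>symgrp m. row_sum m \<mu> \<rho> * F \<rho>) = (\<Sum>p\<in>row_group m \<mu>. F p)"
proof -
  have "(\<Sum>\<rho>\<in>symgrp m. row_sum m \<mu> \<rho> * F \<rho>) = (\<Sum>\<rho>\<in>symgrp m. if \<rho> \<in> row_group m \<mu> then F \<rho> else 0)"
    by (intro sum.cong) (auto simp: row_sum_apply[OF s])
  also have "\<dots> = (\<Sum>p\<in>row_group m \<mu>. F p)"
    by (rule sum.mono_neutral_cong_right) (auto simp: finite_symgrp row_group_symgrp)
  finally show ?thesis .
qed

lemma sum_col_sum:
  assumes s: "sum_list \<mu> = m"
  shows "(\<Sum>\<rho>\<in>symgrp m. col_sum m \<mu> \<rho> * F \<rho>) = (\<Sum>q\<in>col_group m \<mu>. of_int (sign q) * F q)"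
proof -
  have "(\<Sum>\<rho>\<in>symgrp m. col_sum m \<mu> \<rho> * F \<rho>) = (\<Sum>\<rho>\<in>symgrp m. if \<rho> \<in> col_group m \<mu> then of_int (sign \<rho>) * F \<rho> else 0)"
    by (intro sum.cong) (auto simp: col_sum_apply[OF s])
  also have "\<dots> = (\<Sum>q\<in>col_group m \<mu>. of_int (sign q) * F q)"
    by (rule sum.mono_neutral_cong_right) (auto simp: finite_symgrp col_group_symgrp)
  finally show ?thesis .
qed

context
  fixes n :: nat and \<nu> :: "nat list"
  assumes \<nu>: "\<nu> \<in> partitions n"
begin

abbreviation (input) "dbl \<equiv> map ((*) 2) \<nu>"

lemma sum_list_dbl: "sum_list dbl = 2 * n"
  using double_partition[OF \<nu>] by (simp add: partitions_def)

text \<open>Each element of the row group permutes the row-preserving pairings, so each summand of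
  the row sum contributes the same value.\<close>

lemma young_form_row_sum:
  "young_form n \<nu> (mmult_on (pairings n) (act_mat n (row_sum (2 * n) dbl)) K) =
    of_nat (card (row_group (2 * n) dbl)) * young_form n \<nu> K"
proof -
  let ?F = "\<lambda>\<pi>. \<Sum>r\<in>odd_group n (colof \<nu>). of_int (sign r) * K \<pi> (pconj r (base_pairing n))"
  have "young_form n \<nu> (mmult_on (pairings n) (act_mat n (row_sum (2 * n) dbl)) K) =
      (\<Sum>\<pi>\<in>row_pairings n (rowof \<nu>). \<Sum>r\<in>odd_group n (colof \<nu>). \<Sum>p\<in>row_group (2 * n) dbl.
        of_int (sign r) * K (pconj (inv p) \<pi>) (pconj r (base_pairing n)))"
    unfolding young_form_def
    by (intro sum.cong refl)
      (simp add: mmult_act_left[OF row_pairings_in] sum_row_sum[OF sum_list_dbl] sum_distrib_left)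
  also have "\<dots> = (\<Sum>\<pi>\<in>row_pairings n (rowof \<nu>). \<Sum>p\<in>row_group (2 * n) dbl. ?F (pconj (inv p) \<pi>))"
    by (rule sum.cong[OF refl], rule sum.swap)
  also have "\<dots> = (\<Sum>p\<in>row_group (2 * n) dbl. \<Sum>\<pi>\<in>row_pairings n (rowof \<nu>). ?F (pconj (inv p) \<pi>))"
    by (rule sum.swap)
  also have "\<dots> = (\<Sum>p\<in>row_group (2 * n) dbl. young_form n \<nu> K)"
    unfolding young_form_def row_group_double[OF \<nu>]
    by (rule sum.cong[OF refl], rule sum_row_pairings_pconj) (rule label_group_inv)
  finally show ?thesis by simp
qed

text \<open>The sign in the column sum cancels against the sign that \<open>q\<close> produces on
  the antisymmetrized base pairing.\<close>

lemma young_form_col_sum: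
  "young_form n \<nu> (mmult_on (pairings n) K (act_mat n (col_sum (2 * n) dbl))) =
    of_nat (card (col_group (2 * n) dbl)) * young_form n \<nu> K"
proof -
  let ?b = "base_pairing n"
  have "young_form n \<nu> (mmult_on (pairings n) K (act_mat n (col_sum (2 * n) dbl))) =
      (\<Sum>\<pi>\<in>row_pairings n (rowof \<nu>). \<Sum>r\<in>odd_group n (colof \<nu>). \<Sum>q\<in>col_group (2 * n) dbl.
        of_int (sign q) * (of_int (sign r) * K \<pi> (pconj q (pconj r ?b))))"
    unfolding young_form_def
    by (intro sum.cong refl)
      (simp add: mmult_act_right[OF pconj_in[OF odd_groupD(1) base_pairing_in]] sum_col_sum[OF sum_list_dbl]
        sum_distrib_left mult.left_commute)
  also have "\<dots> = (\<Sum>\<pi>\<in>row_pairings n (rowof \<nu>). \<Sum>q\<in>col_group (2 * n) dbl. of_int (sign q) *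
      (\<Sum>r\<in>odd_group n (colof \<nu>). of_int (sign r) * K \<pi> (pconj q (pconj r ?b))))"
    unfolding sum_distrib_left by (rule sum.cong[OF refl], rule sum.swap)
  also have "\<dots> = (\<Sum>\<pi>\<in>row_pairings n (rowof \<nu>). \<Sum>q\<in>col_group (2 * n) dbl.
      (\<Sum>r\<in>odd_group n (colof \<nu>). of_int (sign r) * K \<pi> (pconj r ?b)))"
    by (rule sum.cong[OF refl], rule sum.cong[OF refl])
      (simp only: odd_group_antisym[OF col_group_double[OF \<nu>]] sign_mult_self)
  also have "\<dots> = of_nat (card (col_group (2 * n) dbl)) * young_form n \<nu> K"
    by (simp add: young_form_def sum_distrib_left)
  finally show ?thesis .
qed

text \<open>Invariance lets \<open>K\<close> pass the row sum, which then acts on the left vector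
  while the column sum acts on the right one.\<close>

lemma young_form_young_symmetrizer:
  assumes K: "invariant_kernel n K"
  shows "young_form n \<nu> (mmult_on (pairings n) K (act_mat n (young_symmetrizer (2 * n) dbl))) =
    of_nat (card (row_group (2 * n) dbl)) * of_nat (card (col_group (2 * n) dbl)) * young_form n \<nu> K"
proof -
  let ?B = "pairings n"
  let ?a = "act_mat n (row_sum (2 * n) dbl)" and ?b = "act_mat n (col_sum (2 * n) dbl)"
  have "mmult_on ?B K (act_mat n (young_symmetrizer (2 * n) dbl)) \<pi> \<sigma> = mmult_on ?B ?a (mmult_on ?B K ?b) \<pi> \<sigma>"
    if "\<pi> \<in> ?B" "\<sigma> \<in> ?B" for \<pi> \<sigma>
  proof -
    have "mmult_on ?B K (act_mat n (young_symmetrizer (2 * n) dbl)) \<pi> \<sigma> = mmult_on ?B K (mmult_on ?B ?a ?b) \<pi> \<sigma>"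
      by (rule mmult_on_cong) (simp_all add: young_symmetrizer_eq act_mat_gmult that)
    also have "\<dots> = mmult_on ?B (mmult_on ?B K ?a) ?b \<pi> \<sigma>" by (simp only: mmult_on_assoc)
    also have "\<dots> = mmult_on ?B (mmult_on ?B ?a K) ?b \<pi> \<sigma>"
      by (rule mmult_on_cong) (simp_all add: invariant_kernel_commute[OF K _ that(1)])
    finally show ?thesis by (simp only: mmult_on_assoc)
  qed
  then have "young_form n \<nu> (mmult_on ?B K (act_mat n (young_symmetrizer (2 * n) dbl))) =
      young_form n \<nu> (mmult_on ?B ?a (mmult_on ?B K ?b))"
    by (rule young_form_cong)
  then show ?thesis by (simp add: young_form_row_sum young_form_col_sum)
qed

text \<open>Only \<open>r = id\<close> carries the base pairing to a row-preserving one, so a single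
  term remains.\<close>

lemma young_form_identity: "young_form n \<nu> (\<lambda>\<pi> \<sigma>. if \<pi> = \<sigma> then 1 else 0) = 1"
proof -
  interpret domino_filling n "rowof \<nu>" "colof \<nu>" by (rule domino_filling_tableau[OF \<nu>])
  let ?b = "base_pairing n"
  have b: "?b \<in> row_pairings n (rowof \<nu>)"
    using base_pairing_in base_pairing_domino(1) by (simp add: row_pairings_def)
  have fin: "finite (row_pairings n (rowof \<nu>))"
    by (rule finite_subset[OF _ finite_pairings]) (auto simp: row_pairings_def)
  have "young_form n \<nu> (\<lambda>\<pi> \<sigma>. if \<pi> = \<sigma> then 1 else 0) =
      (\<Sum>r\<in>odd_group n (colof \<nu>). \<Sum>\<pi>\<in>row_pairings n (rowof \<nu>). if \<pi> = pconj r ?b then of_int (sign r) else 0)"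
    unfolding young_form_def by (subst sum.swap) (intro sum.cong refl, simp)
  also have "\<dots> = (\<Sum>r\<in>odd_group n (colof \<nu>). if pconj r ?b \<in> row_pairings n (rowof \<nu>) then of_int (sign r) else 0)"
    by (simp add: fin)
  also have "\<dots> = (\<Sum>r\<in>odd_group n (colof \<nu>). if r = id then 1 else 0)"
    using row_odd_disjoint[of n] b by (intro sum.cong refl) (auto simp: sign_id)
  also have "\<dots> = 1" by (simp add: odd_group_def label_group_id)
  finally show ?thesis .
qed

lemma young_form_gram:
  assumes "\<tau> \<ge> 1"
  shows "young_form n \<nu> (gram n \<tau>) = content_prod \<tau> \<nu>"
proof -
  interpret domino_filling n "rowof \<nu>" "colof \<nu>" by (rule domino_filling_tableau[OF \<nu>])
  have "young_form n \<nu> (gram n \<tau>) = young_gram \<tau> n"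
    unfolding young_form_def young_gram_def
    by (intro sum.cong refl)
      (simp add: gram_eq_colourings[OF row_pairings_in pconj_in[OF odd_groupD(1) base_pairing_in] assms])
  then show ?thesis by (simp add: young_gram_eq content_prod_eq[OF \<nu>])
qed

lemma card_groups_neq_0:
  "of_nat (card (row_group (2 * n) dbl)) * of_nat (card (col_group (2 * n) dbl)) \<noteq> (0 :: complex)"
proof -
  have "id \<in> row_group (2 * n) dbl" "id \<in> col_group (2 * n) dbl"
    by (simp_all add: row_group_label[OF sum_list_dbl] col_group_label[OF sum_list_dbl] label_group_id)
  then show ?thesis by (auto simp: card_eq_0_iff)
qed

end

lemma invariant_kernel_identity: "invariant_kernel n (\<lambda>\<pi> \<sigma>. if \<pi> = \<sigma> then 1 else 0)"
  unfolding invariant_kernel_def using pconj_inv_cancel(1) by metis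

lemma invariant_kernel_gram:
  assumes "\<tau> \<ge> 1"
  shows "invariant_kernel n (gram n \<tau>)"
  unfolding invariant_kernel_def
  by (simp add: gram_eq_colourings[OF _ _ assms] pconj_in colourings_pconj)

abbreviation zonal_idempotent :: "nat \<Rightarrow> nat list \<Rightarrow> galg"
  where "zonal_idempotent n \<nu> \<equiv> central_idempotent (2 * n) (map ((*) 2) \<nu>)"

text \<open>The case of the identity kernel. The value is nonzero, so the Young symmetrizer of a
  doubled shape does not annihilate the pairings.\<close>

lemma young_form_young_symmetrizer_identity:
  assumes \<nu>: "\<nu> \<in> partitions n"
  shows "young_form n \<nu> (act_mat n (young_symmetrizer (2 * n) (map ((*) 2) \<nu>))) =
    of_nat (card (row_group (2 * n) (map ((*) 2) \<nu>))) * of_nat (card (col_group (2 * n) (map ((*) 2) \<nu>)))"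
proof -
  have "mmult_on (pairings n) (\<lambda>\<pi> \<sigma>. if \<pi> = \<sigma> then 1 else 0) M \<pi> \<sigma> = M \<pi> \<sigma>" if "\<pi> \<in> pairings n" for M \<pi> \<sigma>
  proof -
    have "mmult_on (pairings n) (\<lambda>\<pi> \<sigma>. if \<pi> = \<sigma> then 1 else 0) M \<pi> \<sigma> = (\<Sum>\<kappa>\<in>pairings n. if \<kappa> = \<pi> then M \<kappa> \<sigma> else 0)"
      unfolding mmult_on_def by (intro sum.cong) auto
    with that show ?thesis by (simp add: finite_pairings)
  qed
  then have "young_form n \<nu> (act_mat n (young_symmetrizer (2 * n) (map ((*) 2) \<nu>))) =
      young_form n \<nu> (mmult_on (pairings n) (\<lambda>\<pi> \<sigma>. if \<pi> = \<sigma> then 1 else 0)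
        (act_mat n (young_symmetrizer (2 * n) (map ((*) 2) \<nu>))))"
    by (intro young_form_cong) simp
  also have "\<dots> = of_nat (card (row_group (2 * n) (map ((*) 2) \<nu>))) * of_nat (card (col_group (2 * n) (map ((*) 2) \<nu>)))"
    by (simp only: young_form_young_symmetrizer[OF \<nu> invariant_kernel_identity] young_form_identity[OF \<nu>] mult_1_right)
  finally show ?thesis .
qed

text \<open>The Young symmetrizer equals its own idempotent times itself, so orthogonality of
  idempotents handles different shapes.\<close>

lemma zonal_idempotent_young:
  assumes \<nu>: "\<nu> \<in> partitions n" and \<rho>: "\<rho> \<in> partitions n"
  shows "gmult (2 * n) (zonal_idempotent n \<rho>) (young_symmetrizer (2 * n) (map ((*) 2) \<nu>)) =
    (if \<rho> = \<nu> then young_symmetrizer (2 * n) (map ((*) 2) \<nu>) else 0)"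
proof (cases "\<rho> = \<nu>")
  case True
  then show ?thesis using central_idempotent_times_young[OF double_partition[OF \<nu>]] by simp
next
  case False
  then have "map ((*) 2) \<rho> \<noteq> map ((*) 2) \<nu>"
    by (auto simp: inj_map_eq_map inj_def)
  then have "gmult (2 * n) (zonal_idempotent n \<rho>) (zonal_idempotent n \<nu>) = 0"
    by (rule central_idempotent_orthogonal[OF double_partition[OF \<rho>] double_partition[OF \<nu>]])
  then have "gmult (2 * n) (gmult (2 * n) (zonal_idempotent n \<rho>) (zonal_idempotent n \<nu>))
      (young_symmetrizer (2 * n) (map ((*) 2) \<nu>)) = 0" by simp
  with False show ?thesis
    by (simp add: gmult_assoc central_idempotent_times_young[OF double_partition[OF \<nu>]])
qed

lemma zonal_idempotent_mult:
  assumes \<nu>: "\<nu> \<in> partitions n" and \<rho>: "\<rho> \<in> partitions n"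
  shows "gmult (2 * n) (zonal_idempotent n \<nu>) (zonal_idempotent n \<rho>) = (if \<nu> = \<rho> then zonal_idempotent n \<nu> else 0)"
proof (cases "\<nu> = \<rho>")
  case True
  then show ?thesis using central_idempotent_idem[OF double_partition[OF \<nu>]] by simp
next
  case False
  then have "map ((*) 2) \<nu> \<noteq> map ((*) 2) \<rho>"
    by (auto simp: inj_map_eq_map inj_def)
  with False show ?thesis
    using central_idempotent_orthogonal[OF double_partition[OF \<nu>] double_partition[OF \<rho>]] by simp
qed

text \<open>The scalars of the expansion are identified by multiplying with the Young symmetrizer of
  one doubled shape, where only one idempotent survives, and evaluating
  \<open>young_form\<close>.\<close>

lemma gram_spectral:
  assumes \<tau>: "\<tau> \<ge> 1" and \<alpha>: "\<alpha> \<in> pairings n" and \<beta>: "\<beta> \<in> pairings n"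
  shows "gram n \<tau> \<alpha> \<beta> = (\<Sum>\<nu>\<in>partitions n. content_prod \<tau> \<nu> * act_mat n (zonal_idempotent n \<nu>) \<alpha> \<beta>)"
proof -
  let ?B = "pairings n"
  let ?C = "\<lambda>\<nu>. young_symmetrizer (2 * n) (map ((*) 2) \<nu>)"
  have inv: "invariant_kernel n (act_mat n (zonal_idempotent n \<nu>))" if "\<nu> \<in> partitions n" for \<nu>
    by (rule invariant_kernel_act_mat)
      (simp_all add: central_idempotent_in[OF double_partition[OF that]] central_idempotent_central[OF double_partition[OF that]])
  have mult: "mmult_on ?B (act_mat n (zonal_idempotent n \<rho>)) (act_mat n (?C \<nu>)) \<alpha> \<beta> =
      (if \<rho> = \<nu> then act_mat n (?C \<nu>) \<alpha> \<beta> else 0)"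
    if "\<nu> \<in> partitions n" "\<rho> \<in> partitions n" "\<beta> \<in> ?B" for \<nu> \<rho> \<alpha> \<beta>
    using that by (simp add: act_mat_gmult[symmetric] zonal_idempotent_young)
  \<comment> \<open>If the idempotent acted as zero, so would the Young symmetrizer that it fixes,
    against the value of the latter under \<open>young_form\<close>.\<close>
  have nz: "\<exists>\<alpha>\<in>?B. \<exists>\<beta>\<in>?B. act_mat n (zonal_idempotent n \<nu>) \<alpha> \<beta> \<noteq> 0" if \<nu>: "\<nu> \<in> partitions n" for \<nu>
  proof (rule ccontr)
    assume "\<not> (\<exists>\<alpha>\<in>?B. \<exists>\<beta>\<in>?B. act_mat n (zonal_idempotent n \<nu>) \<alpha> \<beta> \<noteq> 0)"
    then have 0: "act_mat n (zonal_idempotent n \<nu>) \<alpha> \<beta> = 0" if "\<alpha> \<in> ?B" "\<beta> \<in> ?B" for \<alpha> \<beta>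
      using that by blast
    have "act_mat n (?C \<nu>) \<alpha> \<beta> = 0 * 0" if "\<alpha> \<in> ?B" "\<beta> \<in> ?B" for \<alpha> \<beta>
      using mult[OF \<nu> \<nu> that(2), of \<alpha>] 0[OF that(1)] by (simp add: mmult_on_def)
    then have "young_form n \<nu> (act_mat n (?C \<nu>)) = young_form n \<nu> (\<lambda>\<alpha> \<beta>. 0 * 0)"
      by (rule young_form_cong)
    also have "\<dots> = 0" by (simp add: young_form_def)
    finally show False
      using young_form_young_symmetrizer_identity[OF \<nu>] card_groups_neq_0[OF \<nu>] by simp
  qed
  obtain f where f: "\<And>\<alpha> \<beta>. \<alpha> \<in> ?B \<Longrightarrow> \<beta> \<in> ?B \<Longrightarrow>
      gram n \<tau> \<alpha> \<beta> = (\<Sum>\<nu>\<in>partitions n. f \<nu> * act_mat n (zonal_idempotent n \<nu>) \<alpha> \<beta>)"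
    by (rule invariant_kernel_span[of n "zonal_idempotent n" "gram n \<tau>"])
      (auto simp: inv zonal_idempotent_mult intro: nz invariant_kernel_gram[OF \<tau>])
  have "f \<nu> = content_prod \<tau> \<nu>" if \<nu>: "\<nu> \<in> partitions n" for \<nu>
  proof -
    let ?c = "of_nat (card (row_group (2 * n) (map ((*) 2) \<nu>))) * of_nat (card (col_group (2 * n) (map ((*) 2) \<nu>))) :: complex"
    have "mmult_on ?B (gram n \<tau>) (act_mat n (?C \<nu>)) \<pi> \<sigma> = f \<nu> * act_mat n (?C \<nu>) \<pi> \<sigma>"
      if "\<pi> \<in> ?B" "\<sigma> \<in> ?B" for \<pi> \<sigma>
    proof -
      have "mmult_on ?B (gram n \<tau>) (act_mat n (?C \<nu>)) \<pi> \<sigma> =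
          (\<Sum>\<kappa>\<in>?B. (\<Sum>\<rho>\<in>partitions n. f \<rho> * act_mat n (zonal_idempotent n \<rho>) \<pi> \<kappa>) * act_mat n (?C \<nu>) \<kappa> \<sigma>)"
        unfolding mmult_on_def by (intro sum.cong refl) (simp add: f that)
      also have "\<dots> = (\<Sum>\<rho>\<in>partitions n. f \<rho> * mmult_on ?B (act_mat n (zonal_idempotent n \<rho>)) (act_mat n (?C \<nu>)) \<pi> \<sigma>)"
        unfolding mmult_on_def sum_distrib_left sum_distrib_right mult.assoc by (rule sum.swap)
      also have "\<dots> = (\<Sum>\<rho>\<in>partitions n. if \<rho> = \<nu> then f \<nu> * act_mat n (?C \<nu>) \<pi> \<sigma> else 0)"
        using \<nu> that by (intro sum.cong refl) (simp add: mult)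
      also have "\<dots> = f \<nu> * act_mat n (?C \<nu>) \<pi> \<sigma>" using \<nu> by (simp add: finite_partitions)
      finally show ?thesis .
    qed
    then have "young_form n \<nu> (mmult_on ?B (gram n \<tau>) (act_mat n (?C \<nu>))) = young_form n \<nu> (\<lambda>\<pi> \<sigma>. f \<nu> * act_mat n (?C \<nu>) \<pi> \<sigma>)"
      by (rule young_form_cong)
    \<comment> \<open>Two evaluations of the same form: through the invariance of the Gram matrix
      and through its expansion in idempotents.\<close>
    then have "?c * content_prod \<tau> \<nu> = f \<nu> * ?c"
      by (simp only: young_form_young_symmetrizer[OF \<nu> invariant_kernel_gram[OF \<tau>]] young_form_gram[OF \<nu> \<tau>]
          young_form_scale young_form_young_symmetrizer_identity[OF \<nu>])
    then have "?c * content_prod \<tau> \<nu> = ?c * f \<nu>" by (simp only: mult.commute[of "f \<nu>"])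
    then show ?thesis by (rule mult_left_cancel[OF card_groups_neq_0[OF \<nu>], THEN iffD1, symmetric])
  qed
  then show ?thesis by (simp add: f[OF \<alpha> \<beta>])
qed

section \<open>The Weingarten matrix\<close>

text \<open>A functional calculus: products of such matrices correspond to pointwise products of
  \<open>h\<close>. Entries off the pairings are 0, matching the normalization in
  \<open>weingarten_matrix\<close>.\<close>

definition spectral_mat :: "nat \<Rightarrow> (nat list \<Rightarrow> complex) \<Rightarrow> pmat"
  where "spectral_mat n h \<alpha> \<beta> = (if \<alpha> \<in> pairings n \<and> \<beta> \<in> pairings n
    then (\<Sum>\<nu>\<in>partitions n. h \<nu> * act_mat n (zonal_idempotent n \<nu>) \<alpha> \<beta>) else 0)"

lemma spectral_mat_mult:
  "mmult_on (pairings n) (spectral_mat n h) (spectral_mat n k) = spectral_mat n (\<lambda>\<nu>. h \<nu> * k \<nu>)"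
proof (intro ext)
  fix \<alpha> \<beta>
  let ?B = "pairings n" and ?P = "\<lambda>\<nu>. act_mat n (zonal_idempotent n \<nu>)"
  show "mmult_on ?B (spectral_mat n h) (spectral_mat n k) \<alpha> \<beta> = spectral_mat n (\<lambda>\<nu>. h \<nu> * k \<nu>) \<alpha> \<beta>"
  proof (cases "\<alpha> \<in> ?B \<and> \<beta> \<in> ?B")
    case True
    have "mmult_on ?B (spectral_mat n h) (spectral_mat n k) \<alpha> \<beta> =
        (\<Sum>\<kappa>\<in>?B. \<Sum>\<nu>\<in>partitions n. \<Sum>\<rho>\<in>partitions n. h \<nu> * k \<rho> * (?P \<nu> \<alpha> \<kappa> * ?P \<rho> \<kappa> \<beta>))"
      using True unfolding mmult_on_def
      by (intro sum.cong refl) (simp add: spectral_mat_def sum_product mult_ac)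
    also have "\<dots> = (\<Sum>\<nu>\<in>partitions n. \<Sum>\<kappa>\<in>?B. \<Sum>\<rho>\<in>partitions n. h \<nu> * k \<rho> * (?P \<nu> \<alpha> \<kappa> * ?P \<rho> \<kappa> \<beta>))"
      by (rule sum.swap)
    also have "\<dots> = (\<Sum>\<nu>\<in>partitions n. \<Sum>\<rho>\<in>partitions n. \<Sum>\<kappa>\<in>?B. h \<nu> * k \<rho> * (?P \<nu> \<alpha> \<kappa> * ?P \<rho> \<kappa> \<beta>))"
      by (rule sum.cong[OF refl], rule sum.swap)
    also have "\<dots> = (\<Sum>\<nu>\<in>partitions n. \<Sum>\<rho>\<in>partitions n. if \<rho> = \<nu> then h \<nu> * k \<nu> * ?P \<nu> \<alpha> \<beta> else 0)"
    proof (rule sum.cong[OF refl], rule sum.cong[OF refl])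
      fix \<nu> \<rho> assume "\<nu> \<in> partitions n" "\<rho> \<in> partitions n"
      then have "mmult_on ?B (?P \<nu>) (?P \<rho>) \<alpha> \<beta> = (if \<rho> = \<nu> then ?P \<nu> \<alpha> \<beta> else 0)"
        using True by (auto simp: act_mat_gmult[symmetric] zonal_idempotent_mult)
      then show "(\<Sum>\<kappa>\<in>?B. h \<nu> * k \<rho> * (?P \<nu> \<alpha> \<kappa> * ?P \<rho> \<kappa> \<beta>)) = (if \<rho> = \<nu> then h \<nu> * k \<nu> * ?P \<nu> \<alpha> \<beta> else 0)"
        by (auto simp: mmult_on_def sum_distrib_left[symmetric])
    qed
    also have "\<dots> = spectral_mat n (\<lambda>\<nu>. h \<nu> * k \<nu>) \<alpha> \<beta>"
      using True by (simp add: spectral_mat_def finite_partitions)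
    finally show ?thesis .
  next
    case False
    then show ?thesis by (auto simp: mmult_on_def spectral_mat_def)
  qed
qed

text \<open>Transposition corresponds to the star, which fixes the central idempotents.\<close>

lemma symmetric_spectral_mat: "symmetric_on (pairings n) (spectral_mat n h)"
proof -
  have "act_mat n (zonal_idempotent n \<nu>) \<alpha> \<beta> = act_mat n (zonal_idempotent n \<nu>) \<beta> \<alpha>" if "\<nu> \<in> partitions n" for \<nu> \<alpha> \<beta>
    using act_mat_gstar[of n "zonal_idempotent n \<nu>" \<alpha> \<beta>] gstar_central_idempotent[OF double_partition[OF that]] by simp
  then show ?thesis by (simp add: symmetric_on_def spectral_mat_def)
qed

lemma mmult_on_gram:
  assumes "\<tau> \<ge> 1" "i \<in> pairings n" "j \<in> pairings n"
  shows "mmult_on (pairings n) (gram n \<tau>) M i j = mmult_on (pairings n) (spectral_mat n (content_prod \<tau>)) M i j"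
    and "mmult_on (pairings n) M (gram n \<tau>) i j = mmult_on (pairings n) M (spectral_mat n (content_prod \<tau>)) i j"
  using assms by (auto intro!: mmult_on_cong simp: spectral_mat_def gram_spectral)

text \<open>By multiplicativity the defining equations reduce to scalar identities for each
  eigenvalue, which hold at 0 as well by the convention \<open>inverse 0 = 0\<close>.\<close>

lemma is_pseudo_inverse_spectral_mat:
  assumes \<tau>: "\<tau> \<ge> 1"
  shows "is_pseudo_inverse_on (pairings n) (gram n \<tau>) (spectral_mat n (\<lambda>\<nu>. inverse (content_prod \<tau> \<nu>)))"
proof -
  let ?B = "pairings n" and ?c = "content_prod \<tau>"
  let ?G = "spectral_mat n ?c" and ?W = "spectral_mat n (\<lambda>\<nu>. inverse (?c \<nu>))"
  have GW: "mmult_on ?B (gram n \<tau>) ?W i j = mmult_on ?B ?G ?W i j"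
    and WG: "mmult_on ?B ?W (gram n \<tau>) i j = mmult_on ?B ?W ?G i j" if "i \<in> ?B" "j \<in> ?B" for i j
    by (rule mmult_on_gram[OF \<tau> that])+
  have "c * inverse c * c = c" for c :: complex by (cases "c = 0") simp_all
  then have id: "(\<lambda>\<nu>. ?c \<nu> * inverse (?c \<nu>) * ?c \<nu>) = ?c" by (rule ext)
  have "inverse c * c * inverse c = inverse c" for c :: complex by (cases "c = 0") simp_all
  then have id': "(\<lambda>\<nu>. inverse (?c \<nu>) * ?c \<nu> * inverse (?c \<nu>)) = (\<lambda>\<nu>. inverse (?c \<nu>))" by (rule ext)
  have "mmult_on ?B (mmult_on ?B (gram n \<tau>) ?W) (gram n \<tau>) i j = gram n \<tau> i j" if "i \<in> ?B" "j \<in> ?B" for i j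
  proof -
    have "mmult_on ?B (mmult_on ?B (gram n \<tau>) ?W) (gram n \<tau>) i j = mmult_on ?B (mmult_on ?B (gram n \<tau>) ?W) ?G i j"
      by (rule mmult_on_gram(2)[OF \<tau> that])
    also have "\<dots> = mmult_on ?B (mmult_on ?B ?G ?W) ?G i j"
      by (rule mmult_on_cong) (simp_all add: GW that)
    also have "\<dots> = ?G i j" by (simp only: spectral_mat_mult id)
    also have "\<dots> = gram n \<tau> i j" using gram_spectral[OF \<tau> that] that by (simp add: spectral_mat_def)
    finally show ?thesis .
  qed
  moreover have "mmult_on ?B (mmult_on ?B ?W (gram n \<tau>)) ?W i j = ?W i j" if "i \<in> ?B" "j \<in> ?B" for i j
  proof -
    have "mmult_on ?B (mmult_on ?B ?W (gram n \<tau>)) ?W i j = mmult_on ?B (mmult_on ?B ?W ?G) ?W i j"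
      by (rule mmult_on_cong) (simp_all add: WG that)
    also have "\<dots> = ?W i j" by (simp only: spectral_mat_mult id')
    finally show ?thesis .
  qed
  moreover have "symmetric_on ?B (mmult_on ?B (gram n \<tau>) ?W)" "symmetric_on ?B (mmult_on ?B ?W (gram n \<tau>))"
    using symmetric_spectral_mat[of n] by (simp_all add: symmetric_on_def GW WG spectral_mat_mult)
  ultimately show ?thesis
    by (simp add: is_pseudo_inverse_on_def mat_eq_on_def symmetric_spectral_mat)
qed

lemma symmetric_gram: "\<tau> \<ge> 1 \<Longrightarrow> symmetric_on (pairings n) (gram n \<tau>)"
  by (simp add: symmetric_on_def gram_eq_colourings colourings_commute)

lemma weingarten_matrix_eq:
  assumes \<tau>: "\<tau> \<ge> 1"
  shows "weingarten_matrix n \<tau> = spectral_mat n (\<lambda>\<nu>. inverse (content_prod \<tau> \<nu>))"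
  unfolding weingarten_matrix_def
proof (rule the_equality)
  let ?W = "spectral_mat n (\<lambda>\<nu>. inverse (content_prod \<tau> \<nu>))"
  show W: "is_pseudo_inverse_on (pairings n) (gram n \<tau>) ?W \<and>
      (\<forall>\<pi> \<pi>'. \<pi> \<notin> pairings n \<or> \<pi>' \<notin> pairings n \<longrightarrow> ?W \<pi> \<pi>' = 0)"
    using is_pseudo_inverse_spectral_mat[OF \<tau>] by (auto simp: spectral_mat_def)
  fix V assume V: "is_pseudo_inverse_on (pairings n) (gram n \<tau>) V \<and>
      (\<forall>\<pi> \<pi>'. \<pi> \<notin> pairings n \<or> \<pi>' \<notin> pairings n \<longrightarrow> V \<pi> \<pi>' = 0)"
  then have "mat_eq_on (pairings n) V ?W"
    using is_pseudo_inverse_on_unique[OF symmetric_gram[OF \<tau>]] W by blast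
  with V W show "V = ?W" unfolding mat_eq_on_def by (intro ext) metis
qed

text \<open>Where the content product vanishes the term is 0 because \<open>inverse 0 = 0\<close>,
  so the sum may run over all partitions.\<close>

lemma weingarten_element_eq:
  "weingarten_element n \<tau> = (\<Sum>\<nu>\<in>partitions n. inverse (content_prod \<tau> \<nu>) *\<^sub>C zonal_idempotent n \<nu>)"
  unfolding weingarten_element_def
  by (rule sum.mono_neutral_left) (auto simp: finite_partitions fscale_def)

lemma weingarten_element_central:
  assumes "x \<in> group_algebra (2 * n)"
  shows "gmult (2 * n) x (weingarten_element n \<tau>) = gmult (2 * n) (weingarten_element n \<tau>) x"
  unfolding weingarten_element_eq gmult_sum_left gmult_sum_right gmult_scale_left gmult_scale_right
  by (intro sum.cong refl) (simp add: central_idempotent_central[OF double_partition assms])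

lemma weingarten_matrix_act:
  assumes "\<tau> \<ge> 1" "\<alpha> \<in> pairings n" "\<beta> \<in> pairings n"
  shows "weingarten_matrix n \<tau> \<alpha> \<beta> = act_mat n (weingarten_element n \<tau>) \<alpha> \<beta>"
  using assms by (simp add: weingarten_matrix_eq spectral_mat_def weingarten_element_eq act_mat_sum act_mat_scale)

section \<open>The action in the standard basis\<close>

text \<open>Translating the uniform weight on the hyperoctahedral group by a \<open>g\<close> that
  carries the base pairing to \<open>\<pi>\<close> spreads it over a left coset; such a
  \<open>g\<close> exists because all pairings are conjugate.\<close>

lemma std_basis_apply:
  assumes \<pi>: "\<pi> \<in> pairings n"
  shows "std_basis n \<pi> s =
    (if s \<in> symgrp (2 * n) \<and> pconj s (base_pairing n) = \<pi> then 1 / of_nat (card (hyperoctahedral n)) else 0)"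
proof -
  have fin: "finite (hyperoctahedral n)"
    by (rule finite_subset[OF _ finite_symgrp[of "2 * n"]]) (auto simp: hyperoctahedral_def)
  have hp: "hyper_proj n h = (if h \<in> hyperoctahedral n then 1 / of_nat (card (hyperoctahedral n)) else 0)" for h
    using fin by (simp add: hyper_proj_def fscale_apply fun_sum_apply gelem_apply)
  obtain g where g: "g \<in> symgrp (2 * n)" "\<pi> = g \<circ> base_pairing n \<circ> inv g"
    by (rule pairings_conjugate[OF base_pairing_in \<pi>])
  have \<pi>_g: "pconj g (base_pairing n) = \<pi>" using g by (simp add: pconj_def)
  have "std_basis n \<pi> = gmult (2 * n) (gelem g) (hyper_proj n)"
    using g by (intro std_basis_eq) auto
  moreover have "inv g \<circ> s \<in> hyperoctahedral n \<longleftrightarrow> pconj s (base_pairing n) = \<pi>" if s: "s \<in> symgrp (2 * n)"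
  proof -
    have "inv g \<circ> s \<in> hyperoctahedral n \<longleftrightarrow> pconj (inv g \<circ> s) (base_pairing n) = base_pairing n"
      using g s by (simp add: hyperoctahedral_def pconj_def)
    also have "\<dots> \<longleftrightarrow> pconj (inv g) (pconj s (base_pairing n)) = base_pairing n"
      using g s by (simp add: pconj_comp[of _ "2 * n"])
    also have "\<dots> \<longleftrightarrow> pconj s (base_pairing n) = \<pi>"
      using pconj_eq_iff[OF inv_symgrp[OF g(1)]] \<pi>_g g(1) by simp
    finally show ?thesis .
  qed
  ultimately show ?thesis using g by (simp add: gmult_gelem_left hp)
qed

lemma std_basis_in: "std_basis n \<pi> \<in> group_algebra (2 * n)"
  by (simp add: std_basis_def)

text \<open>The coefficient at \<open>s\<close> depends only on the pairing that \<open>s\<close>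
  makes of the base pairing: \<open>inv \<rho> \<circ> s\<close> lies in the coset of
  \<open>\<pi>\<close> exactly when \<open>\<rho>\<close> carries \<open>\<pi>\<close> to that
  pairing.\<close>

lemma is_matrix_of_act_mat: "is_matrix_of n (gmult (2 * n) x) (act_mat n x)"
  unfolding is_matrix_of_def
proof (intro ballI group_algebra_eqI)
  let ?b = "base_pairing n" and ?H = "of_nat (card (hyperoctahedral n)) :: complex"
  fix \<pi> assume \<pi>: "\<pi> \<in> pairings n"
  show "(\<Sum>\<pi>'\<in>pairings n. act_mat n x \<pi>' \<pi> *\<^sub>C std_basis n \<pi>') \<in> group_algebra (2 * n)"
    by (intro sum_in_group_algebra scale_in_group_algebra std_basis_in)
  fix s assume s: "s \<in> symgrp (2 * n)"
  have sb: "pconj s ?b \<in> pairings n" by (rule pconj_in[OF s base_pairing_in])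
  have "gmult (2 * n) x (std_basis n \<pi>) s = (\<Sum>\<rho>\<in>symgrp (2 * n). (if pconj \<rho> \<pi> = pconj s ?b then x \<rho> else 0) / ?H)"
  proof -
    have "x \<rho> * std_basis n \<pi> (inv \<rho> \<circ> s) = (if pconj \<rho> \<pi> = pconj s ?b then x \<rho> else 0) / ?H"
      if \<rho>: "\<rho> \<in> symgrp (2 * n)" for \<rho>
    proof -
      have "pconj (inv \<rho> \<circ> s) ?b = \<pi> \<longleftrightarrow> pconj \<rho> \<pi> = pconj s ?b"
        using pconj_eq_iff[OF \<rho>, of \<pi> "pconj s ?b"] \<rho> s by (auto simp: pconj_comp[of _ "2 * n"])
      with \<rho> s show ?thesis by (simp add: std_basis_apply[OF \<pi>])
    qed
    then show ?thesis using s by (simp add: gmult_apply)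
  qed
  also have "\<dots> = act_mat n x (pconj s ?b) \<pi> / ?H"
    by (simp add: act_mat_def sum_divide_distrib)
  also have "\<dots> = (\<Sum>\<pi>'\<in>pairings n. if \<pi>' = pconj s ?b then act_mat n x \<pi>' \<pi> / ?H else 0)"
    using sb by (simp add: finite_pairings)
  also have "\<dots> = (\<Sum>\<pi>'\<in>pairings n. act_mat n x \<pi>' \<pi> *\<^sub>C std_basis n \<pi>') s"
    unfolding fun_sum_apply using s by (intro sum.cong refl) (auto simp: fscale_apply std_basis_apply)
  finally show "gmult (2 * n) x (std_basis n \<pi>) s = (\<Sum>\<pi>'\<in>pairings n. act_mat n x \<pi>' \<pi> *\<^sub>C std_basis n \<pi>') s" .
qed simp

theorem proposition5:
  fixes n \<tau> :: nat
  assumes "n \<ge> 1" and "\<tau> \<ge> 1"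
  shows "is_pseudo_inverse_on (pairings n) (gram n \<tau>) (weingarten_matrix n \<tau>)
    \<and> (\<forall>x \<in> pairing_space n.
          gmult (2 * n) (weingarten_element n \<tau>) x \<in> pairing_space n
        \<and> gmult (2 * n) x (weingarten_element n \<tau>) = gmult (2 * n) (weingarten_element n \<tau>) x)
    \<and> is_matrix_of n (\<lambda>x. gmult (2 * n) (weingarten_element n \<tau>) x) (weingarten_matrix n \<tau>)
    \<and> is_matrix_of n (\<lambda>x. gmult (2 * n) x (weingarten_element n \<tau>)) (weingarten_matrix n \<tau>)"
proof (intro conjI ballI)
  show "is_pseudo_inverse_on (pairings n) (gram n \<tau>) (weingarten_matrix n \<tau>)"
    using assms by (simp add: weingarten_matrix_eq is_pseudo_inverse_spectral_mat)
  show left: "is_matrix_of n (\<lambda>x. gmult (2 * n) (weingarten_element n \<tau>) x) (weingarten_matrix n \<tau>)"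
    using is_matrix_of_act_mat[of n "weingarten_element n \<tau>"] assms
    by (simp add: is_matrix_of_def weingarten_matrix_act)
  then show "is_matrix_of n (\<lambda>x. gmult (2 * n) x (weingarten_element n \<tau>)) (weingarten_matrix n \<tau>)"
    by (simp add: is_matrix_of_def weingarten_element_central[OF std_basis_in])
  fix x assume x: "x \<in> pairing_space n"
  then show "gmult (2 * n) x (weingarten_element n \<tau>) = gmult (2 * n) (weingarten_element n \<tau>) x"
    by (intro weingarten_element_central) (simp add: pairing_space_def)
  \<comment> \<open>Left multiplication commutes with the right multiplications by elements of the
    hyperoctahedral group, so invariance is inherited.\<close>
  show "gmult (2 * n) (weingarten_element n \<tau>) x \<in> pairing_space n"
    using x by (simp add: pairing_space_def gmult_assoc)
qed

end
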